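(* Let $d\ge1$ and let $(\Omega,\mathcal F,\mathbb P)$ be a probability space supporting, for each $N\in\mathbb N$ and $1\le i\le d$, a random Hermitian matrix $A_i^N:\Omega\to\mathfrak h_N$. Assume: (i) for every $k\in\mathbb N$ there is a finite constant $c_A(k)$ with $\sup_{N\in\mathbb N}\sup_{1\le i\le d}\sup_{1\le m,l\le N}\mathbb E\big[|A_i^N(m,l)|^k\big]\le c_A(k)<\infty$; (ii) $\mathbb E[A_i^N(m,l)]=0$ and $\mathbb E[|A_i^N(m,l)|^2]=1$ for all $N$, $1\le i\le d$ and $1\le m,l\le N$; (iii) there is $\kappa>0$ such that for every $p\in\mathbb N$, $\sup_{N\in\mathbb N}\sup_{1\le i\le d}\mathbb E\big[N^{-p/2}\|A_i^N\|_{\mathrm{op}}^p\big]\le \kappa^p\,\Gamma(\tfrac p2+1)$; (iv) for each $N$, the $\sigma$-algebras $\bigvee_{i=1}^d\sigma\big(A_i^N(m,l)\big)$, $1\le m\le l\le N$, are independent; (v) $\mathbb E\big[\overline{A_i^N(m,l)}\,A_j^N(m,l)\big]=0$ for all $i\ne j$, all $N$ and all $1\le m,l\le N$. Let $\gamma\in\mathcal X$ and, for $0\le s\le t\le T$, let $Z_\gamma^N(s,t)$ be the $U(N;\mathbb C)$-valued solution (in the variable $t$, started at time $s$) of $$dZ_\gamma^N(s,t)=\frac{i}{\sqrt N}\sum_{j=1}^d Z_\gamma^N(s,t)A_j^N\,d\gamma_t^j,\qquad Z_\gamma^N(s,s)=I_N,$$ where $i=\sqrt{-1}$. Then for all $0\le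 s\le t\le T$ the limit $$K_\gamma(s,t):=\lim_{N\to\infty}\frac1N\,\mathbb E\big[\mathrm{tr}\big(Z_\gamma^N(s,t)\big)\big]$$ exists, and $K_\gamma$ solves the functional equation $$K_\gamma(s,t)=1-\int_s^t\int_s^r K_\gamma(s,u)\,K_\gamma(u,r)\,\langle d\gamma_u,d\gamma_r\rangle,\qquad K_\gamma(s,s)=K_\gamma(t,t)=1 .$$
   Context: $V=\mathbb R^d$ carries its standard inner product $\langle\cdot,\cdot\rangle$, with norm $\|\cdot\|$; coordinates are with respect to the standard basis. Fix $T>0$. $\mathcal X$ is the set of continuous paths $\gamma:[0,T]\to V$ with $\gamma_0=0$ and finite 1-variation $\sup_{\{t_i\}}\sum_i\|\gamma_{t_{i+1}}-\gamma_{t_i}\|<\infty$ (supremum over partitions of $[0,T]$). The double integral is an iterated Stieltjes integral: $\int_s^t\int_s^r f(u,r)\langle d\gamma_u,d\gamma_r\rangle=\sum_{j=1}^d\int_s^t\Big(\int_s^r f(u,r)\,d\gamma_u^j\Big)d\gamma_r^j$. $\mathfrak h_N$ is the set of $N\times N$ complex Hermitian matrices, $U(N;\mathbb C)$ the group of $N\times N$ unitary matrices, $A(m,l)$ the $(m,l)$ entry of $A$, $\|\cdot\|_{\mathrm{op}}$ the operator norm, and $\Gamma$ the Gamma function. *)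

theory Defs
  imports
    "HOL-Probability.Probability"
    "Jordan_Normal_Form.Schur_Decomposition"
begin

text \<open>The members of a (tagged) division of a compact interval are nonempty compact intervals
  \<open>k = {Inf k..Sup k}\<close>; degenerate members contribute \<open>0\<close> to the sums below.\<close>

definition finite_1_variation :: "(real \<Rightarrow> 'v::real_normed_vector) \<Rightarrow> real \<Rightarrow> real \<Rightarrow> bool" where
  "finite_1_variation \<gamma> a b \<longleftrightarrow>
     bdd_above {(\<Sum>k\<in>D. norm (\<gamma> (Sup k) - \<gamma> (Inf k))) | D. D division_of {a..b}}"

definition path_space :: "real \<Rightarrow> (real \<Rightarrow> 'v::real_normed_vector) set" where
  "path_space T = {\<gamma>. continuous_on {0..T} \<gamma> \<and> \<gamma> 0 = 0 \<and> finite_1_variation \<gamma> 0 T}"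

text \<open>The Riemann--Stieltjes integral of \<open>f\<close> against \<open>g\<close> over \<open>[a, b]\<close> exists, as a limit over the
  mesh of the division, and equals \<open>I\<close>. For \<open>a \<le> b\<close> the value \<open>I\<close> is unique.\<close>

definition has_RS_integral ::
  "(real \<Rightarrow> 'v::real_normed_vector) \<Rightarrow> (real \<Rightarrow> real) \<Rightarrow> real \<Rightarrow> real \<Rightarrow> 'v \<Rightarrow> bool" where
  "has_RS_integral f g a b I \<longleftrightarrow>
     (\<forall>\<epsilon>>0. \<exists>\<delta>>0. \<forall>p. p tagged_division_of {a..b} \<and> (\<forall>(x, k)\<in>p. Sup k - Inf k < \<delta>) \<longrightarrow>
        norm ((\<Sum>(x, k)\<in>p. (g (Sup k) - g (Inf k)) *\<^sub>R f x) - I) < \<epsilon>)"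

text \<open>\<open>I = \<Sum>j. \<integral>\<^sub>s\<^sup>t (\<integral>\<^sub>s\<^sup>r f u r d\<gamma>\<^sub>u\<^sup>j) d\<gamma>\<^sub>r\<^sup>j\<close>, where \<open>G j r\<close> is the inner integral and \<open>J j\<close> the
  \<open>j\<close>-th outer one; all of these integrals are required to exist.\<close>

definition has_RS_double_integral ::
  "(real \<Rightarrow> real \<Rightarrow> 'v::real_normed_vector) \<Rightarrow> (real \<Rightarrow> real^'d) \<Rightarrow> real \<Rightarrow> real \<Rightarrow> 'v \<Rightarrow> bool" where
  "has_RS_double_integral f \<gamma> s t I \<longleftrightarrow>
     (\<exists>G J. (\<forall>j. \<forall>r\<in>{s..t}. has_RS_integral (\<lambda>u. f u r) (\<lambda>u. \<gamma> u $ j) s r (G j r)) \<and>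
            (\<forall>j. has_RS_integral (G j) (\<lambda>r. \<gamma> r $ j) s t (J j)) \<and>
            I = (\<Sum>j\<in>UNIV. J j))"

definition hermitian_mats :: "nat \<Rightarrow> complex mat set" where
  "hermitian_mats N = {A \<in> carrier_mat N N. mat_adjoint A = A}"

definition unitary_mats :: "nat \<Rightarrow> complex mat set" where
  "unitary_mats N = {U \<in> carrier_mat N N. U * mat_adjoint U = 1\<^sub>m N \<and> mat_adjoint U * U = 1\<^sub>m N}"

definition mat_trace :: "complex mat \<Rightarrow> complex" where
  "mat_trace A = (\<Sum>m<dim_row A. A $$ (m, m))"

definition euclid_norm :: "complex Matrix.vec \<Rightarrow> real" where
  "euclid_norm v = sqrt (\<Sum>m<dim_vec v. (cmod (vec_index v m))\<^sup>2)"

definition op_norm :: "complex mat \<Rightarrow> real" where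
  "op_norm A = Sup {euclid_norm (A *\<^sub>v v) | v. v \<in> carrier_vec (dim_col A) \<and> euclid_norm v \<le> 1}"

text \<open>\<open>Z\<close> is a continuous path on \<open>[s, T]\<close> in the unitary group solving, in integrated form and
  entry by entry, \<open>dZ\<^sub>t = (\<i> / \<surd>N) \<Sum>j. Z\<^sub>t A\<^sub>j d\<gamma>\<^sub>t\<^sup>j\<close> with \<open>Z\<^sub>s = I\<^sub>N\<close>;
  \<open>J j\<close> is the integral of the \<open>(m, l)\<close> entry of \<open>Z A\<^sub>j\<close> against \<open>\<gamma>\<^sup>j\<close>.\<close>

definition unitary_CDE_solution ::
  "nat \<Rightarrow> ('d::finite \<Rightarrow> complex mat) \<Rightarrow> (real \<Rightarrow> real^'d) \<Rightarrow> real \<Rightarrow> real \<Rightarrow> (real \<Rightarrow> complex mat) \<Rightarrow> bool"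
  where
  "unitary_CDE_solution N A \<gamma> s T Z \<longleftrightarrow>
     (\<forall>t\<in>{s..T}. Z t \<in> unitary_mats N) \<and>
     (\<forall>m<N. \<forall>l<N. continuous_on {s..T} (\<lambda>t. Z t $$ (m, l))) \<and>
     Z s = 1\<^sub>m N \<and>
     (\<forall>t\<in>{s..T}. \<forall>m<N. \<forall>l<N. \<exists>J.
        (\<forall>j. has_RS_integral (\<lambda>u. (Z u * A j) $$ (m, l)) (\<lambda>u. \<gamma> u $ j) s t (J j)) \<and>
        Z t $$ (m, l) = Z s $$ (m, l) + \<i> / complex_of_real (sqrt (real N)) * (\<Sum>j\<in>UNIV. J j))"

text \<open>The join over \<open>i\<close> of the \<open>\<sigma>\<close>-algebras generated by the \<open>(m, l)\<close> entries of the \<open>A i\<close>.\<close>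

definition entry_sigma ::
  "'w measure \<Rightarrow> ('d \<Rightarrow> 'w \<Rightarrow> complex mat) \<Rightarrow> nat \<times> nat \<Rightarrow> 'w set set" where
  "entry_sigma M A ml =
     sigma_sets (space M) (\<Union>i. sets (vimage_algebra (space M) (\<lambda>\<omega>. A i \<omega> $$ ml) borel))"

end

theory Submission
  imports Defs
begin

text \<open>A linear equation driven by a path of bounded variation is solved by its Picard series:
\<open>Z(s,t) = \<Sum>w. (\<i>/\<surd>N)^|w| sig(w;s,t) A\<^sub>w\<close>, where \<open>w\<close> runs over the words in the letters \<open>'d\<close>,
\<open>sig(w;s,t)\<close> is the iterated Stieltjes integral of \<open>\<gamma>\<close> along \<open>w\<close> and \<open>A\<^sub>w\<close> is the product of the matrices
(\<open>CDE_solution_sums\<close>). Hence \<open>(1/N) E tr Z\<close> is a series whose random part consists of the moments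
\<open>N^(-|w|/2-1) E tr A\<^sub>w\<close> (\<open>expected_trace_series\<close>).

By Wigner's argument these moments converge to the number of noncrossing pairings of the
positions of \<open>w\<close> that only join equal letters (\<open>trace_moment_limit\<close>). The bound on the operator norms
gives \<open>|N^(-n/2-1) E tr A\<^sub>w| \<le> d \<kappa>^n \<Gamma>(n/2+1)\<close> for \<open>n = |w|\<close>, while
\<open>|sig(w;s,t)| \<le> L^n/n!\<close> with the total variation \<open>L\<close> of \<open>\<gamma>\<close>; as
\<open>\<Gamma>(n/2+1) \<le> \<surd>(n!)\<close>, the series is dominated uniformly in \<open>N\<close> and Tannery's theorem lets the limit
be taken term by term. So \<open>K = \<Sum>n. \<i>^n \<Sum>w. pairings(w) sig(w;s,t)\<close>.

In a noncrossing pairing of a word, the partner of the last letter \<open>j\<close> cuts the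
word into \<open>p j q j\<close>, and \<open>p\<close> and \<open>q\<close> are then paired separately. Iterated integrals follow the same
pattern: \<open>\<integral>\<^sub>s\<^sup>r sig(p;s,u) sig(q;u,r) d\<gamma>\<^sup>j\<^sub>u = sig(p j q;s,r)\<close> (\<open>rs_sig_mult_sig\<close>), and one further
integration appends the last \<open>j\<close>. Summing over all words, the sum over the cut is a Cauchy product,
which turns the right-hand side into \<open>1 - \<integral>\<integral> K(s,u) K(u,r) \<langle>d\<gamma>\<^sub>u,d\<gamma>\<^sub>r\<rangle>\<close>; the sign is \<open>\<i>\<^sup>2\<close>.

\<open>E tr A\<^sub>w\<close> is a sum over closed walks in \<open>{..<N}\<close> of expectations of products of
entries. A walk of length \<open>n + 1\<close> that uses some edge just once contributes \<open>0\<close>; if every edge is used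
at least twice, a walk with the maximal number of vertices is a doubly traversed tree, and removing the
last step together with the opposite step on the same edge leaves two closed walks that share no edge.
By independence the expectation factorises in the same way as the recursion for the pairings. The
remaining walks have too few vertices: they are fewer by a factor \<open>\<surd>N\<close> and disappear in the limit.

Words, and the vertex lists of walks, are stored with the \<^emph>\<open>last\<close> letter first, so that appending a
letter to a word, a factor to a product and an outer integral to an iterated integral are all \<open>#\<close>.\<close>

section \<open>Stieltjes integrals against a path controlled by a monotone function\<close>

lemma increment_le_from_local:
  fixes F :: "real \<Rightarrow> complex" and H :: "real \<Rightarrow> real"
  assumes "a \<le> b" "\<delta> > 0"
    and loc: "\<And>x y. a \<le> x \<Longrightarrow> x \<le> y \<Longrightarrow> y \<le> b \<Longrightarrow> y - x < \<delta> \<Longrightarrow> norm (F y - F x) \<le> H y - H x"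
  shows "norm (F b - F a) \<le> H b - H a"
proof -
  obtain n :: nat where n: "(b - a) / \<delta> < real n"
    using reals_Archimedean2 by blast
  have "0 \<le> (b - a) / \<delta>" using assms(1,2) by simp
  hence n0: "n > 0" using n by (cases n) auto
  define h where "h = (b - a) / real n"
  have h0: "h \<ge> 0" using assms(1) by (simp add: h_def)
  have hd: "h < \<delta>" using n n0 assms(2) by (simp add: h_def field_simps)
  define t where "t k = a + real k * h" for k :: nat
  have tn: "t n = b" using n0 by (simp add: t_def h_def)
  have t0: "t 0 = a" by (simp add: t_def)
  have tb: "t k \<le> b" if "k \<le> n" for k
  proof -
    have "t k \<le> t n" using that h0 by (simp add: t_def mult_right_mono)
    thus ?thesis by (simp add: tn)
  qed
  have "norm (F b - F a) = norm (\<Sum>k<n. F (t (Suc k)) - F (t k))"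
    by (subst sum_lessThan_telescope) (simp add: tn t0)
  also have "\<dots> \<le> (\<Sum>k<n. norm (F (t (Suc k)) - F (t k)))" by (rule norm_sum)
  also have "\<dots> \<le> (\<Sum>k<n. H (t (Suc k)) - H (t k))"
  proof (rule sum_mono)
    fix k assume "k \<in> {..<n}"
    hence "k < n" by simp
    show "norm (F (t (Suc k)) - F (t k)) \<le> H (t (Suc k)) - H (t k)"
    proof (rule loc)
      show "a \<le> t k" using h0 by (simp add: t_def)
      show "t k \<le> t (Suc k)" using h0 by (simp add: t_def mult_right_mono)
      show "t (Suc k) \<le> b" using tb \<open>k < n\<close> by simp
      show "t (Suc k) - t k < \<delta>" using hd by (simp add: t_def algebra_simps)
    qed
  qed
  also have "\<dots> = H b - H a" by (subst sum_lessThan_telescope) (simp add: tn t0)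
  finally show ?thesis .
qed

lemma has_RS_integral_unique:
  assumes "a \<le> b" "has_RS_integral f g a b I" "has_RS_integral f g a b J"
  shows "I = J"
proof (rule ccontr)
  assume "I \<noteq> J"
  define e where "e = norm (I - J) / 2"
  have e: "e > 0" using \<open>I \<noteq> J\<close> by (simp add: e_def)
  obtain d1 where d1: "d1 > 0" "\<And>p. p tagged_division_of {a..b} \<Longrightarrow> (\<forall>(x, k)\<in>p. Sup k - Inf k < d1) \<Longrightarrow>
        norm ((\<Sum>(x, k)\<in>p. (g (Sup k) - g (Inf k)) *\<^sub>R f x) - I) < e"
    using assms(2) e unfolding has_RS_integral_def by meson
  obtain d2 where d2: "d2 > 0" "\<And>p. p tagged_division_of {a..b} \<Longrightarrow> (\<forall>(x, k)\<in>p. Sup k - Inf k < d2) \<Longrightarrow>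
        norm ((\<Sum>(x, k)\<in>p. (g (Sup k) - g (Inf k)) *\<^sub>R f x) - J) < e"
    using assms(3) e unfolding has_RS_integral_def by meson
  define d where "d = min d1 d2"
  have "gauge (\<lambda>x::real. ball x (d/2))" using d1(1) d2(1) by (auto simp: d_def gauge_def)
  then obtain p where p: "p tagged_division_of (cbox a b)" "(\<lambda>x. ball x (d/2)) fine p"
    using fine_division_exists by blast
  have small: "Sup k - Inf k < d" if "(x, k) \<in> p" for x k
  proof -
    obtain u v where k: "k = cbox u v" using p(1) \<open>(x,k)\<in>p\<close> by blast
    have "x \<in> k" using p(1) that by blast
    hence uv: "u \<le> v" using k by auto
    have "k \<subseteq> ball x (d/2)" using p(2) that unfolding fine_def by blast
    hence "u \<in> ball x (d/2)" "v \<in> ball x (d/2)" using k uv by auto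
    hence "v - u < d" unfolding mem_ball dist_real_def by linarith
    thus ?thesis using k uv by simp
  qed
  let ?S = "\<Sum>(x, k)\<in>p. (g (Sup k) - g (Inf k)) *\<^sub>R f x"
  have "norm (?S - I) < e" using p small by (intro d1(2)) (fastforce simp: d_def)+
  moreover have "norm (?S - J) < e" using p small by (intro d2(2)) (fastforce simp: d_def)+
  ultimately have "norm (I - J) < 2 * e"
    using norm_triangle_ineq4[of "?S - J" "?S - I"] by simp
  thus False by (simp add: e_def)
qed

text \<open>The typical \<open>V\<close> is the total variation of the path with components \<open>g j\<close>; all estimates below are
expressed through the increments of \<open>V\<close>.\<close>

locale controlled_path =
  fixes g :: "'d::finite \<Rightarrow> real \<Rightarrow> real" and V :: "real \<Rightarrow> real" and T :: real
  assumes control: "0 \<le> x \<Longrightarrow> x \<le> y \<Longrightarrow> y \<le> T \<Longrightarrow> \<bar>g j y - g j x\<bar> \<le> V y - V x"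
    and continuous_V: "continuous_on {0..T} V"
begin

text \<open>An indefinite integral of \<open>f\<close> against \<open>g j\<close>, described locally: over a short interval the increment of
\<open>F\<close> is that of \<open>g j\<close> times any value of \<open>f\<close>, up to a small multiple of the increment of \<open>V\<close>. The
error telescopes over partitions, so this condition yields existence of the Riemann--Stieltjes integral
on every subinterval at once, and estimates for \<open>F\<close> follow without ever writing a Riemann sum.\<close>

definition is_primitive :: "'d \<Rightarrow> (real \<Rightarrow> complex) \<Rightarrow> (real \<Rightarrow> complex) \<Rightarrow> real \<Rightarrow> real \<Rightarrow> bool" where
  "is_primitive j f F a b \<longleftrightarrow> (\<forall>\<epsilon>>0. \<exists>\<delta>>0. \<forall>x z y. a \<le> x \<longrightarrow> x \<le> z \<longrightarrow> z \<le> y \<longrightarrow> y \<le> b \<longrightarrow> y - x < \<delta> \<longrightarrow>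
     norm (F y - F x - (g j y - g j x) *\<^sub>R f z) \<le> \<epsilon> * (V y - V x))"

definition rs :: "'d \<Rightarrow> (real \<Rightarrow> complex) \<Rightarrow> real \<Rightarrow> real \<Rightarrow> complex" where
  "rs j f a b = (THE I. has_RS_integral f (g j) a b I)"

lemma V_mono: "0 \<le> x \<Longrightarrow> x \<le> y \<Longrightarrow> y \<le> T \<Longrightarrow> V x \<le> V y"
  using control[of x y undefined] by linarith

lemma is_primitiveD:
  assumes "is_primitive j f F a b" "\<epsilon> > 0"
  obtains \<delta> where "\<delta> > 0" "\<And>x z y. a \<le> x \<Longrightarrow> x \<le> z \<Longrightarrow> z \<le> y \<Longrightarrow> y \<le> b \<Longrightarrow> y - x < \<delta> \<Longrightarrow>
     norm (F y - F x - (g j y - g j x) *\<^sub>R f z) \<le> \<epsilon> * (V y - V x)"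
  using assms unfolding is_primitive_def by meson

lemma is_primitive_subinterval:
  assumes "is_primitive j f F a b" "a \<le> a'" "b' \<le> b"
  shows "is_primitive j f F a' b'"
  using assms unfolding is_primitive_def by (meson order_trans)

lemma is_primitive_cong:
  assumes "is_primitive j f F a b" "\<And>x. a \<le> x \<Longrightarrow> x \<le> b \<Longrightarrow> f x = f' x" "\<And>x. a \<le> x \<Longrightarrow> x \<le> b \<Longrightarrow> F x = F' x + c"
  shows "is_primitive j f' F' a b"
  unfolding is_primitive_def
proof (intro allI impI)
  fix \<epsilon> :: real assume "\<epsilon> > 0"
  then obtain \<delta> where "\<delta> > 0" and d: "\<And>x z y. a \<le> x \<Longrightarrow> x \<le> z \<Longrightarrow> z \<le> y \<Longrightarrow> y \<le> b \<Longrightarrow> y - x < \<delta> \<Longrightarrow>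
     norm (F y - F x - (g j y - g j x) *\<^sub>R f z) \<le> \<epsilon> * (V y - V x)" using assms(1) is_primitiveD by metis
  show "\<exists>\<delta>>0. \<forall>x z y. a \<le> x \<longrightarrow> x \<le> z \<longrightarrow> z \<le> y \<longrightarrow> y \<le> b \<longrightarrow> y - x < \<delta> \<longrightarrow>
          norm (F' y - F' x - (g j y - g j x) *\<^sub>R f' z) \<le> \<epsilon> * (V y - V x)"
  proof (intro exI[of _ \<delta>] conjI allI impI \<open>\<delta> > 0\<close>)
    fix x z y assume h: "a \<le> x" "x \<le> z" "z \<le> y" "y \<le> b" "y - x < \<delta>"
    show "norm (F' y - F' x - (g j y - g j x) *\<^sub>R f' z) \<le> \<epsilon> * (V y - V x)"
      using d[OF h] assms(2)[of z] assms(3)[of x] assms(3)[of y] h by simp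
  qed
qed

lemma is_primitive_add:
  assumes "is_primitive j f F a b" "is_primitive j h H a b"
  shows "is_primitive j (\<lambda>x. f x + h x) (\<lambda>x. F x + H x) a b"
  unfolding is_primitive_def
proof (intro allI impI)
  fix \<epsilon> :: real assume "\<epsilon> > 0"
  hence e: "\<epsilon>/2 > 0" by simp
  obtain \<delta>1 where d1: "\<delta>1 > 0" "\<And>x z y. a \<le> x \<Longrightarrow> x \<le> z \<Longrightarrow> z \<le> y \<Longrightarrow> y \<le> b \<Longrightarrow> y - x < \<delta>1 \<Longrightarrow>
     norm (F y - F x - (g j y - g j x) *\<^sub>R f z) \<le> \<epsilon>/2 * (V y - V x)" using is_primitiveD[OF assms(1) e] by blast
  obtain \<delta>2 where d2: "\<delta>2 > 0" "\<And>x z y. a \<le> x \<Longrightarrow> x \<le> z \<Longrightarrow> z \<le> y \<Longrightarrow> y \<le> b \<Longrightarrow> y - x < \<delta>2 \<Longrightarrow>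
     norm (H y - H x - (g j y - g j x) *\<^sub>R h z) \<le> \<epsilon>/2 * (V y - V x)" using is_primitiveD[OF assms(2) e] by blast
  show "\<exists>\<delta>>0. \<forall>x z y. a \<le> x \<longrightarrow> x \<le> z \<longrightarrow> z \<le> y \<longrightarrow> y \<le> b \<longrightarrow> y - x < \<delta> \<longrightarrow>
          norm (F y + H y - (F x + H x) - (g j y - g j x) *\<^sub>R (f z + h z)) \<le> \<epsilon> * (V y - V x)"
  proof (intro exI[of _ "min \<delta>1 \<delta>2"] conjI allI impI)
    fix x z y assume h: "a \<le> x" "x \<le> z" "z \<le> y" "y \<le> b" "y - x < min \<delta>1 \<delta>2"
    have "norm (F y + H y - (F x + H x) - (g j y - g j x) *\<^sub>R (f z + h z))
      \<le> norm (F y - F x - (g j y - g j x) *\<^sub>R f z) + norm (H y - H x - (g j y - g j x) *\<^sub>R h z)"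
      by (rule order_trans[OF _ norm_triangle_ineq]) (simp add: algebra_simps)
    also have "\<dots> \<le> \<epsilon>/2 * (V y - V x) + \<epsilon>/2 * (V y - V x)"
      using h by (intro add_mono d1 d2) auto
    finally show "norm (F y + H y - (F x + H x) - (g j y - g j x) *\<^sub>R (f z + h z)) \<le> \<epsilon> * (V y - V x)"
      by (simp add: field_simps)
  qed (use d1 d2 in auto)
qed

lemma is_primitive_cmult:
  assumes "is_primitive j f F a b"
  shows "is_primitive j (\<lambda>x. c * f x) (\<lambda>x. c * F x) a b"
  unfolding is_primitive_def
proof (intro allI impI)
  fix \<epsilon> :: real assume "\<epsilon> > 0"
  hence e: "\<epsilon>/(1 + norm c) > 0" by (simp add: add_pos_nonneg)
  obtain \<delta> where d: "\<delta> > 0" "\<And>x z y. a \<le> x \<Longrightarrow> x \<le> z \<Longrightarrow> z \<le> y \<Longrightarrow> y \<le> b \<Longrightarrow> y - x < \<delta> \<Longrightarrow>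
     norm (F y - F x - (g j y - g j x) *\<^sub>R f z) \<le> \<epsilon>/(1 + norm c) * (V y - V x)" using is_primitiveD[OF assms(1) e] by blast
  show "\<exists>\<delta>>0. \<forall>x z y. a \<le> x \<longrightarrow> x \<le> z \<longrightarrow> z \<le> y \<longrightarrow> y \<le> b \<longrightarrow> y - x < \<delta> \<longrightarrow>
          norm (c * F y - c * F x - (g j y - g j x) *\<^sub>R (c * f z)) \<le> \<epsilon> * (V y - V x)"
  proof (intro exI[of _ \<delta>] conjI allI impI \<open>\<delta> > 0\<close>)
    fix x z y assume h: "a \<le> x" "x \<le> z" "z \<le> y" "y \<le> b" "y - x < \<delta>"
    have eq: "c * F y - c * F x - (g j y - g j x) *\<^sub>R (c * f z) = c * (F y - F x - (g j y - g j x) *\<^sub>R f z)"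
      by (simp add: scaleR_conv_of_real algebra_simps)
    have "norm (c * F y - c * F x - (g j y - g j x) *\<^sub>R (c * f z)) 
        \<le> (1 + norm c) * norm (F y - F x - (g j y - g j x) *\<^sub>R f z)"
      unfolding eq norm_mult by (rule mult_right_mono) auto
    also have "\<dots> \<le> (1 + norm c) * (\<epsilon>/(1 + norm c) * (V y - V x))"
      by (intro mult_left_mono d h) auto
    also have "\<dots> = \<epsilon> * (V y - V x)"
    proof -
      have "1 + norm c \<noteq> 0" using norm_ge_zero[of c] by linarith
      thus ?thesis by simp
    qed
    finally show "norm (c * F y - c * F x - (g j y - g j x) *\<^sub>R (c * f z)) \<le> \<epsilon> * (V y - V x)" .
  qed
qed

text \<open>Locally the increments of \<open>F\<close> are dominated by those of \<open>H + \<epsilon> V\<close>, and domination of increments on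
short intervals adds up to domination on long ones. Choosing \<open>H\<close> constant times \<open>V\<close>, or times a power
of \<open>V\<close>, gives the two estimates that follow.\<close>

lemma is_primitive_bound:
  assumes prim: "is_primitive j f F a b" and ab: "0 \<le> a" "a \<le> b" "b \<le> T"
    and H: "\<And>x y. a \<le> x \<Longrightarrow> x \<le> y \<Longrightarrow> y \<le> b \<Longrightarrow> norm (f x) * (V y - V x) \<le> H y - H x"
  shows "norm (F b - F a) \<le> H b - H a"
proof (rule field_le_epsilon)
  fix e :: real assume "e > 0"
  define \<epsilon> where "\<epsilon> = e / (1 + (V b - V a))"
  have Vab: "V a \<le> V b" using V_mono ab by simp
  have e: "\<epsilon> > 0" using Vab \<open>e > 0\<close> by (simp add: \<epsilon>_def)
  obtain \<delta> where d: "\<delta> > 0" "\<And>x z y. a \<le> x \<Longrightarrow> x \<le> z \<Longrightarrow> z \<le> y \<Longrightarrow> y \<le> b \<Longrightarrow> y - x < \<delta> \<Longrightarrow>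
     norm (F y - F x - (g j y - g j x) *\<^sub>R f z) \<le> \<epsilon> * (V y - V x)" using is_primitiveD[OF prim e] by blast
  have "norm (F b - F a) \<le> (H b + \<epsilon> * V b) - (H a + \<epsilon> * V a)"
  proof (rule increment_le_from_local[OF ab(2) d(1), where H = "\<lambda>x. H x + \<epsilon> * V x"])
    fix x y assume h: "a \<le> x" "x \<le> y" "y \<le> b" "y - x < \<delta>"
    have "norm (F y - F x) \<le> norm (F y - F x - (g j y - g j x) *\<^sub>R f x) + norm ((g j y - g j x) *\<^sub>R f x)"
      by (rule order_trans[OF _ norm_triangle_ineq]) simp
    also have "\<dots> \<le> \<epsilon> * (V y - V x) + (V y - V x) * norm (f x)"
      unfolding norm_scaleR using h ab by (intro add_mono d mult_right_mono) (auto intro!: control)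
    also have "\<dots> \<le> \<epsilon> * (V y - V x) + (H y - H x)" using H[OF h(1-3)] by (simp add: mult.commute)
    finally show "norm (F y - F x) \<le> H y + \<epsilon> * V y - (H x + \<epsilon> * V x)" by (simp add: algebra_simps)
  qed
  also have "\<dots> = H b - H a + \<epsilon> * (V b - V a)" by (simp add: algebra_simps)
  also have "\<epsilon> * (V b - V a) \<le> \<epsilon> * (1 + (V b - V a))" using e by (intro mult_left_mono) auto
  also have "\<dots> = e" using Vab by (simp add: \<epsilon>_def)
  finally show "norm (F b - F a) \<le> H b - H a + e" by simp
qed

lemma is_primitive_bound_const:
  assumes prim: "is_primitive j f F a b" and ab: "0 \<le> a" "a \<le> b" "b \<le> T"
    and B: "\<And>x. a \<le> x \<Longrightarrow> x \<le> b \<Longrightarrow> norm (f x) \<le> B"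
  shows "norm (F b - F a) \<le> B * (V b - V a)"
proof -
  have "norm (F b - F a) \<le> B * V b - B * V a"
  proof (rule is_primitive_bound[OF prim ab])
    fix x y assume "a \<le> x" "x \<le> y" "y \<le> b"
    hence "norm (f x) * (V y - V x) \<le> B * (V y - V x)"
      using V_mono[of x y] ab by (intro mult_right_mono B) auto
    thus "norm (f x) * (V y - V x) \<le> B * V y - B * V x" by (simp add: algebra_simps)
  qed
  thus ?thesis by (simp add: algebra_simps)
qed

lemma power_Suc_increment:
  fixes u v :: real
  assumes "0 \<le> u" "u \<le> v"
  shows "real (Suc n) * u ^ n * (v - u) \<le> v ^ Suc n - u ^ Suc n"
proof -
  have "(\<Sum>i<Suc n. u ^ n) \<le> (\<Sum>i<Suc n. v ^ (n - i) * u ^ i)"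
  proof (rule sum_mono)
    fix i assume "i \<in> {..<Suc n}"
    hence "u ^ n = u ^ (n - i) * u ^ i" by (simp flip: power_add)
    also have "\<dots> \<le> v ^ (n - i) * u ^ i" using assms by (intro mult_right_mono power_mono) auto
    finally show "u ^ n \<le> v ^ (n - i) * u ^ i" .
  qed
  hence "(v - u) * (real (Suc n) * u ^ n) \<le> (v - u) * (\<Sum>i<Suc n. v ^ (n - i) * u ^ i)"
    using assms by (intro mult_left_mono) auto
  also have "\<dots> = v ^ Suc n - u ^ Suc n"
  proof -
    have "u ^ Suc n - v ^ Suc n = (u - v) * (\<Sum>i<Suc n. v ^ (n - i) * u ^ i)"
      using power_diff_sumr2[of u "Suc n" v] by simp
    thus ?thesis by (simp add: algebra_simps del: sum.lessThan_Suc power_Suc)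
  qed
  finally show ?thesis by (simp add: mult_ac)
qed

text \<open>The estimate \<open>\<integral> (V x - V a)^n / n! dV \<le> (V b - V a)^(n+1) / (n+1)!\<close>, which is the source of all
factorials below.\<close>

lemma is_primitive_bound_power:
  assumes prim: "is_primitive j f F a b" and ab: "0 \<le> a" "a \<le> b" "b \<le> T" and C: "0 \<le> C"
    and B: "\<And>x. a \<le> x \<Longrightarrow> x \<le> b \<Longrightarrow> norm (f x) \<le> C * (V x - V a) ^ n / fact n"
  shows "norm (F b - F a) \<le> C * (V b - V a) ^ Suc n / fact (Suc n)"
proof -
  let ?H = "\<lambda>x. C * (V x - V a) ^ Suc n / fact (Suc n)"
  have "norm (F b - F a) \<le> ?H b - ?H a"
  proof (rule is_primitive_bound[OF prim ab])
    fix x y assume h: "a \<le> x" "x \<le> y" "y \<le> b"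
    have m: "V a \<le> V x" "V x \<le> V y" using V_mono h ab by auto
    have "norm (f x) * (V y - V x) \<le> C * (V x - V a) ^ n / fact n * (V y - V x)"
      using B[of x] h m by (intro mult_right_mono) auto
    also have "\<dots> = C / fact (Suc n) * (real (Suc n) * (V x - V a) ^ n * ((V y - V a) - (V x - V a)))"
      by (simp add: field_simps del: of_nat_Suc)
    also have "\<dots> \<le> C / fact (Suc n) * ((V y - V a) ^ Suc n - (V x - V a) ^ Suc n)"
      using C m by (intro mult_left_mono power_Suc_increment) auto
    also have "\<dots> = ?H y - ?H x" by (simp add: right_diff_distrib diff_divide_distrib)
    finally show "norm (f x) * (V y - V x) \<le> ?H y - ?H x" .
  qed
  thus ?thesis by simp
qed

text \<open>Over a tagged division, the increments of \<open>F\<close> and of \<open>V\<close> both telescope, so the local errors add up to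
at most \<open>\<epsilon> (V b - V a)\<close>.\<close>

lemma is_primitive_has_RS_integral:
  assumes prim: "is_primitive j f F a b" and ab: "0 \<le> a" "a \<le> b" "b \<le> T"
  shows "has_RS_integral f (g j) a b (F b - F a)"
  unfolding has_RS_integral_def
proof (intro allI impI)
  fix e :: real assume "e > 0"
  define \<epsilon> where "\<epsilon> = e / (1 + (V b - V a))"
  have Vab: "V a \<le> V b" using V_mono ab by simp
  have e: "\<epsilon> > 0" using Vab \<open>e > 0\<close> by (simp add: \<epsilon>_def)
  obtain \<delta> where d: "\<delta> > 0" "\<And>x z y. a \<le> x \<Longrightarrow> x \<le> z \<Longrightarrow> z \<le> y \<Longrightarrow> y \<le> b \<Longrightarrow> y - x < \<delta> \<Longrightarrow>
     norm (F y - F x - (g j y - g j x) *\<^sub>R f z) \<le> \<epsilon> * (V y - V x)" using is_primitiveD[OF prim e] by blast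
  show "\<exists>\<delta>>0. \<forall>p. p tagged_division_of {a..b} \<and> (\<forall>(x, k)\<in>p. Sup k - Inf k < \<delta>) \<longrightarrow>
          norm ((\<Sum>(x, k)\<in>p. (g j (Sup k) - g j (Inf k)) *\<^sub>R f x) - (F b - F a)) < e"
  proof (intro exI[of _ \<delta>] conjI allI impI d(1))
    fix p assume p: "p tagged_division_of {a..b} \<and> (\<forall>(x, k)\<in>p. Sup k - Inf k < \<delta>)"
    note p1 = conjunct1[OF p]
    have "norm ((\<Sum>(x, k)\<in>p. (g j (Sup k) - g j (Inf k)) *\<^sub>R f x) - (F b - F a))
       = norm (\<Sum>(x, k)\<in>p. (F (Sup k) - F (Inf k)) - (g j (Sup k) - g j (Inf k)) *\<^sub>R f x)"
      unfolding additive_tagged_division_1[OF ab(2) p1, of F, symmetric]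
      by (subst norm_minus_commute) (simp add: sum_subtractf case_prod_unfold)
    also have "\<dots> \<le> (\<Sum>(x, k)\<in>p. \<epsilon> * (V (Sup k) - V (Inf k)))"
    proof (rule sum_norm_le, safe)
      fix x k assume xk: "(x, k) \<in> p"
      obtain u v where k: "k = cbox u v" using p1 xk by blast
      have "x \<in> k" using p1 xk by blast
      hence x: "u \<le> x" "x \<le> v" using k by auto
      have "k \<subseteq> {a..b}" using p1 xk by blast
      hence uv: "a \<le> u" "v \<le> b" using k x by auto
      have "Sup k - Inf k < \<delta>" using p xk by blast
      moreover have "Sup k = v" "Inf k = u" using k x by auto
      ultimately show "norm ((F (Sup k) - F (Inf k)) - (g j (Sup k) - g j (Inf k)) *\<^sub>R f x)
         \<le> \<epsilon> * (V (Sup k) - V (Inf k))"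
        using d(2) x uv by simp
    qed
    also have "\<dots> = \<epsilon> * (V b - V a)"
      unfolding additive_tagged_division_1[OF ab(2) p1, of V, symmetric] sum_distrib_left
      by (simp add: case_prod_unfold)
    also have "\<dots> < \<epsilon> * (1 + (V b - V a))" using e by simp
    also have "\<dots> = e" using Vab by (simp add: \<epsilon>_def)
    finally show "norm ((\<Sum>(x, k)\<in>p. (g j (Sup k) - g j (Inf k)) *\<^sub>R f x) - (F b - F a)) < e" .
  qed
qed

lemma rs_eqI: "has_RS_integral f (g j) a b I \<Longrightarrow> a \<le> b \<Longrightarrow> rs j f a b = I"
  unfolding rs_def using has_RS_integral_unique by blast

text \<open>Primitives vanishing at \<open>a\<close> depend on the integrand in a Lipschitz way, even at the level of
increments; hence they converge, and the limit inherits the local condition.\<close>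

lemma is_primitive_limit:
  assumes ab: "0 \<le> a" "a \<le> b" "b \<le> T"
    and prim: "\<And>n. is_primitive j (f n) (F n) a b" and lim: "uniform_limit {a..b} f h sequentially"
  shows "\<exists>H. is_primitive j h H a b"
proof -
  define G where "G n x = F n x - F n a" for n :: nat and x
  have primG: "is_primitive j (f n) (G n) a b" for n
    by (rule is_primitive_cong[OF prim, where c = "F n a"]) (auto simp: G_def)
  have diff: "is_primitive j (\<lambda>x. f n x - f m x) (\<lambda>x. G n x - G m x) a b" for n m
    using is_primitive_add[OF primG[of n] is_primitive_cmult[OF primG[of m], of "-1"]] by simp
  have inc: "norm ((G n y - G m y) - (G n x - G m x)) \<le> 2 * \<epsilon> * (V y - V x)"
    if "\<And>u. u \<in> {a..b} \<Longrightarrow> dist (f n u) (h u) < \<epsilon>" "\<And>u. u \<in> {a..b} \<Longrightarrow> dist (f m u) (h u) < \<epsilon>"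
      "a \<le> x" "x \<le> y" "y \<le> b" for n m \<epsilon> x y
  proof (rule is_primitive_bound_const[OF is_primitive_subinterval[OF diff]])
    fix u assume "x \<le> u" "u \<le> y"
    hence "dist (f n u) (h u) < \<epsilon>" "dist (f m u) (h u) < \<epsilon>" using that by auto
    hence "dist (f n u) (f m u) < 2 * \<epsilon>" by (metis dist_commute dist_triangle_half_l field_sum_of_halves mult_2 nonzero_mult_div_cancel_left zero_neq_numeral)
    thus "norm (f n u - f m u) \<le> 2 * \<epsilon>" by (simp add: dist_norm)
  qed (use that ab in auto)
  have ev: "\<exists>n0. \<forall>n\<ge>n0. \<forall>u\<in>{a..b}. dist (f n u) (h u) < \<epsilon>" if "\<epsilon> > 0" for \<epsilon>
    using lim that unfolding uniform_limit_sequentially_iff by blast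
  have conv: "\<exists>l. (\<lambda>n. G n x) \<longlonglongrightarrow> l" if x: "x \<in> {a..b}" for x
  proof -
    have "Cauchy (\<lambda>n. G n x)"
    proof (rule metric_CauchyI)
      fix e :: real assume "e > 0"
      define \<epsilon> where "\<epsilon> = e / (2 * (1 + (V x - V a)))"
      have Vab: "V a \<le> V x" using V_mono ab x by simp
      have e: "\<epsilon> > 0" using Vab \<open>e > 0\<close> by (simp add: \<epsilon>_def)
      obtain n0 where n0: "\<forall>n\<ge>n0. \<forall>u\<in>{a..b}. dist (f n u) (h u) < \<epsilon>" using ev[OF e] by blast
      have "dist (G m x) (G n x) < e" if "m \<ge> n0" "n \<ge> n0" for m n
      proof -
        have "norm ((G m x - G n x) - (G m a - G n a)) \<le> 2 * \<epsilon> * (V x - V a)"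
          using n0 that x by (intro inc) auto
        also have "\<dots> < \<epsilon> * (2 * (1 + (V x - V a)))" using e by simp
        also have "\<dots> = e" using Vab by (simp add: \<epsilon>_def)
        finally show ?thesis by (simp add: dist_norm G_def)
      qed
      thus "\<exists>M. \<forall>m\<ge>M. \<forall>n\<ge>M. dist (G m x) (G n x) < e" by blast
    qed
    thus ?thesis using Cauchy_convergent convergent_def by blast
  qed
  define H where "H x = lim (\<lambda>n. G n x)" for x
  have H: "(\<lambda>n. G n x) \<longlonglongrightarrow> H x" if "x \<in> {a..b}" for x
    using conv[OF that] unfolding H_def by (metis limI)
  have "is_primitive j h H a b" unfolding is_primitive_def
  proof (intro allI impI)
    fix \<epsilon>' :: real assume "\<epsilon>' > 0"
    define \<epsilon> where "\<epsilon> = \<epsilon>' / 4"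
    have e: "\<epsilon> > 0" using \<open>\<epsilon>' > 0\<close> by (simp add: \<epsilon>_def)
    obtain n where n0: "\<forall>m\<ge>n. \<forall>u\<in>{a..b}. dist (f m u) (h u) < \<epsilon>" using ev[OF e] by blast
    obtain \<delta> where d: "\<delta> > 0" "\<And>x z y. a \<le> x \<Longrightarrow> x \<le> z \<Longrightarrow> z \<le> y \<Longrightarrow> y \<le> b \<Longrightarrow> y - x < \<delta> \<Longrightarrow>
       norm (G n y - G n x - (g j y - g j x) *\<^sub>R f n z) \<le> \<epsilon> * (V y - V x)" using is_primitiveD[OF primG e] by blast
    show "\<exists>\<delta>>0. \<forall>x z y. a \<le> x \<longrightarrow> x \<le> z \<longrightarrow> z \<le> y \<longrightarrow> y \<le> b \<longrightarrow> y - x < \<delta> \<longrightarrow>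
            norm (H y - H x - (g j y - g j x) *\<^sub>R h z) \<le> \<epsilon>' * (V y - V x)"
    proof (intro exI[of _ \<delta>] conjI allI impI d(1))
      fix x z y assume xyz: "a \<le> x" "x \<le> z" "z \<le> y" "y \<le> b" "y - x < \<delta>"
      have 1: "norm ((H y - G n y) - (H x - G n x)) \<le> 2 * \<epsilon> * (V y - V x)"
      proof (rule tendsto_upperbound)
        show "(\<lambda>m. norm ((G m y - G n y) - (G m x - G n x))) \<longlonglongrightarrow> norm ((H y - G n y) - (H x - G n x))"
          using xyz by (intro tendsto_intros H) auto
        show "\<forall>\<^sub>F m in sequentially. norm ((G m y - G n y) - (G m x - G n x)) \<le> 2 * \<epsilon> * (V y - V x)"
          using eventually_ge_at_top[of n] by eventually_elim (use n0 xyz in \<open>intro inc, auto\<close>)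
      qed simp
      have 2: "norm (G n y - G n x - (g j y - g j x) *\<^sub>R f n z) \<le> \<epsilon> * (V y - V x)" using d xyz by blast
      have 3: "norm ((g j y - g j x) *\<^sub>R (f n z - h z)) \<le> (V y - V x) * \<epsilon>"
        unfolding norm_scaleR using n0 xyz ab e
        by (intro mult_mono control) (auto simp: dist_norm less_imp_le intro: V_mono)
      have "H y - H x - (g j y - g j x) *\<^sub>R h z = ((H y - G n y) - (H x - G n x)) +
         ((G n y - G n x - (g j y - g j x) *\<^sub>R f n z) + (g j y - g j x) *\<^sub>R (f n z - h z))"
        by (simp add: algebra_simps)
      hence "norm (H y - H x - (g j y - g j x) *\<^sub>R h z) \<le> norm ((H y - G n y) - (H x - G n x)) +
         (norm (G n y - G n x - (g j y - g j x) *\<^sub>R f n z) + norm ((g j y - g j x) *\<^sub>R (f n z - h z)))"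
        by (metis norm_triangle_le norm_triangle_ineq add_left_mono)
      also have "\<dots> \<le> 2 * \<epsilon> * (V y - V x) + (\<epsilon> * (V y - V x) + (V y - V x) * \<epsilon>)"
        by (intro add_mono 1 2 3)
      also have "\<dots> = (4 * \<epsilon>) * (V y - V x)" by (simp add: algebra_simps)
      also have "\<dots> = \<epsilon>' * (V y - V x)" by (simp add: \<epsilon>_def)
      finally show "norm (H y - H x - (g j y - g j x) *\<^sub>R h z) \<le> \<epsilon>' * (V y - V x)" .
    qed
  qed
  thus ?thesis by blast
qed

text \<open>For a smooth integrand, integration by parts produces the primitive \<open>g f - \<integral> g f'\<close>, which only
needs an ordinary integral. General continuous integrands are uniform limits of polynomials.\<close>

lemma is_primitive_of_C1:
  assumes ab: "0 \<le> a" "a \<le> b" "b \<le> T"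
    and deriv: "\<And>x. (f has_vector_derivative f' x) (at x)" and cont: "continuous_on UNIV f'"
    and cg: "continuous_on {a..b} (g j)"
  shows "\<exists>F. is_primitive j f F a b"
proof -
  obtain B where B: "\<And>x. x \<in> {a..b} \<Longrightarrow> norm (f' x) \<le> B"
  proof -
    have "compact (f' ` {a..b})" using cont by (intro compact_continuous_image continuous_on_subset[OF cont]) auto
    thus ?thesis using that by (metis bounded_iff compact_imp_bounded imageI)
  qed
  have B0: "0 \<le> B" using B[of a] ab by (meson atLeastAtMost_iff norm_ge_zero order_refl order_trans)
  define F where "F x = g j x *\<^sub>R f x - integral {a..x} (\<lambda>u. g j u *\<^sub>R f' u)" for x
  have cgf: "continuous_on {a..b} (\<lambda>u. g j u *\<^sub>R f' u)"
    by (intro continuous_intros cg continuous_on_subset[OF cont]) auto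
  have int_f': "(f' has_integral (f y - f x)) {x..y}" if "x \<le> y" for x y
    using that by (intro fundamental_theorem_of_calculus) (auto intro: has_vector_derivative_at_within deriv)
  have est: "norm (F y - F x - (g j y - g j x) *\<^sub>R f z) \<le> 2 * (B * (V y - V x)) * (y - x)"
    if h: "a \<le> x" "x \<le> z" "z \<le> y" "y \<le> b" for x y z
  proof -
    have mono: "V x \<le> V y" using h ab by (intro V_mono) auto
    have piece: "norm (integral {p..q} (\<lambda>u. g j u *\<^sub>R f' u) - g j w *\<^sub>R (f q - f p)) \<le> (B * (V y - V x)) * (q - p)"
      if "x \<le> p" "p \<le> q" "q \<le> y" "x \<le> w" "w \<le> y" for p q w
    proof -
      have i1: "((\<lambda>u. g j u *\<^sub>R f' u) has_integral integral {p..q} (\<lambda>u. g j u *\<^sub>R f' u)) {p..q}"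
        using that h by (intro integrable_integral integrable_continuous_real continuous_on_subset[OF cgf]) auto
      have "((\<lambda>u. g j u *\<^sub>R f' u - g j w *\<^sub>R f' u) has_integral
          (integral {p..q} (\<lambda>u. g j u *\<^sub>R f' u) - g j w *\<^sub>R (f q - f p))) {p..q}"
        using that by (intro has_integral_diff i1 has_integral_cmul int_f') auto
      moreover have "norm (g j u *\<^sub>R f' u - g j w *\<^sub>R f' u) \<le> B * (V y - V x)" if u: "u \<in> {p..q}" for u
      proof -
        have "\<bar>g j u - g j w\<bar> \<le> V y - V x"
        proof (cases "u \<le> w")
          case True
          have "\<bar>g j w - g j u\<bar> \<le> V w - V u" 
            using True u \<open>x \<le> p\<close> \<open>w \<le> y\<close> h ab by (intro control) auto
          moreover have "V w \<le> V y" "V x \<le> V u" using True u \<open>x \<le> p\<close> \<open>w \<le> y\<close> h ab by (auto intro!: V_mono)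
          ultimately show ?thesis by (simp add: abs_minus_commute)
        next
          case False
          have "\<bar>g j u - g j w\<bar> \<le> V u - V w" 
            using False u \<open>q \<le> y\<close> \<open>x \<le> w\<close> h ab by (intro control) auto
          moreover have "V u \<le> V y" "V x \<le> V w" using False u \<open>q \<le> y\<close> \<open>x \<le> w\<close> h ab by (auto intro!: V_mono)
          ultimately show ?thesis by simp
        qed
        hence "\<bar>g j u - g j w\<bar> * norm (f' u) \<le> (V y - V x) * B"
          using u \<open>x \<le> p\<close> \<open>q \<le> y\<close> h by (intro mult_mono B) auto
        thus ?thesis by (simp flip: scaleR_diff_left add: mult.commute)
      qed
      ultimately have "norm (integral {p..q} (\<lambda>u. g j u *\<^sub>R f' u) - g j w *\<^sub>R (f q - f p)) \<le> (B * (V y - V x)) * measure lborel {p..q}"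
        using B0 mono by (intro has_integral_bound_real[where S = "{}"]) auto
      thus ?thesis using that by simp
    qed
    have split: "integral {a..y} (\<lambda>u. g j u *\<^sub>R f' u) = integral {a..x} (\<lambda>u. g j u *\<^sub>R f' u) +
        integral {x..z} (\<lambda>u. g j u *\<^sub>R f' u) + integral {z..y} (\<lambda>u. g j u *\<^sub>R f' u)"
    proof -
      have c1: "integral {a..x} (\<lambda>u. g j u *\<^sub>R f' u) + integral {x..z} (\<lambda>u. g j u *\<^sub>R f' u) = integral {a..z} (\<lambda>u. g j u *\<^sub>R f' u)"
        using h by (intro Henstock_Kurzweil_Integration.integral_combine integrable_continuous_real continuous_on_subset[OF cgf]) auto
      have c2: "integral {a..z} (\<lambda>u. g j u *\<^sub>R f' u) + integral {z..y} (\<lambda>u. g j u *\<^sub>R f' u) = integral {a..y} (\<lambda>u. g j u *\<^sub>R f' u)"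
        using h by (intro Henstock_Kurzweil_Integration.integral_combine integrable_continuous_real continuous_on_subset[OF cgf]) auto
      show ?thesis using c1 c2 by simp
    qed
    have "F y - F x - (g j y - g j x) *\<^sub>R f z =
       - ((integral {x..z} (\<lambda>u. g j u *\<^sub>R f' u) - g j x *\<^sub>R (f z - f x)) +
          (integral {z..y} (\<lambda>u. g j u *\<^sub>R f' u) - g j y *\<^sub>R (f y - f z)))"
      unfolding F_def split by (simp add: algebra_simps)
    hence "norm (F y - F x - (g j y - g j x) *\<^sub>R f z) \<le> 
        norm (integral {x..z} (\<lambda>u. g j u *\<^sub>R f' u) - g j x *\<^sub>R (f z - f x)) +
        norm (integral {z..y} (\<lambda>u. g j u *\<^sub>R f' u) - g j y *\<^sub>R (f y - f z))"
      unfolding norm_minus_cancel by (simp only: norm_minus_cancel norm_triangle_ineq)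
    also have "\<dots> \<le> (B * (V y - V x)) * (z - x) + (B * (V y - V x)) * (y - z)"
      using h by (intro add_mono piece) auto
    also have "\<dots> \<le> (B * (V y - V x)) * (y - x) + (B * (V y - V x)) * (y - x)"
      using h B0 mono by (intro add_mono mult_left_mono) auto
    finally show ?thesis by (simp add: algebra_simps)
  qed
  have "is_primitive j f F a b" unfolding is_primitive_def
  proof (intro allI impI)
    fix \<epsilon> :: real assume e: "\<epsilon> > 0"
    show "\<exists>\<delta>>0. \<forall>x z y. a \<le> x \<longrightarrow> x \<le> z \<longrightarrow> z \<le> y \<longrightarrow> y \<le> b \<longrightarrow> y - x < \<delta> \<longrightarrow>
            norm (F y - F x - (g j y - g j x) *\<^sub>R f z) \<le> \<epsilon> * (V y - V x)"
    proof (intro exI[of _ "\<epsilon> / (2 * B + 1)"] conjI allI impI)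
      show "\<epsilon> / (2 * B + 1) > 0" using e B0 by simp
      fix x z y assume h: "a \<le> x" "x \<le> z" "z \<le> y" "y \<le> b" "y - x < \<epsilon> / (2 * B + 1)"
      have mono: "V x \<le> V y" using h ab by (intro V_mono) auto
      have "norm (F y - F x - (g j y - g j x) *\<^sub>R f z) \<le> (2 * B * (y - x)) * (V y - V x)"
        using est[OF h(1-4)] by (simp add: algebra_simps)
      also have "\<dots> \<le> \<epsilon> * (V y - V x)"
      proof (intro mult_right_mono)
        have "2 * B * (y - x) \<le> (2 * B + 1) * (\<epsilon> / (2 * B + 1))" using h B0 by (intro mult_mono) auto
        also have "\<dots> = \<epsilon>" using B0 by simp
        finally show "2 * B * (y - x) \<le> \<epsilon>" .
      qed (use mono in auto)
      finally show "norm (F y - F x - (g j y - g j x) *\<^sub>R f z) \<le> \<epsilon> * (V y - V x)" .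
    qed
  qed
  thus ?thesis by blast
qed

text \<open>Functions obtained by integration against the path are Lipschitz with respect to \<open>V\<close>; this is how
their continuity is obtained.\<close>

lemma continuous_on_of_V_increments:
  fixes F :: "real \<Rightarrow> 'a::real_normed_vector"
  assumes ab: "0 \<le> a" "b \<le> T"
    and inc: "\<And>x y. a \<le> x \<Longrightarrow> x \<le> y \<Longrightarrow> y \<le> b \<Longrightarrow> norm (F y - F x) \<le> B * (V y - V x)"
  shows "continuous_on {a..b} F"
  unfolding continuous_on_def
proof
  fix x assume x: "x \<in> {a..b}"
  have cV: "(V \<longlongrightarrow> V x) (at x within {a..b})"
    using continuous_on_subset[OF continuous_V, of "{a..b}"] ab x by (auto simp: continuous_on_def)
  have "((\<lambda>y. F y - F x) \<longlongrightarrow> 0) (at x within {a..b})"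
  proof (rule Lim_null_comparison)
    show "\<forall>\<^sub>F y in at x within {a..b}. norm (F y - F x) \<le> B * \<bar>V y - V x\<bar>"
      unfolding eventually_at_filter
    proof (intro always_eventually allI impI)
      fix y assume y: "y \<in> {a..b}"
      show "norm (F y - F x) \<le> B * \<bar>V y - V x\<bar>"
      proof (cases "x \<le> y")
        case True
        then show ?thesis using inc[of x y] V_mono[of x y] x y ab by auto
      next
        case False
        then show ?thesis using inc[of y x] V_mono[of y x] x y ab by (auto simp: norm_minus_commute)
      qed
    qed
    have "((\<lambda>y. B * \<bar>V y - V x\<bar>) \<longlongrightarrow> B * \<bar>V x - V x\<bar>) (at x within {a..b})"
      by (intro tendsto_intros cV)
    thus "((\<lambda>y. B * \<bar>V y - V x\<bar>) \<longlongrightarrow> 0) (at x within {a..b})" by simp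
  qed
  thus "(F \<longlongrightarrow> F x) (at x within {a..b})" using LIM_zero_cancel by blast
qed

lemma continuous_g: "continuous_on {0..T} (g j)"
  by (rule continuous_on_of_V_increments[where B = 1]) (auto intro: control)

lemma ex_is_primitive:
  assumes ab: "0 \<le> a" "a \<le> b" "b \<le> T" and f: "continuous_on {a..b} f"
  shows "\<exists>F. is_primitive j f F a b"
proof -
  have "\<exists>p p'. (\<forall>x. (p has_vector_derivative p' x) (at x)) \<and> continuous_on UNIV p' \<and>
      (\<forall>x\<in>{a..b}. norm (f x - p x) < inverse (real (Suc n)))" for n
  proof -
    obtain p where p: "polynomial_function p" "\<forall>x\<in>{a..b}. norm (f x - p x) < inverse (real (Suc n))"
      using Stone_Weierstrass_polynomial_function[OF _ f, of "inverse (real (Suc n))"] by auto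
    obtain p' where "polynomial_function p'" "\<And>x. (p has_vector_derivative (p' x)) (at x)"
      using has_vector_derivative_polynomial_function[OF p(1)] by blast
    thus ?thesis using p(2) continuous_on_polymonial_function by blast
  qed
  then obtain p p' where p: "\<And>n x. (p n has_vector_derivative p' n x) (at x)" "\<And>n. continuous_on UNIV (p' n)"
    "\<And>n x. x \<in> {a..b} \<Longrightarrow> norm (f x - p n x) < inverse (real (Suc n))" by metis
  have "\<exists>F. is_primitive j (p n) F a b" for n
    by (intro is_primitive_of_C1[OF ab p(1) p(2)] continuous_on_subset[OF continuous_g]) (use ab in auto)
  then obtain F where F: "\<And>n. is_primitive j (p n) (F n) a b" by metis
  have "uniform_limit {a..b} p f sequentially"
  proof (rule uniform_limitI)
    fix e :: real assume "e > 0"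
    have "\<forall>\<^sub>F n in sequentially. inverse (real (Suc n)) < e"
      using order_tendstoD(2)[OF LIMSEQ_inverse_real_of_nat \<open>e > 0\<close>] .
    thus "\<forall>\<^sub>F n in sequentially. \<forall>x\<in>{a..b}. dist (p n x) (f x) < e"
    proof eventually_elim
      case (elim n)
      show ?case
      proof
        fix x assume "x \<in> {a..b}"
        from p(3)[OF this, of n] elim show "dist (p n x) (f x) < e" by (simp add: dist_norm norm_minus_commute)
      qed
    qed
  qed
  from is_primitive_limit[OF ab F this] show ?thesis .
qed

lemma is_primitive_rs_eq:
  assumes "is_primitive j f F a b" "0 \<le> a" "a \<le> x" "x \<le> y" "y \<le> b" "b \<le> T"
  shows "rs j f x y = F y - F x"
proof -
  have "is_primitive j f F x y" by (rule is_primitive_subinterval[OF assms(1,3,5)])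
  thus ?thesis using assms by (auto intro!: rs_eqI is_primitive_has_RS_integral)
qed

lemma is_primitive_rs:
  assumes "0 \<le> a" "a \<le> b" "b \<le> T" "continuous_on {a..b} f"
  shows "is_primitive j f (rs j f a) a b"
proof -
  obtain F where F: "is_primitive j f F a b" using ex_is_primitive[OF assms] by blast
  show ?thesis by (rule is_primitive_cong[OF F, where c = "F a"]) (use is_primitive_rs_eq[OF F] assms in auto)
qed

lemma has_RS_integral_rs:
  assumes "0 \<le> a" "a \<le> b" "b \<le> T" "continuous_on {a..b} f"
  shows "has_RS_integral f (g j) a b (rs j f a b)"
proof -
  obtain F where F: "is_primitive j f F a b" using ex_is_primitive[OF assms] by blast
  show ?thesis using is_primitive_rs_eq[OF F] is_primitive_has_RS_integral[OF F] assms by simp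
qed

lemma rs_refl: "0 \<le> a \<Longrightarrow> a \<le> T \<Longrightarrow> rs j f a a = 0"
proof -
  assume a: "0 \<le> a" "a \<le> T"
  have "is_primitive j f (\<lambda>_. 0) a a" unfolding is_primitive_def
  proof (intro allI impI exI[of _ "1::real"] conjI)
    fix \<epsilon> x z y :: real assume "a \<le> x" "x \<le> z" "z \<le> y" "y \<le> a"
    hence "y = x" by simp
    thus "norm (0 - 0 - (g j y - g j x) *\<^sub>R f z) \<le> \<epsilon> * (V y - V x)" by simp
  qed simp
  from is_primitive_rs_eq[OF this] show ?thesis using a by simp
qed

lemma rs_combine:
  assumes "0 \<le> a" "a \<le> c" "c \<le> b" "b \<le> T" "continuous_on {a..b} f"
  shows "rs j f a b = rs j f a c + rs j f c b"
proof -
  obtain F where F: "is_primitive j f F a b" using ex_is_primitive[of a b] assms by auto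
  show ?thesis using is_primitive_rs_eq[OF F] assms by simp
qed

lemma rs_cong:
  assumes "0 \<le> a" "a \<le> b" "b \<le> T" "continuous_on {a..b} f" "\<And>x. x \<in> {a..b} \<Longrightarrow> f x = f' x"
  shows "rs j f a b = rs j f' a b"
proof -
  obtain F where F: "is_primitive j f F a b" using ex_is_primitive[OF assms(1-4)] by blast
  have F': "is_primitive j f' F a b" by (rule is_primitive_cong[OF F, where c = 0]) (use assms in auto)
  show ?thesis using is_primitive_rs_eq[OF F] is_primitive_rs_eq[OF F'] assms by simp
qed

lemma rs_add:
  assumes "0 \<le> a" "a \<le> b" "b \<le> T" "continuous_on {a..b} f" "continuous_on {a..b} h"
  shows "rs j (\<lambda>x. f x + h x) a b = rs j f a b + rs j h a b"
  using is_primitive_rs_eq[OF is_primitive_add[OF is_primitive_rs is_primitive_rs], of a b f h a b] assms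
  by (simp add: rs_refl)

lemma rs_cmult:
  assumes "0 \<le> a" "a \<le> b" "b \<le> T" "continuous_on {a..b} f"
  shows "rs j (\<lambda>x. c * f x) a b = c * rs j f a b"
  using is_primitive_rs_eq[OF is_primitive_cmult[OF is_primitive_rs], of a b f a b] assms
  by (simp add: rs_refl)

lemma rs_diff:
  assumes "0 \<le> a" "a \<le> b" "b \<le> T" "continuous_on {a..b} f" "continuous_on {a..b} h"
  shows "rs j (\<lambda>x. f x - h x) a b = rs j f a b - rs j h a b"
  using rs_add[OF assms(1-4), of "\<lambda>x. (-1) * h x"] rs_cmult[OF assms(1-3,5), of j "-1"] assms
  by (simp add: continuous_on_minus)

lemma rs_sum:
  assumes "0 \<le> a" "a \<le> b" "b \<le> T" "\<And>i. i \<in> I \<Longrightarrow> continuous_on {a..b} (f i)"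
  shows "rs j (\<lambda>x. \<Sum>i\<in>I. f i x) a b = (\<Sum>i\<in>I. rs j (f i) a b)"
proof (cases "finite I")
  case True
  have "rs j (\<lambda>x. 0 * 1) a b = 0" using rs_cmult[of a b "\<lambda>_. 1" j 0] assms by simp
  hence 0: "rs j (\<lambda>x. 0) a b = 0" by simp
  show ?thesis using True assms(4)
    by (induction rule: finite_induct) (simp_all add: 0 rs_add[OF assms(1-3)] continuous_on_sum)
next
  case False
  have "rs j (\<lambda>x. 0 * 1) a b = 0" using rs_cmult[of a b "\<lambda>_. 1" j 0] assms by simp
  then show ?thesis using False by simp
qed

lemma norm_rs_le:
  assumes "0 \<le> a" "a \<le> b" "b \<le> T" "continuous_on {a..b} f" "\<And>x. x \<in> {a..b} \<Longrightarrow> norm (f x) \<le> B"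
  shows "norm (rs j f a b) \<le> B * (V b - V a)"
  using is_primitive_bound_const[OF is_primitive_rs[OF assms(1-4)] assms(1-3), of B j] assms(5) assms(1-3)
  by (simp add: rs_refl)

lemma norm_rs_le_power:
  assumes "0 \<le> a" "a \<le> b" "b \<le> T" "continuous_on {a..b} f" "0 \<le> C"
    and "\<And>x. x \<in> {a..b} \<Longrightarrow> norm (f x) \<le> C * (V x - V a) ^ n / fact n"
  shows "norm (rs j f a b) \<le> C * (V b - V a) ^ Suc n / fact (Suc n)"
  using is_primitive_bound_power[OF is_primitive_rs[OF assms(1-4)] assms(1-3,5), of n j] assms(6) assms(1-3)
  by (simp add: rs_refl)

lemma continuous_on_bounded_Icc:
  fixes f :: "real \<Rightarrow> complex"
  assumes "continuous_on {a..b} f"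
  obtains B where "B \<ge> 0" "\<And>x. x \<in> {a..b} \<Longrightarrow> norm (f x) \<le> B"
proof -
  have "bounded (f ` {a..b})" using assms by (intro compact_imp_bounded compact_continuous_image) auto
  then obtain B where "\<forall>x\<in>{a..b}. norm (f x) \<le> B" by (auto simp: bounded_iff)
  thus ?thesis using that[of "max B 0"] by fastforce
qed

lemma continuous_on_rs:
  assumes "0 \<le> a" "b \<le> T" "continuous_on {a..b} f"
  shows "continuous_on {a..b} (rs j f a)"
proof -
  obtain B where B: "\<And>x. x \<in> {a..b} \<Longrightarrow> norm (f x) \<le> B" using continuous_on_bounded_Icc[OF assms(3)] by blast
  show ?thesis
  proof (rule continuous_on_of_V_increments[OF assms(1,2)])
    fix x y assume h: "a \<le> x" "x \<le> y" "y \<le> b"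
    have c: "continuous_on {a..y} f" "continuous_on {x..y} f" using assms(3) h by (auto intro: continuous_on_subset)
    have "rs j f a y - rs j f a x = rs j f x y" using rs_combine[of a x y f j] h assms c by simp
    thus "norm (rs j f a y - rs j f a x) \<le> B * (V y - V x)"
      using norm_rs_le[of x y f B j] h assms c B by simp
  qed
qed

lemma tendsto_rs:
  assumes "0 \<le> a" "a \<le> b" "b \<le> T" "\<And>n. continuous_on {a..b} (f n)" "uniform_limit {a..b} f h sequentially"
  shows "(\<lambda>n. rs j (f n) a b) \<longlonglongrightarrow> rs j h a b"
proof (rule LIMSEQ_I)
  fix e :: real assume "e > 0"
  define \<epsilon> where "\<epsilon> = e / (1 + (V b - V a))"
  have Vab: "V a \<le> V b" using V_mono assms by simp
  have e: "\<epsilon> > 0" using Vab \<open>e > 0\<close> by (simp add: \<epsilon>_def)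
  have ch: "continuous_on {a..b} h" using assms(4,5) by (intro uniform_limit_theorem) auto
  obtain n0 where n0: "\<forall>n\<ge>n0. \<forall>u\<in>{a..b}. dist (f n u) (h u) < \<epsilon>"
    using assms(5) e unfolding uniform_limit_sequentially_iff by blast
  have "norm (rs j (f n) a b - rs j h a b) < e" if "n \<ge> n0" for n
  proof -
    have "norm (rs j (\<lambda>x. f n x - h x) a b) \<le> \<epsilon> * (V b - V a)"
      using assms ch n0 that by (intro norm_rs_le continuous_intros) (auto simp: dist_norm less_imp_le)
    also have "\<dots> < \<epsilon> * (1 + (V b - V a))" using e by simp
    also have "\<dots> = e" using Vab by (simp add: \<epsilon>_def)
    finally show ?thesis using rs_diff[OF assms(1-3) assms(4) ch] by simp
  qed
  thus "\<exists>n0. \<forall>n\<ge>n0. norm (rs j (f n) a b - rs j h a b) < e" by blast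
qed

end

section \<open>Words, noncrossing pairings and iterated integrals\<close>

abbreviation words :: "nat \<Rightarrow> 'd list set" where
  "words n \<equiv> {w. length w = n}"

lemma finite_words: "finite (words n :: 'd::finite list set)"
  using finite_lists_length_eq[of "UNIV :: 'd set" n] by simp

lemma card_words: "card (words n :: 'd::finite list set) = CARD('d) ^ n"
  using card_lists_length_eq[of "UNIV :: 'd set" n] by simp

lemma sum_words_Suc:
  fixes f :: "'d::finite list \<Rightarrow> 'a::comm_monoid_add"
  shows "(\<Sum>w\<in>words (Suc n). f w) = (\<Sum>j\<in>UNIV. \<Sum>w\<in>words n. f (j # w))"
proof -
  have "(\<Sum>j\<in>UNIV. \<Sum>w\<in>words n. f (j # w)) = (\<Sum>(j, w)\<in>UNIV \<times> words n. f (j # w))"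
    by (simp add: sum.cartesian_product)
  also have "\<dots> = (\<Sum>w\<in>words (Suc n). f w)"
    by (rule sum.reindex_bij_witness[where i = "\<lambda>w. (hd w, tl w)" and j = "\<lambda>(j, w). j # w"])
       (auto simp: length_Suc_conv)
  finally show ?thesis by simp
qed

text \<open>The number of noncrossing pairings of the positions of a word that join equal letters only: the index
\<open>k\<close> is the partner of the head, and since no pair may cross this one, the letters on either side of
position \<open>k\<close> are paired among themselves.\<close>

fun noncrossing_count :: "'d list \<Rightarrow> nat" where
  "noncrossing_count [] = 1"
| "noncrossing_count (j # w) = (\<Sum>k<length w.
     if w ! k = j then noncrossing_count (take k w) * noncrossing_count (drop (Suc k) w) else 0)"

lemma sum_words_marked:
  fixes f :: "'d::finite list \<Rightarrow> 'd list \<Rightarrow> 'd list \<Rightarrow> 'a::comm_monoid_add"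
  assumes "k \<le> n"
  shows "(\<Sum>w\<in>words (Suc n). if w ! k = j then f (take k w) (drop (Suc k) w) w else 0)
       = (\<Sum>q\<in>words k. \<Sum>p\<in>words (n - k). f q p (q @ j # p))"
proof -
  have "(\<Sum>w\<in>words (Suc n). if w ! k = j then f (take k w) (drop (Suc k) w) w else 0)
      = (\<Sum>w\<in>{w \<in> words (Suc n). w ! k = j}. f (take k w) (drop (Suc k) w) w)"
    by (rule sum.inter_filter[symmetric]) (rule finite_words)
  also have "\<dots> = (\<Sum>(q, p)\<in>words k \<times> words (n - k). f q p (q @ j # p))"
    by (rule sum.reindex_bij_witness[where j = "\<lambda>w. (take k w, drop (Suc k) w)" and i = "\<lambda>(q, p). q @ j # p"])
       (use assms in \<open>auto simp: id_take_nth_drop[symmetric] nth_append min_def\<close>)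
  finally show ?thesis by (simp add: sum.cartesian_product)
qed

context controlled_path
begin

text \<open>The coefficients of the signature of the path: the integral over \<open>s < u\<^sub>1 < \<dots> < u\<^sub>n < t\<close> of the product
of the differentials, the head of the word belonging to the largest time \<open>u\<^sub>n\<close>.\<close>

primrec sig :: "'d list \<Rightarrow> real \<Rightarrow> real \<Rightarrow> complex" where
  "sig [] = (\<lambda>s t. 1)"
| "sig (j # w) = (\<lambda>s t. rs j (sig w s) s t)"

lemma continuous_on_sig: "0 \<le> s \<Longrightarrow> continuous_on {s..T} (sig w s)"
  by (induction w) (auto intro: continuous_on_rs)

lemma continuous_on_sig': "0 \<le> s \<Longrightarrow> s \<le> a \<Longrightarrow> b \<le> T \<Longrightarrow> continuous_on {a..b} (sig w s)"
  by (rule continuous_on_subset[OF continuous_on_sig]) auto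

lemma norm_sig_le:
  assumes "0 \<le> s" "s \<le> t" "t \<le> T"
  shows "norm (sig w s t) \<le> (V t - V s) ^ length w / fact (length w)"
  using assms
proof (induction w arbitrary: t)
  case (Cons j w)
  have "norm (rs j (sig w s) s t) \<le> 1 * (V t - V s) ^ Suc (length w) / fact (Suc (length w))"
    using Cons by (intro norm_rs_le_power continuous_on_sig') auto
  thus ?case by simp
qed simp

lemma norm_sig_bounded:
  obtains B where "B \<ge> 0" "\<And>s t. 0 \<le> s \<Longrightarrow> s \<le> t \<Longrightarrow> t \<le> T \<Longrightarrow> norm (sig w s t) \<le> B"
proof
  show "0 \<le> \<bar>V T - V 0\<bar> ^ length w / fact (length w)" by simp
  fix s t assume h: "0 \<le> s" "s \<le> t" "t \<le> T"
  have v: "V 0 \<le> V s" "V s \<le> V t" "V t \<le> V T" using h by (auto intro!: V_mono)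
  have "norm (sig w s t) \<le> (V t - V s) ^ length w / fact (length w)" by (rule norm_sig_le[OF h])
  also have "\<dots> \<le> \<bar>V T - V 0\<bar> ^ length w / fact (length w)"
    using v by (intro divide_right_mono power_mono) auto
  finally show "norm (sig w s t) \<le> \<bar>V T - V 0\<bar> ^ length w / fact (length w)" .
qed

lemma sig_increment:
  assumes "0 \<le> s" "s \<le> x" "x \<le> y" "y \<le> T"
  shows "sig (j # w) s y - sig (j # w) s x = rs j (sig w s) x y"
  using rs_combine[of s x y "sig w s" j] assms by (simp add: continuous_on_sig')

text \<open>This estimate and the next one hold uniformly in the other time, which is needed when \<open>sig w u x\<close>
occurs as an integrand in \<open>u\<close> and \<open>x\<close> varies.\<close>

lemma sig_lipschitz_end:
  obtains C where "C \<ge> 0" "\<And>s x y. 0 \<le> s \<Longrightarrow> s \<le> x \<Longrightarrow> x \<le> y \<Longrightarrow> y \<le> T \<Longrightarrow>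
    norm (sig w s y - sig w s x) \<le> C * (V y - V x)"
proof (cases w)
  case Nil
  thus ?thesis using that[of 0] by simp
next
  case (Cons j w')
  obtain B where B: "B \<ge> 0" "\<And>s t. 0 \<le> s \<Longrightarrow> s \<le> t \<Longrightarrow> t \<le> T \<Longrightarrow> norm (sig w' s t) \<le> B"
    using norm_sig_bounded by blast
  show ?thesis
  proof (rule that[OF B(1)])
    fix s x y :: real assume h: "0 \<le> s" "s \<le> x" "x \<le> y" "y \<le> T"
    show "norm (sig w s y - sig w s x) \<le> B * (V y - V x)"
      unfolding Cons sig_increment[OF h] using h by (intro norm_rs_le B(2) continuous_on_sig') auto
  qed
qed

lemma sig_lipschitz_start:
  "\<exists>C\<ge>0. \<forall>s s' t. 0 \<le> s \<longrightarrow> s \<le> s' \<longrightarrow> s' \<le> t \<longrightarrow> t \<le> T \<longrightarrow> norm (sig w s' t - sig w s t) \<le> C * (V s' - V s)"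
proof (induction w)
  case Nil
  show ?case by (intro exI[of _ 0]) simp
next
  case (Cons j w)
  then obtain C where C: "C \<ge> 0" "\<And>s s' t. 0 \<le> s \<Longrightarrow> s \<le> s' \<Longrightarrow> s' \<le> t \<Longrightarrow> t \<le> T \<Longrightarrow>
      norm (sig w s' t - sig w s t) \<le> C * (V s' - V s)" by meson
  obtain B where B: "B \<ge> 0" "\<And>s t. 0 \<le> s \<Longrightarrow> s \<le> t \<Longrightarrow> t \<le> T \<Longrightarrow> norm (sig w s t) \<le> B"
    using norm_sig_bounded by blast
  show ?case
  proof (intro exI[of _ "C * \<bar>V T - V 0\<bar> + B"] conjI allI impI)
    fix s s' t :: real assume h: "0 \<le> s" "s \<le> s'" "s' \<le> t" "t \<le> T"
    have v: "V 0 \<le> V s" "V s \<le> V s'" "V s' \<le> V t" "V t \<le> V T" using h by (auto intro!: V_mono)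
    have eq: "sig (j # w) s' t - sig (j # w) s t = rs j (\<lambda>u. sig w s' u - sig w s u) s' t - rs j (sig w s) s s'"
      using h rs_combine[of s s' t "sig w s" j] rs_diff[of s' t "sig w s'" "sig w s" j]
      by (simp add: continuous_on_sig')
    have "norm (sig (j # w) s' t - sig (j # w) s t) \<le> norm (rs j (\<lambda>u. sig w s' u - sig w s u) s' t) + norm (rs j (sig w s) s s')"
      unfolding eq by (rule norm_triangle_ineq4)
    also have "\<dots> \<le> (C * (V s' - V s)) * (V t - V s') + B * (V s' - V s)"
    proof (rule add_mono)
      show "norm (rs j (\<lambda>u. sig w s' u - sig w s u) s' t) \<le> (C * (V s' - V s)) * (V t - V s')"
      proof (rule norm_rs_le)
        show "continuous_on {s'..t} (\<lambda>u. sig w s' u - sig w s u)"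
          by (rule continuous_on_diff; rule continuous_on_sig') (use h in auto)
        show "norm (sig w s' x - sig w s x) \<le> C * (V s' - V s)" if "x \<in> {s'..t}" for x
          by (rule C(2)) (use h that in auto)
      qed (use h in auto)
      show "norm (rs j (sig w s) s s') \<le> B * (V s' - V s)"
      proof (rule norm_rs_le)
        show "continuous_on {s..s'} (sig w s)"
          by (rule continuous_on_sig') (use h in auto)
        show "norm (sig w s x) \<le> B" if "x \<in> {s..s'}" for x
          by (rule B(2)) (use h that in auto)
      qed (use h in auto)
    qed
    also have "\<dots> \<le> (C * (V s' - V s)) * \<bar>V T - V 0\<bar> + B * (V s' - V s)"
      using v C(1) by (intro add_right_mono mult_left_mono) auto
    finally show "norm (sig (j # w) s' t - sig (j # w) s t) \<le> (C * \<bar>V T - V 0\<bar> + B) * (V s' - V s)"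
      by (simp add: algebra_simps)
  qed (use C B in auto)
qed

lemma continuous_on_sig_start:
  assumes "t \<le> T" "0 \<le> a" "b \<le> t"
  shows "continuous_on {a..b} (\<lambda>u. sig w u t)"
proof -
  obtain C where C: "C \<ge> 0" "\<And>s s' t. 0 \<le> s \<Longrightarrow> s \<le> s' \<Longrightarrow> s' \<le> t \<Longrightarrow> t \<le> T \<Longrightarrow>
      norm (sig w s' t - sig w s t) \<le> C * (V s' - V s)" using sig_lipschitz_start by meson
  show ?thesis by (rule continuous_on_of_V_increments[where B = C]) (use assms C in auto)
qed

text \<open>For integrands that are Lipschitz with respect to \<open>V\<close> it is enough to compare with the value at the left
end point, with an error quadratic in the increment of \<open>V\<close>; continuity of \<open>V\<close> makes it small.\<close>

lemma is_primitive_of_quadratic: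
  assumes ab: "0 \<le> a" "b \<le> T" and C: "0 \<le> C"
    and est: "\<And>x y. a \<le> x \<Longrightarrow> x \<le> y \<Longrightarrow> y \<le> b \<Longrightarrow>
       norm (F y - F x - (g j y - g j x) *\<^sub>R f x) \<le> C * (V y - V x)\<^sup>2"
    and lip: "\<And>x y. a \<le> x \<Longrightarrow> x \<le> y \<Longrightarrow> y \<le> b \<Longrightarrow> norm (f y - f x) \<le> C * (V y - V x)"
  shows "is_primitive j f F a b"
  unfolding is_primitive_def
proof (intro allI impI)
  fix \<epsilon> :: real assume e: "\<epsilon> > 0"
  have "uniformly_continuous_on {0..T} V"
    using continuous_V by (intro compact_uniformly_continuous) auto
  moreover have "\<epsilon> / (2 * C + 1) > 0" using e C by simp
  ultimately obtain \<delta> where d: "\<delta> > 0" "\<And>x y. x \<in> {0..T} \<Longrightarrow> y \<in> {0..T} \<Longrightarrow> dist y x < \<delta> \<Longrightarrow> dist (V y) (V x) < \<epsilon> / (2 * C + 1)"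
    unfolding uniformly_continuous_on_def by metis
  show "\<exists>\<delta>>0. \<forall>x z y. a \<le> x \<longrightarrow> x \<le> z \<longrightarrow> z \<le> y \<longrightarrow> y \<le> b \<longrightarrow> y - x < \<delta> \<longrightarrow>
          norm (F y - F x - (g j y - g j x) *\<^sub>R f z) \<le> \<epsilon> * (V y - V x)"
  proof (intro exI[of _ \<delta>] conjI allI impI d(1))
    fix x z y assume h: "a \<le> x" "x \<le> z" "z \<le> y" "y \<le> b" "y - x < \<delta>"
    have v: "V x \<le> V z" "V z \<le> V y" using h ab by (auto intro!: V_mono)
    have "dist (V y) (V x) < \<epsilon> / (2 * C + 1)" using h ab by (intro d(2)) (auto simp: dist_real_def)
    hence vd: "V y - V x < \<epsilon> / (2 * C + 1)" by (simp add: dist_real_def)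
    have eq: "F y - F x - (g j y - g j x) *\<^sub>R f z = (F y - F x - (g j y - g j x) *\<^sub>R f x) - (g j y - g j x) *\<^sub>R (f z - f x)"
      by (simp add: algebra_simps)
    have "norm (F y - F x - (g j y - g j x) *\<^sub>R f z) \<le> norm (F y - F x - (g j y - g j x) *\<^sub>R f x) + norm ((g j y - g j x) *\<^sub>R (f z - f x))"
      unfolding eq by (rule norm_triangle_ineq4)
    also have "\<dots> \<le> C * (V y - V x)\<^sup>2 + (V y - V x) * (C * (V y - V x))"
    proof (rule add_mono)
      have "norm (f z - f x) \<le> C * (V z - V x)" using h by (intro lip) auto
      also have "\<dots> \<le> C * (V y - V x)" using C v by (intro mult_left_mono) auto
      finally show "norm ((g j y - g j x) *\<^sub>R (f z - f x)) \<le> (V y - V x) * (C * (V y - V x))"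
        unfolding norm_scaleR using h ab v by (intro mult_mono control) auto
      show "norm (F y - F x - (g j y - g j x) *\<^sub>R f x) \<le> C * (V y - V x)\<^sup>2" using h by (intro est) auto
    qed
    also have "\<dots> = (2 * C * (V y - V x)) * (V y - V x)" by (simp add: power2_eq_square algebra_simps)
    also have "\<dots> \<le> \<epsilon> * (V y - V x)"
    proof (rule mult_right_mono)
      have "2 * C * (V y - V x) \<le> (2 * C + 1) * (\<epsilon> / (2 * C + 1))" using vd v C by (intro mult_mono) auto
      thus "2 * C * (V y - V x) \<le> \<epsilon>" using C by simp
    qed (use v in auto)
    finally show "norm (F y - F x - (g j y - g j x) *\<^sub>R f z) \<le> \<epsilon> * (V y - V x)" .
  qed
qed

lemma rs_const:
  assumes "0 \<le> a" "a \<le> b" "b \<le> T"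
  shows "rs j (\<lambda>_. c) a b = (g j b - g j a) *\<^sub>R c"
proof -
  have "is_primitive j (\<lambda>_. c) (\<lambda>x. g j x *\<^sub>R c) a b" unfolding is_primitive_def
  proof (intro allI impI exI[of _ "1::real"] conjI)
    fix \<epsilon> x z y :: real assume h: "\<epsilon> > 0" "a \<le> x" "x \<le> z" "z \<le> y" "y \<le> b"
    hence "0 \<le> \<epsilon> * (V y - V x)" using V_mono[of x y] assms by auto
    thus "norm (g j y *\<^sub>R c - g j x *\<^sub>R c - (g j y - g j x) *\<^sub>R c) \<le> \<epsilon> * (V y - V x)"
      by (simp add: scaleR_diff_left)
  qed simp
  from is_primitive_rs_eq[OF this] assms show ?thesis by (simp add: scaleR_diff_left)
qed

text \<open>Concatenation of iterated integrals across an intermediate time. The case of \<open>k # q\<close> exchanges two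
integrations over a triangle: with \<open>D r\<close> denoting the left-hand side, it is shown that \<open>D\<close> is a primitive
of \<open>sig (q @ j # p) s\<close> against \<open>g k\<close>. When \<open>r\<close> moves from \<open>x\<close> to \<open>y\<close>, the new range of \<open>u\<close> contributes
only a quadratic error, because \<open>sig (k # q) u y\<close> is small for \<open>u\<close> close to \<open>y\<close>; on the old range the
increment of \<open>sig (k # q) u\<close> is \<open>sig q u x\<close> times the increment of \<open>g k\<close>, up to a quadratic error, and
the induction hypothesis evaluates the integral of that main term.\<close>

lemma rs_sig_mult_sig:
  assumes s: "0 \<le> s" and "s \<le> r" "r \<le> T"
  shows "rs j (\<lambda>u. sig p s u * sig q u r) s r = sig (q @ j # p) s r"
  using assms(2,3)
proof (induction q arbitrary: r)
  case Nil
  show ?case by simp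
next
  case (Cons k q)
  define D where "D r = rs j (\<lambda>u. sig p s u * sig (k # q) u r) s r" for r
  define m where "m = sig (q @ j # p) s"
  have sT: "s \<le> T" using Cons.prems by simp
  obtain Bp where Bp: "Bp \<ge> 0" "\<And>s t. 0 \<le> s \<Longrightarrow> s \<le> t \<Longrightarrow> t \<le> T \<Longrightarrow> norm (sig p s t) \<le> Bp"
    using norm_sig_bounded by blast
  obtain Bq where Bq: "Bq \<ge> 0" "\<And>s t. 0 \<le> s \<Longrightarrow> s \<le> t \<Longrightarrow> t \<le> T \<Longrightarrow> norm (sig q s t) \<le> Bq"
    using norm_sig_bounded by blast
  obtain Lq where Lq: "Lq \<ge> 0" "\<And>s x y. 0 \<le> s \<Longrightarrow> s \<le> x \<Longrightarrow> x \<le> y \<Longrightarrow> y \<le> T \<Longrightarrow>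
    norm (sig q s y - sig q s x) \<le> Lq * (V y - V x)" using sig_lipschitz_end[of q] by metis
  obtain Lm where Lm: "Lm \<ge> 0" "\<And>s x y. 0 \<le> s \<Longrightarrow> s \<le> x \<Longrightarrow> x \<le> y \<Longrightarrow> y \<le> T \<Longrightarrow>
    norm (sig (q @ j # p) s y - sig (q @ j # p) s x) \<le> Lm * (V y - V x)" using sig_lipschitz_end[of "q @ j # p"] by metis
  define C1 where "C1 = Bp * Bq + Bp * Lq * \<bar>V T - V 0\<bar>"
  have C1: "C1 \<ge> 0" using Bp(1) Bq(1) Lq(1) by (simp add: C1_def)
  have cont: "continuous_on {a..b} (\<lambda>u. sig p s u * sig q' u r)" if "s \<le> a" "b \<le> r" "r \<le> T" for a b r q'
    using that s by (intro continuous_on_mult continuous_on_sig' continuous_on_sig_start) auto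
  have est: "norm (D y - D x - (g k y - g k x) *\<^sub>R m x) \<le> C1 * (V y - V x)\<^sup>2"
    if h: "s \<le> x" "x \<le> y" "y \<le> T" for x y
  proof -
    have v: "V 0 \<le> V s" "V s \<le> V x" "V x \<le> V y" "V y \<le> V T" using h s by (auto intro!: V_mono)
    \<comment> \<open>the increment of the inner integral, with its linear part subtracted\<close>
    have inner: "sig (k # q) u y - sig (k # q) u x - (g k y - g k x) *\<^sub>R sig q u x = rs k (\<lambda>v. sig q u v - sig q u x) x y"
      if "s \<le> u" "u \<le> x" for u
      using sig_increment[of u x y k q] rs_const[of x y k "sig q u x"] that h s
      by (subst rs_diff) (auto intro: continuous_on_sig')
    have m: "(g k y - g k x) *\<^sub>R m x = rs j (\<lambda>u. (g k y - g k x) * (sig p s u * sig q u x)) s x"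
      unfolding m_def using h s cont[of s x x q]
      by (subst Cons.IH[symmetric]) (auto simp: rs_cmult scaleR_conv_of_real)
    let ?h = "\<lambda>u. sig p s u * sig (k # q) u y - sig p s u * sig (k # q) u x - (g k y - g k x) * (sig p s u * sig q u x)"
    have "D y = rs j (\<lambda>u. sig p s u * sig (k # q) u y) s x + rs j (\<lambda>u. sig p s u * sig (k # q) u y) x y"
      unfolding D_def using h s by (intro rs_combine cont) auto
    moreover have "rs j ?h s x = rs j (\<lambda>u. sig p s u * sig (k # q) u y) s x - D x - (g k y - g k x) *\<^sub>R m x"
      unfolding m D_def using h s cont[of s x y "k # q"] cont[of s x x "k # q"] cont[of s x x q]
      by (subst rs_diff; (intro continuous_on_diff continuous_on_mult_left)?; (simp add: rs_diff)?)
    ultimately have eq: "D y - D x - (g k y - g k x) *\<^sub>R m x = rs j (\<lambda>u. sig p s u * sig (k # q) u y) x y + rs j ?h s x"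
      by simp
    have "norm (D y - D x - (g k y - g k x) *\<^sub>R m x) \<le> norm (rs j (\<lambda>u. sig p s u * sig (k # q) u y) x y) + norm (rs j ?h s x)"
      unfolding eq by (rule norm_triangle_ineq)
    also have "\<dots> \<le> (Bp * (Bq * (V y - V x))) * (V y - V x) + (Bp * (Lq * (V y - V x) * (V y - V x))) * (V x - V s)"
    proof (intro add_mono norm_rs_le)
      fix u assume u: "u \<in> {x..y}"
      have "norm (sig (k # q) u y) \<le> Bq * (V y - V u)"
        unfolding sig.simps using u h s by (intro norm_rs_le continuous_on_sig' Bq(2)) auto
      also have "\<dots> \<le> Bq * (V y - V x)" using u h s Bq(1) by (intro mult_left_mono diff_left_mono V_mono) auto
      finally show "norm (sig p s u * sig (k # q) u y) \<le> Bp * (Bq * (V y - V x))"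
        unfolding norm_mult using u h s Bp by (intro mult_mono Bp(2)) auto
    next
      fix u assume u: "u \<in> {s..x}"
      have "?h u = sig p s u * (sig (k # q) u y - sig (k # q) u x - (g k y - g k x) *\<^sub>R sig q u x)"
        by (simp add: algebra_simps scaleR_conv_of_real)
      also have "\<dots> = sig p s u * rs k (\<lambda>v. sig q u v - sig q u x) x y" using inner u by auto
      finally have eq: "?h u = sig p s u * rs k (\<lambda>v. sig q u v - sig q u x) x y" .
      have "norm (rs k (\<lambda>v. sig q u v - sig q u x) x y) \<le> (Lq * (V y - V x)) * (V y - V x)"
      proof (rule norm_rs_le)
        fix v assume v: "v \<in> {x..y}"
        have "norm (sig q u v - sig q u x) \<le> Lq * (V v - V x)" using u v h s by (intro Lq(2)) auto
        also have "\<dots> \<le> Lq * (V y - V x)" using v h s Lq(1) by (intro mult_left_mono diff_right_mono V_mono) auto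
        finally show "norm (sig q u v - sig q u x) \<le> Lq * (V y - V x)" .
      qed (use u h s in \<open>auto intro!: continuous_on_diff continuous_on_const continuous_on_sig'\<close>)
      thus "norm (?h u) \<le> Bp * (Lq * (V y - V x) * (V y - V x))"
        unfolding eq norm_mult using u h s Bp by (intro mult_mono Bp(2)) auto
    next
      show "continuous_on {s..x} ?h"
        using h s by (intro continuous_on_diff continuous_on_mult_left cont) auto
      show "continuous_on {x..y} (\<lambda>u. sig p s u * sig (k # q) u y)"
        using h s by (intro cont) auto
    qed (use h s in auto)
    also have "\<dots> \<le> (Bp * (Bq * (V y - V x))) * (V y - V x) + (Bp * (Lq * (V y - V x) * (V y - V x))) * \<bar>V T - V 0\<bar>"
      using v Bp(1) Lq(1) by (intro add_left_mono mult_left_mono) auto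
    also have "\<dots> = C1 * (V y - V x)\<^sup>2" by (simp add: C1_def power2_eq_square algebra_simps)
    finally show ?thesis .
  qed
  have "is_primitive k m D s T"
  proof (rule is_primitive_of_quadratic[where C = "max C1 Lm"])
    fix x y assume h: "s \<le> x" "x \<le> y" "y \<le> T"
    have v: "V x \<le> V y" using h s by (auto intro!: V_mono)
    show "norm (D y - D x - (g k y - g k x) *\<^sub>R m x) \<le> max C1 Lm * (V y - V x)\<^sup>2"
      by (rule order_trans[OF est[OF h] mult_right_mono]) auto
    show "norm (m y - m x) \<le> max C1 Lm * (V y - V x)"
      unfolding m_def by (rule order_trans[OF Lm(2)[OF s h] mult_right_mono]) (use v in auto)
  qed (use s C1 in auto)
  from is_primitive_rs_eq[OF this, of s r] have "rs k m s r = D r - D s"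
    using s Cons.prems sT by simp
  moreover have "D s = 0" unfolding D_def using s sT by (simp add: rs_refl)
  ultimately show ?case by (simp add: D_def m_def)
qed

section \<open>The functional equation for the series of pairings\<close>

definition Klevel :: "nat \<Rightarrow> real \<Rightarrow> real \<Rightarrow> complex" where
  "Klevel n s t = (\<Sum>w\<in>words n. of_nat (noncrossing_count w) * sig w s t)"

text \<open>The limit of the expected normalised traces. The part of degree \<open>n\<close> carries the factor \<open>\<i>^n\<close> of the
Picard series.\<close>

definition Kseries :: "real \<Rightarrow> real \<Rightarrow> complex" where
  "Kseries s t = (\<Sum>n. \<i> ^ n * Klevel n s t)"

lemma Klevel_0: "Klevel 0 s t = 1" by (simp add: Klevel_def)

lemma Klevel_1: "Klevel (Suc 0) s t = 0"
  unfolding Klevel_def sum_words_Suc by simp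

text \<open>The recursion for \<open>noncrossing_count\<close>, read from right to left: a pair of words \<open>q, p\<close> and the position
\<open>a = |q|\<close> determine the word \<open>q @ j # p\<close> with a marked letter \<open>j\<close>.\<close>

lemma rs_Klevel_mult_Klevel:
  assumes "0 \<le> s" "s \<le> r" "r \<le> T"
  shows "rs j (\<lambda>u. \<Sum>a\<le>n. Klevel (n - a) s u * Klevel a u r) s r =
    (\<Sum>w\<in>words (Suc n). of_nat (noncrossing_count (j # w)) * sig w s r)"
proof -
  have c: "continuous_on {s..r} (\<lambda>u. sig p s u * sig q u r)" for p q
    using assms by (intro continuous_on_mult continuous_on_sig' continuous_on_sig_start) auto
  let ?t = "\<lambda>q p u. of_nat (noncrossing_count q * noncrossing_count p) * (sig p s u * sig q u r)"
  have "(\<lambda>u. \<Sum>a\<le>n. Klevel (n - a) s u * Klevel a u r) = (\<lambda>u. \<Sum>a\<le>n. \<Sum>q\<in>words a. \<Sum>p\<in>words (n - a). ?t q p u)"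
    unfolding Klevel_def sum_product by (subst sum.swap) (simp add: mult_ac)
  hence "rs j (\<lambda>u. \<Sum>a\<le>n. Klevel (n - a) s u * Klevel a u r) s r =
     (\<Sum>a\<le>n. \<Sum>q\<in>words a. \<Sum>p\<in>words (n - a). rs j (?t q p) s r)"
    using assms by (simp only: rs_sum continuous_on_sum continuous_on_mult_left[OF c])
  also have "\<dots> = (\<Sum>a\<le>n. \<Sum>q\<in>words a. \<Sum>p\<in>words (n - a). of_nat (noncrossing_count q * noncrossing_count p) * sig (q @ j # p) s r)"
    using assms by (simp only: rs_cmult c rs_sig_mult_sig)
  also have "\<dots> = (\<Sum>a\<le>n. \<Sum>w\<in>words (Suc n). if w ! a = j then 
      of_nat (noncrossing_count (take a w) * noncrossing_count (drop (Suc a) w)) * sig w s r else 0)"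
    by (rule sum.cong[OF refl], subst sum_words_marked[where f = "\<lambda>q p w. of_nat (noncrossing_count q * noncrossing_count p) * sig w s r"]) auto
  also have "\<dots> = (\<Sum>w\<in>words (Suc n). \<Sum>a\<le>n. if w ! a = j then 
      of_nat (noncrossing_count (take a w) * noncrossing_count (drop (Suc a) w)) * sig w s r else 0)"
    by (rule sum.swap)
  also have "\<dots> = (\<Sum>w\<in>words (Suc n). of_nat (noncrossing_count (j # w)) * sig w s r)"
  proof (intro sum.cong refl)
    fix w :: "'d list" assume "w \<in> words (Suc n)"
    hence "noncrossing_count (j # w) = (\<Sum>a\<le>n. if w ! a = j then noncrossing_count (take a w) * noncrossing_count (drop (Suc a) w) else 0)"
      by (simp add: lessThan_Suc_atMost)
    thus "(\<Sum>a\<le>n. if w ! a = j then of_nat (noncrossing_count (take a w) * noncrossing_count (drop (Suc a) w)) * sig w s r else 0) =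
       of_nat (noncrossing_count (j # w)) * sig w s r"
      by (simp only: of_nat_sum sum_distrib_right) (auto intro!: sum.cong)
  qed
  finally show ?thesis .
qed

lemma Klevel_Suc_Suc:
  assumes "0 \<le> s" "s \<le> t" "t \<le> T"
  shows "Klevel (Suc (Suc n)) s t =
    (\<Sum>j\<in>UNIV. rs j (\<lambda>r. rs j (\<lambda>u. \<Sum>a\<le>n. Klevel (n - a) s u * Klevel a u r) s r) s t)"
proof -
  have c: "continuous_on {s..t} (\<lambda>r. \<Sum>w\<in>words (Suc n). of_nat (noncrossing_count (j # w)) * sig w s r)" for j
    using assms by (intro continuous_on_sum continuous_on_mult_left continuous_on_sig') auto
  have "rs j (\<lambda>r. rs j (\<lambda>u. \<Sum>a\<le>n. Klevel (n - a) s u * Klevel a u r) s r) s t =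
     rs j (\<lambda>r. \<Sum>w\<in>words (Suc n). of_nat (noncrossing_count (j # w)) * sig w s r) s t" for j
    by (rule rs_cong[OF assms c, symmetric]) (use assms in \<open>auto simp: rs_Klevel_mult_Klevel\<close>)
  also have "rs j (\<lambda>r. \<Sum>w\<in>words (Suc n). of_nat (noncrossing_count (j # w)) * sig w s r) s t =
     (\<Sum>w\<in>words (Suc n). of_nat (noncrossing_count (j # w)) * sig (j # w) s t)" for j
    using assms by (simp add: rs_sum rs_cmult continuous_on_mult_left continuous_on_sig')
  finally show ?thesis unfolding Klevel_def by (subst sum_words_Suc) simp
qed

end

lemma uniform_limit_on_image:
  assumes "uniform_limit X f l F" "h ` Y \<subseteq> X"
  shows "uniform_limit Y (\<lambda>n y. f n (h y)) (\<lambda>y. l (h y)) F"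
  unfolding uniform_limit_iff
proof (intro allI impI)
  fix e :: real assume "e > 0"
  from uniform_limitD[OF assms(1) this] show "\<forall>\<^sub>F n in F. \<forall>y\<in>Y. dist (f n (h y)) (l (h y)) < e"
    by eventually_elim (use assms(2) in auto)
qed

text \<open>The hypotheses under which the series may be multiplied and integrated term by term. The majorant is
kept abstract, since it will come from the moments of the matrices.\<close>

locale summable_levels = controlled_path +
  fixes b :: "nat \<Rightarrow> real"
  assumes Klevel_bound: "\<And>n s t. 0 \<le> s \<Longrightarrow> s \<le> t \<Longrightarrow> t \<le> T \<Longrightarrow> norm (Klevel n s t) \<le> b n"
    and summable_b: "summable b" and T_nonneg: "0 \<le> T"
begin

lemma b_nonneg: "0 \<le> b n"
  using Klevel_bound[of 0 0 n] T_nonneg norm_ge_zero order_trans by blast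

definition time_simplex :: "(real \<times> real) set" where "time_simplex = {(s, t). 0 \<le> s \<and> s \<le> t \<and> t \<le> T}"

lemma norm_level_le: "0 \<le> s \<Longrightarrow> s \<le> t \<Longrightarrow> t \<le> T \<Longrightarrow> norm (\<i> ^ n * Klevel n s t) \<le> b n"
  by (simp add: norm_mult norm_power Klevel_bound)

lemma Kseries_sums:
  assumes "0 \<le> s" "s \<le> t" "t \<le> T"
  shows "(\<lambda>n. \<i> ^ n * Klevel n s t) sums Kseries s t"
  unfolding Kseries_def
  by (rule summable_sums, rule summable_comparison_test'[OF summable_b, of 0]) (use norm_level_le assms in auto)

lemma Kseries_uniform:
  "uniform_limit time_simplex (\<lambda>m (s, t). \<Sum>n<m. \<i> ^ n * Klevel n s t) (\<lambda>(s, t). Kseries s t) sequentially"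
proof -
  have "uniform_limit time_simplex (\<lambda>m x. \<Sum>n<m. \<i> ^ n * Klevel n (fst x) (snd x)) (\<lambda>x. \<Sum>n. \<i> ^ n * Klevel n (fst x) (snd x)) sequentially"
    by (rule Weierstrass_m_test[OF _ summable_b]) (auto simp: time_simplex_def norm_level_le)
  thus ?thesis by (simp add: Kseries_def case_prod_unfold)
qed

lemma continuous_on_Klevel: "0 \<le> s \<Longrightarrow> s \<le> c \<Longrightarrow> d \<le> T \<Longrightarrow> continuous_on {c..d} (Klevel n s)"
  unfolding Klevel_def by (intro continuous_on_sum continuous_on_mult_left continuous_on_sig') auto

lemma continuous_on_Klevel_start: "t \<le> T \<Longrightarrow> 0 \<le> c \<Longrightarrow> d \<le> t \<Longrightarrow> continuous_on {c..d} (\<lambda>u. Klevel n u t)"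
  unfolding Klevel_def by (intro continuous_on_sum continuous_on_mult_left continuous_on_sig_start) auto

lemma continuous_on_Kseries:
  assumes "0 \<le> s" "s \<le> c" "d \<le> T" shows "continuous_on {c..d} (Kseries s)"
proof (rule uniform_limit_theorem)
  show "uniform_limit {c..d} (\<lambda>m t. \<Sum>n<m. \<i> ^ n * Klevel n s t) (Kseries s) sequentially"
  proof -
    have "(\<lambda>t. (s, t)) ` {c..d} \<subseteq> time_simplex" using assms by (auto simp: time_simplex_def)
    from uniform_limit_on_image[OF Kseries_uniform this] show ?thesis by simp
  qed
  show "\<forall>\<^sub>F m in sequentially. continuous_on {c..d} (\<lambda>t. \<Sum>n<m. \<i> ^ n * Klevel n s t)"
    using assms by (intro always_eventually allI continuous_on_sum continuous_on_mult_left continuous_on_Klevel) auto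
qed simp

lemma continuous_on_Kseries_start:
  assumes "t \<le> T" "0 \<le> c" "d \<le> t" shows "continuous_on {c..d} (\<lambda>s. Kseries s t)"
proof (rule uniform_limit_theorem)
  show "uniform_limit {c..d} (\<lambda>m s. \<Sum>n<m. \<i> ^ n * Klevel n s t) (\<lambda>s. Kseries s t) sequentially"
  proof -
    have "(\<lambda>s. (s, t)) ` {c..d} \<subseteq> time_simplex" using assms by (auto simp: time_simplex_def)
    from uniform_limit_on_image[OF Kseries_uniform this] show ?thesis by simp
  qed
  show "\<forall>\<^sub>F m in sequentially. continuous_on {c..d} (\<lambda>s. \<Sum>n<m. \<i> ^ n * Klevel n s t)"
    using assms by (intro always_eventually allI continuous_on_sum continuous_on_mult_left continuous_on_Klevel_start) auto
qed simp

text \<open>Partial sums of the Cauchy product of the series for \<open>K(u,r)\<close> and \<open>K(s,u)\<close>.\<close>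

definition Kprod :: "real \<Rightarrow> nat \<Rightarrow> real \<Rightarrow> real \<Rightarrow> complex" where
  "Kprod s m u r = (\<Sum>n<m. \<i> ^ n * (\<Sum>a\<le>n. Klevel (n - a) s u * Klevel a u r))"

lemma Kprod_uniform:
  assumes "0 \<le> s"
  shows "uniform_limit {(u, r). s \<le> u \<and> u \<le> r \<and> r \<le> T} (\<lambda>m (u, r). Kprod s m u r)
     (\<lambda>(u, r). Kseries s u * Kseries u r) sequentially"
proof -
  let ?X = "{(u, r). s \<le> u \<and> u \<le> r \<and> r \<le> T}"
  let ?c = "\<lambda>n x. \<i> ^ n * (\<Sum>a\<le>n. Klevel (n - a) s (fst x) * Klevel a (fst x) (snd x))"
  have sb: "summable (\<lambda>n. norm (b n))" using summable_b b_nonneg by simp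
  have M: "summable (\<lambda>n. \<Sum>a\<le>n. b a * b (n - a))" using summable_Cauchy_product[OF sb sb] .
  have u: "uniform_limit ?X (\<lambda>m x. \<Sum>n<m. ?c n x) (\<lambda>x. \<Sum>n. ?c n x) sequentially"
  proof (rule Weierstrass_m_test[OF _ M])
    fix n x assume "x \<in> ?X"
    hence h: "s \<le> fst x" "fst x \<le> snd x" "snd x \<le> T" by auto
    have "norm (?c n x) = norm (\<Sum>a\<le>n. Klevel (n - a) s (fst x) * Klevel a (fst x) (snd x))"
      by (simp add: norm_mult norm_power)
    also have "\<dots> \<le> (\<Sum>a\<le>n. b (n - a) * b a)"
      by (rule sum_norm_le) (use h assms b_nonneg in \<open>auto simp: norm_mult intro!: mult_mono Klevel_bound\<close>)
    finally show "norm (?c n x) \<le> (\<Sum>a\<le>n. b a * b (n - a))" by (simp add: mult.commute)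
  qed
  have lim: "(\<Sum>n. ?c n x) = Kseries s (fst x) * Kseries (fst x) (snd x)" if "x \<in> ?X" for x
  proof -
    from that have h: "s \<le> fst x" "fst x \<le> snd x" "snd x \<le> T" by auto
    let ?a = "\<lambda>n. \<i> ^ n * Klevel n (fst x) (snd x)" and ?d = "\<lambda>n. \<i> ^ n * Klevel n s (fst x)"
    have "summable (\<lambda>n. norm (?a n))" "summable (\<lambda>n. norm (?d n))"
      by (rule summable_comparison_test'[OF summable_b, of 0]; use norm_level_le h assms in auto)+
    from Cauchy_product_sums[OF this]
    have "(\<lambda>n. \<Sum>i\<le>n. ?a i * ?d (n - i)) sums (Kseries (fst x) (snd x) * Kseries s (fst x))"
      unfolding Kseries_def .
    moreover have "(\<lambda>n. \<Sum>i\<le>n. ?a i * ?d (n - i)) = (\<lambda>n. ?c n x)"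
    proof
      fix n
      have "?a i * ?d (n - i) = \<i> ^ n * (Klevel (n - i) s (fst x) * Klevel i (fst x) (snd x))" if "i \<le> n" for i
      proof -
        have "(\<i> :: complex) ^ n = \<i> ^ i * \<i> ^ (n - i)" using that by (simp flip: power_add)
        thus ?thesis by (simp add: mult_ac)
      qed
      thus "(\<Sum>i\<le>n. ?a i * ?d (n - i)) = ?c n x"
        unfolding sum_distrib_left by (intro sum.cong refl) simp
    qed
    ultimately have "(\<lambda>n. ?c n x) sums (Kseries (fst x) (snd x) * Kseries s (fst x))" by (simp only:)
    from sums_unique[OF this] show ?thesis by (simp only: mult.commute)
  qed
  have "uniform_limit ?X (\<lambda>m x. \<Sum>n<m. ?c n x) (\<lambda>x. Kseries s (fst x) * Kseries (fst x) (snd x)) sequentially"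
    using u by (rule uniform_limit_cong'[THEN iffD1, rotated 2]) (use lim in auto)
  thus ?thesis by (simp add: Kprod_def case_prod_unfold)
qed

lemma continuous_on_Klevel_mult:
  "0 \<le> s \<Longrightarrow> r \<le> T \<Longrightarrow> continuous_on {s..r} (\<lambda>u. \<Sum>a\<le>n. Klevel (n - a) s u * Klevel a u r)"
  by (intro continuous_on_sum continuous_on_mult continuous_on_Klevel continuous_on_Klevel_start) auto

lemma continuous_on_Kprod: "0 \<le> s \<Longrightarrow> r \<le> T \<Longrightarrow> continuous_on {s..r} (\<lambda>u. Kprod s m u r)"
  unfolding Kprod_def by (intro continuous_on_sum continuous_on_mult_left continuous_on_Klevel_mult)

lemma continuous_on_KK: "0 \<le> s \<Longrightarrow> r \<le> T \<Longrightarrow> continuous_on {s..r} (\<lambda>u. Kseries s u * Kseries u r)"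
  by (intro continuous_on_mult continuous_on_Kseries continuous_on_Kseries_start) auto

lemma rs_Klevel_mult_continuous:
  assumes "0 \<le> s" "t \<le> T"
  shows "continuous_on {s..t} (\<lambda>r. rs j (\<lambda>u. \<Sum>a\<le>n. Klevel (n - a) s u * Klevel a u r) s r)"
proof -
  have "continuous_on {s..t} (\<lambda>r. \<Sum>w\<in>words (Suc n). of_nat (noncrossing_count (j # w)) * sig w s r)"
    using assms by (intro continuous_on_sum continuous_on_mult_left continuous_on_sig') auto
  thus ?thesis using assms
    by (subst continuous_on_cong[OF refl rs_Klevel_mult_Klevel]) auto
qed

lemma rs_Kprod:
  assumes "0 \<le> s" "s \<le> r" "r \<le> T"
  shows "rs j (\<lambda>u. Kprod s m u r) s r = (\<Sum>n<m. \<i> ^ n * rs j (\<lambda>u. \<Sum>a\<le>n. Klevel (n - a) s u * Klevel a u r) s r)"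
  unfolding Kprod_def using assms
  by (simp add: rs_sum rs_cmult continuous_on_mult_left continuous_on_Klevel_mult)

lemma continuous_on_rs_Kprod:
  assumes "0 \<le> s" "t \<le> T"
  shows "continuous_on {s..t} (\<lambda>r. rs j (\<lambda>u. Kprod s m u r) s r)"
proof -
  have "continuous_on {s..t} (\<lambda>r. \<Sum>n<m. \<i> ^ n * rs j (\<lambda>u. \<Sum>a\<le>n. Klevel (n - a) s u * Klevel a u r) s r)"
    by (intro continuous_on_sum continuous_on_mult_left rs_Klevel_mult_continuous assms)
  thus ?thesis using assms by (subst continuous_on_cong[OF refl rs_Kprod]) auto
qed

lemma rs_Kprod_uniform:
  assumes "0 \<le> s" "t \<le> T"
  shows "uniform_limit {s..t} (\<lambda>m r. rs j (\<lambda>u. Kprod s m u r) s r) (\<lambda>r. rs j (\<lambda>u. Kseries s u * Kseries u r) s r) sequentially"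
  unfolding uniform_limit_iff
proof (intro allI impI)
  fix e :: real assume "e > 0"
  define \<epsilon> where "\<epsilon> = e / (1 + \<bar>V T - V 0\<bar>)"
  have e: "\<epsilon> > 0" using \<open>e > 0\<close> by (simp add: \<epsilon>_def)
  show "\<forall>\<^sub>F m in sequentially. \<forall>r\<in>{s..t}. dist (rs j (\<lambda>u. Kprod s m u r) s r) (rs j (\<lambda>u. Kseries s u * Kseries u r) s r) < e"
    using uniform_limitD[OF Kprod_uniform[OF assms(1)] e]
  proof eventually_elim
    case (elim m)
    show ?case
    proof
      fix r assume r: "r \<in> {s..t}"
      have v: "V 0 \<le> V s" "V s \<le> V r" "V r \<le> V T" using r assms by (auto intro!: V_mono)
      have "norm (rs j (\<lambda>u. Kprod s m u r - Kseries s u * Kseries u r) s r) \<le> \<epsilon> * (V r - V s)"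
      proof (rule norm_rs_le)
        show "continuous_on {s..r} (\<lambda>u. Kprod s m u r - Kseries s u * Kseries u r)"
          using assms r by (intro continuous_on_diff continuous_on_Kprod continuous_on_KK) auto
        show "norm (Kprod s m u r - Kseries s u * Kseries u r) \<le> \<epsilon>" if "u \<in> {s..r}" for u
        proof -
          have "dist (Kprod s m u r) (Kseries s u * Kseries u r) < \<epsilon>"
            using elim[rule_format, of "(u, r)"] that r assms by auto
          thus ?thesis by (simp add: dist_norm)
        qed
      qed (use r assms in auto)
      also have "\<dots> \<le> \<epsilon> * \<bar>V T - V 0\<bar>" using v e by (intro mult_left_mono) auto
      also have "\<dots> < \<epsilon> * (1 + \<bar>V T - V 0\<bar>)" using e by simp
      also have "\<dots> = e" by (simp add: \<epsilon>_def)
      finally show "dist (rs j (\<lambda>u. Kprod s m u r) s r) (rs j (\<lambda>u. Kseries s u * Kseries u r) s r) < e"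
        using r assms by (simp add: dist_norm rs_diff continuous_on_Kprod continuous_on_KK)
    qed
  qed
qed

text \<open>Integrating twice the partial sums of the Cauchy product yields the partial sums of the series without
the terms of degree \<open>0\<close> and \<open>1\<close>, up to the factor \<open>\<i>\<^sup>2\<close>; the former is \<open>1\<close>, the latter vanishes because
a word of one letter has no pairing.\<close>

lemma Kseries_functional_equation:
  assumes st: "0 \<le> s" "s \<le> t" "t \<le> T"
  shows "Kseries s t = 1 - (\<Sum>j\<in>UNIV. rs j (\<lambda>r. rs j (\<lambda>u. Kseries s u * Kseries u r) s r) s t)"
proof -
  have "(\<lambda>m. rs j (\<lambda>r. rs j (\<lambda>u. Kprod s m u r) s r) s t) \<longlonglongrightarrow>
      rs j (\<lambda>r. rs j (\<lambda>u. Kseries s u * Kseries u r) s r) s t" for j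
    by (rule tendsto_rs[OF st continuous_on_rs_Kprod rs_Kprod_uniform]) (use st in auto)
  hence lim1: "(\<lambda>m. \<Sum>j\<in>UNIV. rs j (\<lambda>r. rs j (\<lambda>u. Kprod s m u r) s r) s t) \<longlonglongrightarrow>
      (\<Sum>j\<in>UNIV. rs j (\<lambda>r. rs j (\<lambda>u. Kseries s u * Kseries u r) s r) s t)"
    by (intro tendsto_sum)
  have eq: "(\<Sum>j\<in>UNIV. rs j (\<lambda>r. rs j (\<lambda>u. Kprod s m u r) s r) s t) =
     1 - (\<Sum>n<Suc (Suc m). \<i> ^ n * Klevel n s t)" for m
  proof -
    have "rs j (\<lambda>r. rs j (\<lambda>u. Kprod s m u r) s r) s t =
        (\<Sum>n<m. \<i> ^ n * rs j (\<lambda>r. rs j (\<lambda>u. \<Sum>a\<le>n. Klevel (n - a) s u * Klevel a u r) s r) s t)" for j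
    proof -
      have "rs j (\<lambda>r. rs j (\<lambda>u. Kprod s m u r) s r) s t =
        rs j (\<lambda>r. \<Sum>n<m. \<i> ^ n * rs j (\<lambda>u. \<Sum>a\<le>n. Klevel (n - a) s u * Klevel a u r) s r) s t"
        using st by (intro rs_cong continuous_on_rs_Kprod rs_Kprod) auto
      thus ?thesis using st
        by (simp add: rs_sum rs_cmult continuous_on_mult_left rs_Klevel_mult_continuous)
    qed
    hence "(\<Sum>j\<in>UNIV. rs j (\<lambda>r. rs j (\<lambda>u. Kprod s m u r) s r) s t) =
       (\<Sum>n<m. \<i> ^ n * Klevel (Suc (Suc n)) s t)"
      using st by (simp add: Klevel_Suc_Suc sum_distrib_left) (rule sum.swap)
    also have "\<dots> = 1 - (\<Sum>n<Suc (Suc m). \<i> ^ n * Klevel n s t)"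
      unfolding sum.lessThan_Suc_shift by (simp add: Klevel_0 Klevel_1 sum_negf)
    finally show ?thesis .
  qed
  have "(\<lambda>m. \<Sum>n<Suc (Suc m). \<i> ^ n * Klevel n s t) \<longlonglongrightarrow> Kseries s t"
    by (rule LIMSEQ_Suc[OF LIMSEQ_Suc[OF Kseries_sums[OF st, unfolded sums_def]]])
  hence "(\<lambda>m. 1 - (\<Sum>n<Suc (Suc m). \<i> ^ n * Klevel n s t)) \<longlonglongrightarrow> 1 - Kseries s t"
    by (intro tendsto_intros)
  from LIMSEQ_unique[OF this lim1[unfolded eq], symmetric] show ?thesis by simp
qed

lemma Kseries_refl:
  assumes "0 \<le> s" "s \<le> T" shows "Kseries s s = 1"
  using Kseries_functional_equation[of s s] assms by (simp add: rs_refl)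

lemma Kseries_has_RS_double_integral:
  fixes \<gamma> :: "real \<Rightarrow> real^'a"
  assumes st: "0 \<le> s" "s \<le> t" "t \<le> T" and g: "\<And>j u. vec_nth (\<gamma> u) j = g j u"
  shows "has_RS_double_integral (\<lambda>u r. Kseries s u * Kseries u r) \<gamma> s t
     (\<Sum>j\<in>UNIV. rs j (\<lambda>r. rs j (\<lambda>u. Kseries s u * Kseries u r) s r) s t)"
  unfolding has_RS_double_integral_def g
proof (intro exI[of _ "\<lambda>j r. rs j (\<lambda>u. Kseries s u * Kseries u r) s r"]
      exI[of _ "\<lambda>j. rs j (\<lambda>r. rs j (\<lambda>u. Kseries s u * Kseries u r) s r) s t"] conjI allI ballI refl)
  fix j r assume "r \<in> {s..t}"
  thus "has_RS_integral (\<lambda>u. Kseries s u * Kseries u r) (g j) s r (rs j (\<lambda>u. Kseries s u * Kseries u r) s r)"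
    using st by (intro has_RS_integral_rs continuous_on_KK) auto
next
  fix j
  have "continuous_on {s..t} (\<lambda>r. rs j (\<lambda>u. Kseries s u * Kseries u r) s r)"
    by (rule uniform_limit_theorem[OF _ rs_Kprod_uniform]) (use st continuous_on_rs_Kprod in auto)
  thus "has_RS_integral (\<lambda>r. rs j (\<lambda>u. Kseries s u * Kseries u r) s r) (g j) s t
      (rs j (\<lambda>r. rs j (\<lambda>u. Kseries s u * Kseries u r) s r) s t)"
    using st by (intro has_RS_integral_rs) auto
qed

end

section \<open>The total variation of a continuous path\<close>

definition division_variation :: "(real \<Rightarrow> 'v::real_normed_vector) \<Rightarrow> real set set \<Rightarrow> real" where
  "division_variation \<gamma> D = (\<Sum>k\<in>D. norm (\<gamma> (Sup k) - \<gamma> (Inf k)))"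

definition variation :: "(real \<Rightarrow> 'v::real_normed_vector) \<Rightarrow> real \<Rightarrow> real" where
  "variation \<gamma> t = Sup {division_variation \<gamma> D | D. D division_of {0..t}}"

lemma division_variation_extend:
  assumes D: "D division_of {0..x}" and xy: "0 \<le> x" "x < y"
  shows "\<exists>D'. D' division_of {0..y} \<and> division_variation \<gamma> D' = division_variation \<gamma> D + norm (\<gamma> y - \<gamma> x)"
proof -
  have self: "{{x..y}} division_of {x..y}" using division_of_self[of x y] xy by simp
  have "interior {0..x} \<inter> interior {x..y} = {}" by auto
  from division_disjoint_union[OF D self this] have d: "insert {x..y} D division_of {0..y}"
    using xy by (simp add: ivl_disj_un_two_touch(4) Un_commute)
  have "{x..y} \<notin> D"
  proof
    assume "{x..y} \<in> D"
    hence "{x..y} \<subseteq> {0..x}" using D by blast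
    thus False using xy by auto
  qed
  moreover have "finite D" using D by blast
  ultimately have "division_variation \<gamma> (insert {x..y} D) = division_variation \<gamma> D + norm (\<gamma> y - \<gamma> x)"
    unfolding division_variation_def using xy by simp
  with d show ?thesis by blast
qed

lemma bdd_above_division_variation:
  assumes "finite_1_variation \<gamma> 0 T" "0 \<le> t" "t \<le> T"
  shows "bdd_above {division_variation \<gamma> D | D. D division_of {0..t}}"
proof -
  have T: "bdd_above {division_variation \<gamma> D | D. D division_of {0..T}}"
    using assms(1) unfolding finite_1_variation_def division_variation_def .
  show ?thesis
  proof (cases "t = T")
    case True thus ?thesis using T by simp
  next
    case False
    obtain b where b: "\<And>D. D division_of {0..T} \<Longrightarrow> division_variation \<gamma> D \<le> b"
      using T unfolding bdd_above_def by blast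
    have "division_variation \<gamma> D \<le> b" if D: "D division_of {0..t}" for D
    proof -
      obtain D' where D': "D' division_of {0..T}" "division_variation \<gamma> D' = division_variation \<gamma> D + norm (\<gamma> T - \<gamma> t)"
        using division_variation_extend[OF D, of T \<gamma>] assms False by auto
      have "division_variation \<gamma> D \<le> division_variation \<gamma> D'" using D'(2) by simp
      also have "\<dots> \<le> b" by (rule b[OF D'(1)])
      finally show ?thesis .
    qed
    thus ?thesis unfolding bdd_above_def by blast
  qed
qed

lemma variation_control:
  assumes fin: "finite_1_variation \<gamma> 0 T" and xy: "0 \<le> x" "x \<le> y" "y \<le> T"
  shows "norm (\<gamma> y - \<gamma> x) \<le> variation \<gamma> y - variation \<gamma> x"
proof (cases "x = y")
  case False
  have "variation \<gamma> x \<le> variation \<gamma> y - norm (\<gamma> y - \<gamma> x)"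
    unfolding variation_def[of \<gamma> x]
  proof (rule cSup_least)
    have "{{0..x}} division_of {0..x}" using division_of_self[of 0 x] xy by simp
    thus "{division_variation \<gamma> D |D. D division_of {0..x}} \<noteq> {}" by blast
    fix v assume "v \<in> {division_variation \<gamma> D |D. D division_of {0..x}}"
    then obtain D where D: "D division_of {0..x}" "v = division_variation \<gamma> D" by blast
    obtain D' where D': "D' division_of {0..y}" "division_variation \<gamma> D' = v + norm (\<gamma> y - \<gamma> x)"
      using division_variation_extend[OF D(1), of y \<gamma>] D(2) xy False by auto
    have "division_variation \<gamma> D' \<le> variation \<gamma> y"
      unfolding variation_def using D'(1) bdd_above_division_variation[OF fin, of y] xy by (intro cSup_upper) auto
    thus "v \<le> variation \<gamma> y - norm (\<gamma> y - \<gamma> x)" using D'(2) by simp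
  qed
  thus ?thesis by simp
qed simp

lemma sum_division_increments:
  fixes f :: "real \<Rightarrow> real"
  assumes "a \<le> b" "D division_of {a..b}"
  shows "(\<Sum>k\<in>D. f (Sup k) - f (Inf k)) = f b - f a"
proof -
  note d = division_ofD[OF assms(2)]
  have k: "Inf k \<in> k" if kD: "k \<in> D" for k
  proof -
    obtain u v where "k = cbox u v" using d(4)[OF kD] by blast
    thus ?thesis using d(3)[OF kD] by auto
  qed
  have t: "(\<lambda>k. (Inf k, k)) ` D tagged_division_of {a..b}"
  proof (rule tagged_division_ofI)
    have "{K. \<exists>x. (x, K) \<in> (\<lambda>k. (Inf k, k)) ` D} = D" by auto
    thus "\<Union>{K. \<exists>x. (x, K) \<in> (\<lambda>k. (Inf k, k)) ` D} = {a..b}" using d(6) by simp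
  next
    fix x1 K1 x2 K2 assume h: "(x1, K1) \<in> (\<lambda>k. (Inf k, k)) ` D" "(x2, K2) \<in> (\<lambda>k. (Inf k, k)) ` D" "(x1, K1) \<noteq> (x2, K2)"
    hence "K1 \<in> D" "K2 \<in> D" "K1 \<noteq> K2" by auto
    thus "interior K1 \<inter> interior K2 = {}" by (rule d(5))
  qed (use d(1,2,4) k in auto)
  have inj: "inj_on (\<lambda>k. (Inf k, k)) D" by (auto simp: inj_on_def)
  show ?thesis using additive_tagged_division_1[OF assms(1) t, of f] by (simp add: sum.reindex[OF inj])
qed

text \<open>Given a division \<open>D\<close> that nearly attains the total variation, let \<open>W t\<close> be the sum over \<open>D\<close> of the
displacements up to time \<open>t\<close>. It is continuous together with the path, and its increments are at most
those of the variation. As the total increments differ by less than \<open>e\<close>, so do the increments over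
every subinterval; thus the variation is continuous up to \<open>e\<close>.\<close>

lemma continuous_on_variation:
  fixes \<gamma> :: "real \<Rightarrow> 'v::real_normed_vector"
  assumes fin: "finite_1_variation \<gamma> 0 T" and cont: "continuous_on {0..T} \<gamma>" and T: "0 \<le> T"
  shows "continuous_on {0..T} (variation \<gamma>)"
proof -
  let ?V = "variation \<gamma>"
  have Vmono: "?V x \<le> ?V y" if "0 \<le> x" "x \<le> y" "y \<le> T" for x y
    using variation_control[OF fin that] norm_ge_zero[of "\<gamma> y - \<gamma> x"] by linarith
  have approx: "\<exists>W. continuous_on {0..T} W \<and> (\<forall>x y. 0 \<le> x \<longrightarrow> x \<le> y \<longrightarrow> y \<le> T \<longrightarrow> ?V y - ?V x \<le> W y - W x + e)"
    if "e > 0" for e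
  proof -
    have ne: "{division_variation \<gamma> D |D. D division_of {0..T}} \<noteq> {}"
      using division_of_self[of 0 T] T by fastforce
    have "?V T - e < Sup {division_variation \<gamma> D |D. D division_of {0..T}}" using that by (simp add: variation_def)
    from less_cSupD[OF ne this] obtain D where D: "D division_of {0..T}" and De: "?V T - e < division_variation \<gamma> D" by auto
    \<comment> \<open>the time \<open>t\<close> moved to the nearest point of the interval \<open>k\<close>\<close>
    define c where "c k t = max (Inf k) (min t (Sup k))" for k :: "real set" and t :: real
    define W where "W t = (\<Sum>k\<in>D. norm (\<gamma> (c k t) - \<gamma> (Inf k)))" for t
    note d = division_ofD[OF D]
    have kk: "0 \<le> Inf k" "Inf k \<le> Sup k" "Sup k \<le> T" if kD: "k \<in> D" for k
    proof -
      obtain u v where k: "k = cbox u v" using d(4)[OF kD] by blast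
      hence "u \<le> v" using d(3)[OF kD] by auto
      moreover have "{u..v} \<subseteq> {0..T}" using d(2)[OF kD] k by simp
      ultimately show "0 \<le> Inf k" "Inf k \<le> Sup k" "Sup k \<le> T" using k by auto
    qed
    have cr: "0 \<le> c k t" "c k t \<le> T" if "k \<in> D" for k t using kk[OF that] by (auto simp: c_def)
    have cm: "c k x \<le> c k y" if "x \<le> y" for k x y using that by (auto simp: c_def)
    have contW: "continuous_on {0..T} W" unfolding W_def
    proof (intro continuous_on_sum continuous_on_norm continuous_on_diff continuous_on_const)
      fix k assume k: "k \<in> D"
      have "continuous_on {0..T} (c k)" unfolding c_def by (intro continuous_intros)
      thus "continuous_on {0..T} (\<lambda>t. \<gamma> (c k t))"
        by (rule continuous_on_compose2[OF cont]) (use cr[OF k] in auto)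
    qed
    have tel: "(\<Sum>k\<in>D. ?V (c k t) - ?V (Inf k)) = ?V t - ?V 0" if t: "0 \<le> t" "t \<le> T" for t
    proof -
      have "(\<Sum>k\<in>D. ?V (c k t) - ?V (Inf k)) = (\<Sum>k\<in>D. ?V (min t (Sup k)) - ?V (min t (Inf k)))"
      proof (rule sum.cong[OF refl])
        fix k assume "k \<in> D"
        from kk(2)[OF this] show "?V (c k t) - ?V (Inf k) = ?V (min t (Sup k)) - ?V (min t (Inf k))"
          by (cases "t \<le> Inf k") (auto simp: c_def min_def max_def)
      qed
      also have "\<dots> = ?V t - ?V 0" using sum_division_increments[OF T D, of "\<lambda>u. ?V (min t u)"] t by simp
      finally show ?thesis .
    qed
    have WV: "W y - W x \<le> ?V y - ?V x" if h: "0 \<le> x" "x \<le> y" "y \<le> T" for x y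
    proof -
      have "W y - W x = (\<Sum>k\<in>D. norm (\<gamma> (c k y) - \<gamma> (Inf k)) - norm (\<gamma> (c k x) - \<gamma> (Inf k)))"
        by (simp add: W_def sum_subtractf)
      also have "\<dots> \<le> (\<Sum>k\<in>D. ?V (c k y) - ?V (c k x))"
      proof (rule sum_mono)
        fix k assume k: "k \<in> D"
        have "norm (\<gamma> (c k y) - \<gamma> (Inf k)) - norm (\<gamma> (c k x) - \<gamma> (Inf k)) \<le> norm (\<gamma> (c k y) - \<gamma> (c k x))"
          using norm_triangle_ineq2[of "\<gamma> (c k y) - \<gamma> (Inf k)" "\<gamma> (c k x) - \<gamma> (Inf k)"] by simp
        also have "\<dots> \<le> ?V (c k y) - ?V (c k x)" by (rule variation_control[OF fin]) (use cr[OF k] cm h in auto)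
        finally show "norm (\<gamma> (c k y) - \<gamma> (Inf k)) - norm (\<gamma> (c k x) - \<gamma> (Inf k)) \<le> ?V (c k y) - ?V (c k x)" .
      qed
      also have "\<dots> = (\<Sum>k\<in>D. ?V (c k y) - ?V (Inf k)) - (\<Sum>k\<in>D. ?V (c k x) - ?V (Inf k))"
        by (simp add: sum_subtractf)
      also have "\<dots> = ?V y - ?V x" using tel[of x] tel[of y] h by simp
      finally show ?thesis .
    qed
    have WT: "W T = division_variation \<gamma> D" unfolding W_def division_variation_def
      by (rule sum.cong[OF refl]) (use kk in \<open>auto simp: c_def\<close>)
    have "?V y - ?V x \<le> W y - W x + e" if h: "0 \<le> x" "x \<le> y" "y \<le> T" for x y
    proof -
      have "c k 0 = Inf k" if "k \<in> D" for k using kk[OF that] by (simp add: c_def min_def max_def)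
      hence W0: "W 0 = 0" by (simp add: W_def)
      have V0: "0 \<le> ?V 0"
      proof -
        have z: "0 = division_variation \<gamma> {{0..0}}" by (simp add: division_variation_def)
        have d0: "{{0..0}} division_of {0..0::real}" using division_of_self[of "0::real" 0] by simp
        have "0 \<in> {division_variation \<gamma> D |D. D division_of {0..0}}"
          unfolding mem_Collect_eq by (rule exI[of _ "{{0..0}}"]) (rule conjI[OF z d0])
        from cSup_upper[OF this bdd_above_division_variation[OF fin order_refl T]]
        show ?thesis unfolding variation_def .
      qed
      have "W x \<le> ?V x" using WV[of 0 x] h W0 V0 by simp
      moreover have "W T - W y \<le> ?V T - ?V y" using WV[of y T] h by simp
      ultimately show ?thesis using WT De by linarith
    qed
    with contW show ?thesis by blast
  qed
  show ?thesis unfolding continuous_on_iff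
  proof (intro ballI allI impI)
    fix x e :: real assume x: "x \<in> {0..T}" and e: "0 < e"
    obtain W where W: "continuous_on {0..T} W" "\<And>x y. 0 \<le> x \<Longrightarrow> x \<le> y \<Longrightarrow> y \<le> T \<Longrightarrow> ?V y - ?V x \<le> W y - W x + e/2"
      using approx[of "e/2"] e by auto
    obtain \<delta> where \<delta>: "\<delta> > 0" "\<And>y. y \<in> {0..T} \<Longrightarrow> dist y x < \<delta> \<Longrightarrow> dist (W y) (W x) < e/2"
      using W(1) x e unfolding continuous_on_iff by (meson half_gt_zero)
    show "\<exists>d>0. \<forall>x'\<in>{0..T}. dist x' x < d \<longrightarrow> dist (?V x') (?V x) < e"
    proof (intro exI[of _ \<delta>] conjI ballI impI \<delta>(1))
      fix y assume y: "y \<in> {0..T}" "dist y x < \<delta>"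
      have w: "W y - W x < e/2" "W x - W y < e/2" using \<delta>(2)[OF y] unfolding dist_real_def by linarith+
      show "dist (?V y) (?V x) < e"
      proof (cases "x \<le> y")
        case True
        hence "?V y - ?V x \<le> W y - W x + e/2" "?V x \<le> ?V y" using W(2)[of x y] Vmono[of x y] x y by auto
        thus ?thesis using w unfolding dist_real_def by linarith
      next
        case False
        hence "?V x - ?V y \<le> W x - W y + e/2" "?V y \<le> ?V x" using W(2)[of y x] Vmono[of y x] x y by auto
        thus ?thesis using w unfolding dist_real_def by linarith
      qed
    qed
  qed
qed

section \<open>The Picard series of the matrix equation\<close>

primrec word_prod :: "nat \<Rightarrow> ('d \<Rightarrow> complex mat) \<Rightarrow> 'd list \<Rightarrow> complex mat" where
  "word_prod N A [] = 1\<^sub>m N"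
| "word_prod N A (j # w) = word_prod N A w * A j"

lemma word_prod_carrier: "(\<And>j. A j \<in> carrier_mat N N) \<Longrightarrow> word_prod N A w \<in> carrier_mat N N"
  by (induction w) auto

lemma index_mult_carrier:
  assumes "A \<in> carrier_mat N N" "B \<in> carrier_mat N N" "m < N" "l < N"
  shows "(A * B) $$ (m, l) = (\<Sum>a<N. A $$ (m, a) * B $$ (a, l))"
  using assms by (simp add: scalar_prod_def lessThan_atLeast0)

context controlled_path
begin

definition picard_sum :: "nat \<Rightarrow> complex \<Rightarrow> ('d \<Rightarrow> complex mat) \<Rightarrow> real \<Rightarrow> nat \<Rightarrow> real \<Rightarrow> nat \<Rightarrow> nat \<Rightarrow> complex" where
  "picard_sum N c A s n t m l = (\<Sum>k<n. c ^ k * (\<Sum>w\<in>words k. sig w s t * word_prod N A w $$ (m, l)))"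

lemma continuous_on_picard_sum:
  "0 \<le> s \<Longrightarrow> b \<le> T \<Longrightarrow> continuous_on {s..b} (\<lambda>t. picard_sum N c A s n t m l)"
  unfolding picard_sum_def
  by (intro continuous_on_sum continuous_on_mult_left continuous_on_mult_right continuous_on_sig') auto

lemma picard_sum_Suc:
  assumes A: "\<And>j. A j \<in> carrier_mat N N" and st: "0 \<le> s" "s \<le> t" "t \<le> T" and ml: "m < N" "l < N"
  shows "picard_sum N c A s (Suc n) t m l = (1\<^sub>m N $$ (m, l)) +
    c * (\<Sum>j\<in>UNIV. rs j (\<lambda>u. \<Sum>a<N. picard_sum N c A s n u m a * A j $$ (a, l)) s t)"
proof -
  have cs: "continuous_on {s..t} (sig w s)" for w using st by (intro continuous_on_sig') auto
  have "rs j (\<lambda>u. \<Sum>a<N. picard_sum N c A s n u m a * A j $$ (a, l)) s t =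
     (\<Sum>k<n. c ^ k * (\<Sum>w\<in>words k. sig (j # w) s t * word_prod N A (j # w) $$ (m, l)))" for j
  proof -
    have "(\<lambda>u. \<Sum>a<N. picard_sum N c A s n u m a * A j $$ (a, l)) =
       (\<lambda>u. \<Sum>k<n. \<Sum>w\<in>words k. c ^ k * (\<Sum>a<N. word_prod N A w $$ (m, a) * A j $$ (a, l)) * sig w s u)"
    proof
      fix u
      have "(\<Sum>a<N. picard_sum N c A s n u m a * A j $$ (a, l)) =
        (\<Sum>a<N. \<Sum>k<n. \<Sum>w\<in>words k. c ^ k * (word_prod N A w $$ (m, a) * A j $$ (a, l)) * sig w s u)"
        unfolding picard_sum_def sum_distrib_left sum_distrib_right by (simp add: mult_ac)
      also have "\<dots> = (\<Sum>k<n. \<Sum>w\<in>words k. \<Sum>a<N. c ^ k * (word_prod N A w $$ (m, a) * A j $$ (a, l)) * sig w s u)"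
        by (subst sum.swap, subst (2) sum.swap) simp
      finally show "(\<Sum>a<N. picard_sum N c A s n u m a * A j $$ (a, l)) =
        (\<Sum>k<n. \<Sum>w\<in>words k. c ^ k * (\<Sum>a<N. word_prod N A w $$ (m, a) * A j $$ (a, l)) * sig w s u)"
        by (simp add: sum_distrib_left sum_distrib_right)
    qed
    also have "(\<lambda>u. \<Sum>k<n. \<Sum>w\<in>words k. c ^ k * (\<Sum>a<N. word_prod N A w $$ (m, a) * A j $$ (a, l)) * sig w s u) =
        (\<lambda>u. \<Sum>k<n. \<Sum>w\<in>words k. c ^ k * word_prod N A (j # w) $$ (m, l) * sig w s u)"
      by (simp only: word_prod.simps index_mult_carrier[OF word_prod_carrier[OF A] A ml])
    finally have "rs j (\<lambda>u. \<Sum>a<N. picard_sum N c A s n u m a * A j $$ (a, l)) s t =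
       rs j (\<lambda>u. \<Sum>k<n. \<Sum>w\<in>words k. c ^ k * word_prod N A (j # w) $$ (m, l) * sig w s u) s t"
      by (simp only:)
    also have "\<dots> = (\<Sum>k<n. \<Sum>w\<in>words k. rs j (\<lambda>u. c ^ k * word_prod N A (j # w) $$ (m, l) * sig w s u) s t)"
      using st by (simp only: rs_sum continuous_on_sum continuous_on_mult_left[OF cs])
    also have "\<dots> = (\<Sum>k<n. \<Sum>w\<in>words k. c ^ k * word_prod N A (j # w) $$ (m, l) * rs j (sig w s) s t)"
      using st by (simp only: rs_cmult cs)
    finally show ?thesis by (simp add: sum_distrib_left mult_ac del: word_prod.simps)
  qed
  hence "(\<Sum>j\<in>UNIV. rs j (\<lambda>u. \<Sum>a<N. picard_sum N c A s n u m a * A j $$ (a, l)) s t) =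
      (\<Sum>k<n. c ^ k * (\<Sum>w\<in>words (Suc k). sig w s t * word_prod N A w $$ (m, l)))"
    by (simp only: sum_words_Suc) (subst sum.swap, simp only: sum_distrib_left)
  thus ?thesis
    unfolding picard_sum_def by (subst sum.lessThan_Suc_shift) (simp add: sum_distrib_left mult_ac)
qed

text \<open>The difference between the solution and a Picard sum satisfies the integral equation without its
constant term, so each further step of the iteration gains a factor \<open>D (V u - V s) / (n + 1)\<close>. Besides
the expansion itself, this shows that the solution is a limit of polynomials in the entries of the
matrices, which is what makes its trace a random variable.\<close>

lemma CDE_solution_sums:
  fixes \<gamma> :: "real \<Rightarrow> real^'d"
  assumes sol: "unitary_CDE_solution N A \<gamma> s T Z" and A: "\<And>j. A j \<in> carrier_mat N N"
    and \<gamma>: "\<And>j u. vec_nth (\<gamma> u) j = g j u" and st: "0 \<le> s" "s \<le> t" "t \<le> T"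
  shows "(\<lambda>n. (\<i> / complex_of_real (sqrt (real N))) ^ n * (\<Sum>w\<in>words n. sig w s t * mat_trace (word_prod N A w)))
    sums mat_trace (Z t)"
proof -
  define c where "c = \<i> / complex_of_real (sqrt (real N))"
  have Zc: "Z u \<in> carrier_mat N N" if "u \<in> {s..T}" for u
    using sol that unfolding unitary_CDE_solution_def unitary_mats_def by auto
  have Zcont: "continuous_on {s..b} (\<lambda>t. Z t $$ (m, l))" if "m < N" "l < N" "b \<le> T" for m l b
  proof -
    have "continuous_on {s..T} (\<lambda>t. Z t $$ (m, l))" using sol that unfolding unitary_CDE_solution_def by blast
    thus ?thesis by (rule continuous_on_subset) (use that in auto)
  qed
  have Zint: "Z u $$ (m, l) = (1\<^sub>m N $$ (m, l)) + c * (\<Sum>j\<in>UNIV. rs j (\<lambda>u. \<Sum>a<N. Z u $$ (m, a) * A j $$ (a, l)) s u)"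
    if u: "u \<in> {s..T}" and ml: "m < N" "l < N" for u m l
  proof -
    obtain J where J: "\<And>j. has_RS_integral (\<lambda>u. (Z u * A j) $$ (m, l)) (\<lambda>u. vec_nth (\<gamma> u) j) s u (J j)"
      "Z u $$ (m, l) = Z s $$ (m, l) + c * (\<Sum>j\<in>UNIV. J j)" and Zs: "Z s = 1\<^sub>m N"
      using sol u ml unfolding unitary_CDE_solution_def c_def by meson
    have "rs j (\<lambda>u. \<Sum>a<N. Z u $$ (m, a) * A j $$ (a, l)) s u = J j" for j
    proof -
      have cont: "continuous_on {s..u} (\<lambda>u. \<Sum>a<N. Z u $$ (m, a) * A j $$ (a, l))"
        using ml u by (intro continuous_on_sum continuous_on_mult_right Zcont) auto
      have 1: "rs j (\<lambda>u. \<Sum>a<N. Z u $$ (m, a) * A j $$ (a, l)) s u = rs j (\<lambda>u. (Z u * A j) $$ (m, l)) s u"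
        by (rule rs_cong[OF _ _ _ cont]) (use st u in \<open>auto simp: index_mult_carrier[OF Zc A ml]\<close>)
      have 2: "rs j (\<lambda>u. (Z u * A j) $$ (m, l)) s u = J j" using J(1)[of j] u by (intro rs_eqI) (auto simp: \<gamma>)
      show ?thesis by (rule trans[OF 1 2])
    qed
    thus ?thesis using J(2) Zs by simp
  qed
  define \<alpha> where "\<alpha> j = (\<Sum>a<N. \<Sum>b<N. norm (A j $$ (a, b)))" for j
  define D where "D = norm c * (\<Sum>j\<in>UNIV. \<alpha> j)"
  have \<alpha>0: "0 \<le> \<alpha> j" for j unfolding \<alpha>_def by (intro sum_nonneg) auto
  have D0: "0 \<le> D" unfolding D_def using \<alpha>0 by (intro mult_nonneg_nonneg sum_nonneg) auto
  have colsum: "(\<Sum>a<N. norm (A j $$ (a, l))) \<le> \<alpha> j" if "l < N" for j l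
    unfolding \<alpha>_def using that by (intro sum_mono member_le_sum) auto
  have "\<exists>B\<ge>0. \<forall>u\<in>{s..T}. \<forall>m<N. \<forall>l<N. norm (Z u $$ (m, l)) \<le> B"
  proof -
    have "\<exists>b\<ge>0. \<forall>u\<in>{s..T}. norm (Z u $$ (m, l)) \<le> b" if "m < N" "l < N" for m l
      using continuous_on_bounded_Icc[OF Zcont[OF that order_refl]] by metis
    then obtain b where b: "\<And>m l. m < N \<Longrightarrow> l < N \<Longrightarrow> b m l \<ge> 0 \<and> (\<forall>u\<in>{s..T}. norm (Z u $$ (m, l)) \<le> b m l)"
      by metis
    have le: "b m l \<le> (\<Sum>m<N. \<Sum>l<N. b m l)" if "m < N" "l < N" for m l
    proof -
      have "b m l \<le> (\<Sum>l<N. b m l)" using that b by (intro member_le_sum) auto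
      also have "\<dots> \<le> (\<Sum>m<N. \<Sum>l<N. b m l)" using that b by (intro member_le_sum[where f = "\<lambda>m. \<Sum>l<N. b m l"] sum_nonneg) auto
      finally show ?thesis .
    qed
    show ?thesis
    proof (intro exI[of _ "\<Sum>m<N. \<Sum>l<N. b m l"] conjI ballI allI impI)
      show "0 \<le> (\<Sum>m<N. \<Sum>l<N. b m l)" using b by (intro sum_nonneg) auto
      fix u m l assume "u \<in> {s..T}" "m < N" "l < N"
      thus "norm (Z u $$ (m, l)) \<le> (\<Sum>m<N. \<Sum>l<N. b m l)" using b le order_trans by meson
    qed
  qed
  then obtain B where B: "B \<ge> 0" "\<And>u m l. u \<in> {s..T} \<Longrightarrow> m < N \<Longrightarrow> l < N \<Longrightarrow> norm (Z u $$ (m, l)) \<le> B" by meson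
  have est: "norm (Z u $$ (m, l) - picard_sum N c A s n u m l) \<le> B * D ^ n * (V u - V s) ^ n / fact n"
    if "u \<in> {s..T}" "m < N" "l < N" for n u m l
    using that
  proof (induction n arbitrary: u m l)
    case 0
    thus ?case using B by (simp add: picard_sum_def)
  next
    case (Suc n)
    let ?R = "\<lambda>j u. \<Sum>a<N. (Z u $$ (m, a) - picard_sum N c A s n u m a) * A j $$ (a, l)"
    have su: "0 \<le> s" "s \<le> u" "u \<le> T" using Suc.prems st by auto
    have c1: "continuous_on {s..u} (\<lambda>u. \<Sum>a<N. Z u $$ (m, a) * A j $$ (a, l))" for j
      using Suc.prems su by (intro continuous_on_sum continuous_on_mult_right Zcont) auto
    have c2: "continuous_on {s..u} (\<lambda>u. \<Sum>a<N. picard_sum N c A s n u m a * A j $$ (a, l))" for j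
      using su by (intro continuous_on_sum continuous_on_mult_right continuous_on_picard_sum) auto
    have R: "?R j = (\<lambda>u. (\<Sum>a<N. Z u $$ (m, a) * A j $$ (a, l)) - (\<Sum>a<N. picard_sum N c A s n u m a * A j $$ (a, l)))" for j
      by (simp add: left_diff_distrib sum_subtractf)
    have "Z u $$ (m, l) - picard_sum N c A s (Suc n) u m l = c * (\<Sum>j\<in>UNIV. rs j (?R j) s u)"
      unfolding R rs_diff[OF su c1 c2] sum_subtractf
      using Zint[OF Suc.prems] picard_sum_Suc[OF A su Suc.prems(2,3)] by (simp add: algebra_simps)
    hence "norm (Z u $$ (m, l) - picard_sum N c A s (Suc n) u m l) \<le> norm c * (\<Sum>j\<in>UNIV. norm (rs j (?R j) s u))"
      by (simp add: norm_mult mult_left_mono norm_sum)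
    also have "\<dots> \<le> norm c * (\<Sum>j\<in>UNIV. (B * D ^ n * \<alpha> j) * (V u - V s) ^ Suc n / fact (Suc n))"
    proof (intro mult_left_mono sum_mono norm_rs_le_power su)
      fix j :: 'd
      show "continuous_on {s..u} (?R j)" unfolding R by (intro continuous_on_diff c1 c2)
      show "0 \<le> B * D ^ n * \<alpha> j" using B(1) D0 \<alpha>0 by (intro mult_nonneg_nonneg) auto
      fix x assume x: "x \<in> {s..u}"
      have v: "V s \<le> V x" using x su by (auto intro!: V_mono)
      have "norm (?R j x) \<le> (\<Sum>a<N. B * D ^ n * (V x - V s) ^ n / fact n * norm (A j $$ (a, l)))"
      proof (rule sum_norm_le)
        fix a assume "a \<in> {..<N}"
        thus "norm ((Z x $$ (m, a) - picard_sum N c A s n x m a) * A j $$ (a, l)) \<le> B * D ^ n * (V x - V s) ^ n / fact n * norm (A j $$ (a, l))"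
          unfolding norm_mult using Suc x su by (intro mult_right_mono Suc.IH) auto
      qed
      also have "\<dots> = B * D ^ n * (V x - V s) ^ n / fact n * (\<Sum>a<N. norm (A j $$ (a, l)))"
        by (simp only: sum_distrib_left)
      also have "\<dots> \<le> B * D ^ n * (V x - V s) ^ n / fact n * \<alpha> j"
        using colsum[of l j] Suc.prems B(1) D0 v by (intro mult_left_mono) auto
      finally show "norm (?R j x) \<le> B * D ^ n * \<alpha> j * (V x - V s) ^ n / fact n" by (simp add: mult_ac)
    qed auto
    also have "\<dots> = B * D ^ Suc n * (V u - V s) ^ Suc n / fact (Suc n)"
      by (simp only: D_def power_Suc times_divide_eq_right[symmetric] sum_distrib_right[symmetric] sum_distrib_left[symmetric]) (simp add: mult_ac)
    finally show ?case .
  qed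
  have entry: "(\<lambda>n. c ^ n * (\<Sum>w\<in>words n. sig w s t * word_prod N A w $$ (m, l))) sums (Z t $$ (m, l))"
    if ml: "m < N" "l < N" for m l
    unfolding sums_def
  proof (rule LIM_zero_cancel, rule Lim_null_comparison)
    have tT: "t \<in> {s..T}" using st by simp
    show "\<forall>\<^sub>F n in sequentially. norm ((\<Sum>i<n. c ^ i * (\<Sum>w\<in>words i. sig w s t * word_prod N A w $$ (m, l))) - Z t $$ (m, l))
       \<le> B * ((D * (V t - V s)) ^ n / fact n)"
    proof (intro always_eventually allI)
      fix n
      show "norm ((\<Sum>i<n. c ^ i * (\<Sum>w\<in>words i. sig w s t * word_prod N A w $$ (m, l))) - Z t $$ (m, l)) \<le> B * ((D * (V t - V s)) ^ n / fact n)"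
        using est[OF tT ml, of n] by (simp add: picard_sum_def norm_minus_commute power_mult_distrib mult_ac)
    qed
    have "(\<lambda>n. (D * (V t - V s)) ^ n / fact n) \<longlonglongrightarrow> 0"
      using summable_LIMSEQ_zero[OF summable_exp[of "D * (V t - V s)"]] by (simp add: divide_inverse mult.commute)
    from tendsto_mult_right_zero[OF this] show "(\<lambda>n. B * ((D * (V t - V s)) ^ n / fact n)) \<longlonglongrightarrow> 0" .
  qed
  have dim: "dim_row (word_prod N A w) = N" for w by (rule carrier_matD(1)[OF word_prod_carrier[OF A]])
  have "(\<lambda>n. \<Sum>m<N. c ^ n * (\<Sum>w\<in>words n. sig w s t * word_prod N A w $$ (m, m))) sums (\<Sum>m<N. Z t $$ (m, m))"
    by (intro sums_sum entry) auto
  also have "(\<lambda>n. \<Sum>m<N. c ^ n * (\<Sum>w\<in>words n. sig w s t * word_prod N A w $$ (m, m))) =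
     (\<lambda>n. c ^ n * (\<Sum>w\<in>words n. sig w s t * mat_trace (word_prod N A w)))"
    unfolding mat_trace_def dim sum_distrib_left by (subst sum.swap) simp
  also have "(\<Sum>m<N. Z t $$ (m, m)) = mat_trace (Z t)"
    using Zc[of t] st by (simp add: mat_trace_def)
  finally show ?thesis unfolding c_def .
qed

end

section \<open>Closed walks in which every edge is traversed twice\<close>

definition edge :: "nat \<Rightarrow> nat \<Rightarrow> nat \<times> nat" where
  "edge a b = (min a b, max a b)"

fun edges :: "nat list \<Rightarrow> (nat \<times> nat) list" where
  "edges (b # c # xs) = edge c b # edges (c # xs)"
| "edges _ = []"

text \<open>The factors of a product of matrix entries along a walk. Reading the vertex list forwards means
following the product from right to left, so the step between consecutive list elements \<open>b, c\<close> is the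
entry at row \<open>c\<close> and column \<open>b\<close>.\<close>

fun steps :: "'d list \<Rightarrow> nat list \<Rightarrow> ('d \<times> nat \<times> nat) list" where
  "steps (j # w) (b # c # xs) = (j, c, b) # steps w (c # xs)"
| "steps _ _ = []"

definition support :: "('d \<times> nat \<times> nat) list \<Rightarrow> (nat \<times> nat) list" where
  "support = map (\<lambda>(i, a, b). edge a b)"

lemma edge_commute: "edge a b = edge b a"
  by (simp add: edge_def min.commute max.commute)

lemma edge_eq_iff: "edge a b = edge c d \<longleftrightarrow> a = c \<and> b = d \<or> a = d \<and> b = c"
  by (auto simp: edge_def min_def max_def split: if_splits)

lemma support_append [simp]: "support (L @ L') = support L @ support L'"
  and support_Cons [simp]: "support ((i, a, b) # L) = edge a b # support L"
  and support_Nil [simp]: "support [] = []"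
  by (simp_all add: support_def)

lemma length_edges: "length (edges xs) = length xs - 1"
  by (induction xs rule: edges.induct) auto

lemma length_steps: "length ys = Suc (length w) \<Longrightarrow> length (steps w ys) = length w"
  by (induction w ys rule: steps.induct) auto

lemma support_steps: "length ys = Suc (length w) \<Longrightarrow> support (steps w ys) = edges ys"
  by (induction w ys rule: steps.induct) (auto simp: length_Suc_conv)

lemma edges_append:
  "ys1 \<noteq> [] \<Longrightarrow> ys2 \<noteq> [] \<Longrightarrow> edges (ys1 @ ys2) = edges ys1 @ edge (hd ys2) (last ys1) # edges ys2"
proof (induction ys1 rule: edges.induct)
  case ("2_2" v)
  thus ?case by (cases ys2) auto
qed auto

lemma steps_append:
  "length ys1 = Suc (length q) \<Longrightarrow> length ys2 = Suc (length p) \<Longrightarrow>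
   steps (q @ i # p) (ys1 @ ys2) = steps q ys1 @ (i, hd ys2, last ys1) # steps p ys2"
proof (induction q arbitrary: ys1)
  case Nil
  then obtain a where "ys1 = [a]" by (auto simp: length_Suc_conv)
  moreover obtain b ys where "ys2 = b # ys" using Nil by (auto simp: length_Suc_conv)
  ultimately show ?case by simp
next
  case (Cons j q)
  then obtain a b ys where "ys1 = a # b # ys" by (auto simp: length_Suc_conv)
  thus ?case using Cons.IH[of "b # ys"] Cons.prems by simp
qed

lemma edges_subset: "set (edges xs) \<subseteq> set xs \<times> set xs"
  by (induction xs rule: edges.induct) (auto simp: edge_def min_def max_def)

text \<open>A walk that touches the vertex set \<open>S\<close> of a graph adds at least as many edges as vertices, because
every vertex outside \<open>S\<close> is reached along an edge of its own. If the walk still touches \<open>S\<close> after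
its first vertex, the induction peels off that vertex; otherwise the first vertex lies in \<open>S\<close>, and \<open>S\<close>
is enlarged by the second one.\<close>

lemma card_vertices_union_walk:
  assumes "finite S" "finite F" "F \<subseteq> S \<times> S" "set xs \<inter> S \<noteq> {}"
  shows "card (S \<union> set xs) + card F \<le> card S + card (F \<union> set (edges xs))"
  using assms
proof (induction xs arbitrary: S F rule: edges.induct)
  case (1 b c xs)
  note fin = 1(2,3)
  show ?case
  proof (cases "set (c # xs) \<inter> S = {}")
    case False
    have IH: "card (S \<union> set (c # xs)) + card F \<le> card S + card (F \<union> set (edges (c # xs)))"
      using 1 False by blast
    show ?thesis
    proof (cases "b \<in> S \<union> set (c # xs)")
      case True
      hence "S \<union> set (b # c # xs) = S \<union> set (c # xs)" by auto
      moreover have "card (F \<union> set (edges (c # xs))) \<le> card (F \<union> set (edges (b # c # xs)))"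
        using fin by (intro card_mono) auto
      ultimately show ?thesis using IH by simp
    next
      case False
      have "edge c b \<notin> F \<union> set (edges (c # xs))"
        using False 1(4) edges_subset[of "c # xs"] by (auto simp: edge_def min_def max_def split: if_splits)
      moreover have "F \<union> set (edges (b # c # xs)) = insert (edge c b) (F \<union> set (edges (c # xs)))" by auto
      ultimately have "card (F \<union> set (edges (b # c # xs))) = Suc (card (F \<union> set (edges (c # xs))))"
        using fin by simp
      moreover have "S \<union> set (b # c # xs) = insert b (S \<union> set (c # xs))" by auto
      hence "card (S \<union> set (b # c # xs)) = Suc (card (S \<union> set (c # xs)))" using False fin by simp
      ultimately show ?thesis using IH by simp
    qed
  next
    case True
    hence b: "b \<in> S" and c: "c \<notin> S" using 1(5) by auto
    have new: "edge c b \<notin> F" using c 1(4) by (auto simp: edge_def min_def max_def split: if_splits)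
    have "card (insert c S \<union> set (c # xs)) + card (insert (edge c b) F)
        \<le> card (insert c S) + card (insert (edge c b) F \<union> set (edges (c # xs)))"
    proof (rule 1(1))
      show "insert (edge c b) F \<subseteq> insert c S \<times> insert c S"
        using b 1(4) by (auto simp: edge_def min_def max_def)
    qed (use fin in auto)
    moreover have "insert c S \<union> set (c # xs) = S \<union> set (b # c # xs)" using b by auto
    moreover have "insert (edge c b) F \<union> set (edges (c # xs)) = F \<union> set (edges (b # c # xs))" by auto
    ultimately show ?thesis using fin c new by simp
  qed
next
  case ("2_2" v)
  hence "S \<union> set [v] = S" by auto
  thus ?case by simp
qed auto

lemma card_vertices_walk: "xs \<noteq> [] \<Longrightarrow> card (set xs) \<le> Suc (card (set (edges xs)))"
  using card_vertices_union_walk[of "{hd xs}" "{}" xs] by (auto simp: insert_absorb)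

lemma length_eq_sum_count_list: "length xs = (\<Sum>x\<in>set xs. count_list xs x)"
  using sum_count_set[of xs "set xs"] by simp

text \<open>Let the walk be closed by the edge from its last to its first vertex. There are \<open>length ys\<close> steps, each
edge is used at least twice, and the number of vertices exceeds the number of edges by at most one; the
assumption on the number of vertices forces equality everywhere.\<close>

lemma generic_walk_double_edges:
  assumes ys: "ys \<noteq> []" and gen: "length ys + 2 \<le> 2 * card (set ys)"
    and dbl: "\<And>e. e \<in> set (edge (hd ys) (last ys) # edges ys) \<Longrightarrow> 2 \<le> count_list (edge (hd ys) (last ys) # edges ys) e"
  shows "\<And>e. e \<in> set (edge (hd ys) (last ys) # edges ys) \<Longrightarrow> count_list (edge (hd ys) (last ys) # edges ys) e = 2"
    and "edge (hd ys) (last ys) \<in> set (edges ys)"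
    and "card (set ys) = Suc (card (set (edges ys)))"
proof -
  let ?f = "edge (hd ys) (last ys) # edges ys"
  show mem: "edge (hd ys) (last ys) \<in> set (edges ys)"
  proof (rule ccontr)
    assume "\<not> ?thesis"
    hence "count_list (edges ys) (edge (hd ys) (last ys)) = 0" by (simp add: count_list_0_iff)
    thus False using dbl[of "edge (hd ys) (last ys)"] by simp
  qed
  hence setf: "set ?f = set (edges ys)" by auto
  have len: "length ?f = length ys" using ys by (cases ys) (auto simp: length_edges)
  have v: "card (set ys) \<le> Suc (card (set ?f))" using card_vertices_walk[OF ys] setf by simp
  have cnt: "length ys = (\<Sum>e\<in>set ?f. count_list ?f e)" using length_eq_sum_count_list[of ?f] len by simp
  have split: "(\<Sum>e\<in>set ?f. count_list ?f e) = (\<Sum>e\<in>set ?f. count_list ?f e - 2) + (\<Sum>e\<in>set ?f. 2)"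
    unfolding sum.distrib[symmetric]
  proof (rule sum.cong[OF refl])
    fix e assume "e \<in> set ?f"
    from dbl[OF this] show "count_list ?f e = count_list ?f e - 2 + 2" by linarith
  qed
  have "2 * card (set ?f) + (\<Sum>e\<in>set ?f. count_list ?f e - 2) = length ys"
    using cnt split by simp
  with gen v have zero: "(\<Sum>e\<in>set ?f. count_list ?f e - 2) = 0" and eq: "card (set ys) = Suc (card (set ?f))" by linarith+
  show "count_list ?f e = 2" if "e \<in> set ?f" for e
    using sum_eq_0_iff[THEN iffD1, OF finite_set zero, rule_format, OF that] dbl[OF that] by linarith
  show "card (set ys) = Suc (card (set (edges ys)))" using eq setf by simp
qed

text \<open>If the two pieces left after removing both occurrences of the closing edge had a vertex in common, they
would form a connected graph with one edge less than the whole walk but all its vertices, which is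
impossible. Hence they are disjoint; in particular the two occurrences have opposite directions.\<close>

lemma generic_walk_split:
  assumes gen: "length ys + 2 \<le> 2 * card (set ys)"
    and dbl: "\<And>e. e \<in> set (edge (hd ys) (last ys) # edges ys) \<Longrightarrow> 2 \<le> count_list (edge (hd ys) (last ys) # edges ys) e"
    and ys: "ys = y1 @ y2" "y1 \<noteq> []" "y2 \<noteq> []" and e: "edge (hd y2) (last y1) = edge (hd ys) (last ys)"
  shows "hd y2 = last ys" "last y1 = hd ys"
    "edge (hd ys) (last ys) \<notin> set (edges y1)" "edge (hd ys) (last ys) \<notin> set (edges y2)"
    "set (edges y1) \<inter> set (edges y2) = {}"
proof -
  let ?e = "edge (hd ys) (last ys)"
  have ne: "ys \<noteq> []" using ys by simp
  note D = generic_walk_double_edges[OF ne gen dbl]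
  have ed: "edges ys = edges y1 @ ?e # edges y2" using edges_append[OF ys(2,3)] ys(1) e by simp
  have "count_list (edges y1) ?e + count_list (edges y2) ?e = 0"
    using D(1)[of ?e] ed by simp
  thus n1: "?e \<notin> set (edges y1)" and n2: "?e \<notin> set (edges y2)" by (auto simp: count_list_0_iff)
  have cE: "card (set (edges ys)) = Suc (card (set (edges y1) \<union> set (edges y2)))"
    unfolding ed using n1 n2 by simp
  have un: "card (set y1 \<union> set y2) \<le> Suc (card (set (edges y1) \<union> set (edges y2)))" if "set y2 \<inter> set y1 \<noteq> {}"
    using card_vertices_union_walk[OF _ _ edges_subset[of y1] that] card_vertices_walk[OF ys(2)] by simp
  have disj: "set y2 \<inter> set y1 = {}"
  proof (rule ccontr)
    assume "set y2 \<inter> set y1 \<noteq> {}"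
    from un[OF this] show False using D(3) cE ys(1) by simp
  qed
  have "hd ys = hd y1" using ys by simp
  hence "\<not> (hd y2 = hd ys \<and> last y1 = last ys)"
    using disj hd_in_set[OF ys(2)] hd_in_set[OF ys(3)] by auto
  thus "hd y2 = last ys" "last y1 = hd ys" using e by (auto simp: edge_eq_iff)
  have "set (edges y1) \<inter> set (edges y2) \<subseteq> (set y1 \<inter> set y2) \<times> UNIV"
    using edges_subset[of y1] edges_subset[of y2] by auto
  thus "set (edges y1) \<inter> set (edges y2) = {}" using disj by auto
qed

definition walks :: "nat \<Rightarrow> nat \<Rightarrow> nat list set" where
  "walks N n = {ys. set ys \<subseteq> {..<N} \<and> length ys = Suc n}"

definition closed_walks :: "nat \<Rightarrow> nat \<Rightarrow> nat list set" where
  "closed_walks N n = {ys \<in> walks N n. hd ys = last ys}"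

lemma finite_walks: "finite (walks N n)"
  unfolding walks_def by (rule finite_lists_length_eq) simp

lemma finite_closed_walks: "finite (closed_walks N n)"
  unfolding closed_walks_def using finite_walks by simp

text \<open>A walk with at most \<open>b\<close> vertices is given by a list of \<open>b\<close> vertices and, for each time, a position in
that list.\<close>

lemma card_walks_few_vertices:
  assumes "1 \<le> b" "1 \<le> N"
  shows "card {ys \<in> walks N n. card (set ys) \<le> b} \<le> b ^ Suc n * N ^ b"
proof -
  let ?A = "{zs. set zs \<subseteq> {..<N} \<and> length zs = b}" and ?B = "{is. set is \<subseteq> {..<b} \<and> length is = Suc n}"
  have fin: "finite ?A" "finite ?B" by (simp_all add: finite_lists_length_eq)
  have "{ys \<in> walks N n. card (set ys) \<le> b} \<subseteq> (\<lambda>(zs, is). map ((!) zs) is) ` (?A \<times> ?B)"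
  proof
    fix ys assume ys: "ys \<in> {ys \<in> walks N n. card (set ys) \<le> b}"
    define zs where "zs = remdups ys @ replicate (b - card (set ys)) (hd ys)"
    have ne: "ys \<noteq> []" using ys by (auto simp: walks_def)
    have len: "length zs = b" using ys by (auto simp: zs_def length_remdups_card_conv)
    have sub: "set zs = set ys" using ne by (auto simp: zs_def)
    have "\<forall>y\<in>set ys. \<exists>i<b. zs ! i = y" using sub len by (metis in_set_conv_nth)
    then obtain h where h: "\<And>y. y \<in> set ys \<Longrightarrow> h y < b \<and> zs ! h y = y" by metis
    have "ys = map ((!) zs) (map h ys)" using h by (simp add: map_idI)
    moreover have "zs \<in> ?A" using sub len ys by (auto simp: walks_def)
    moreover have "map h ys \<in> ?B" using h ys by (auto simp: walks_def)
    ultimately show "ys \<in> (\<lambda>(zs, is). map ((!) zs) is) ` (?A \<times> ?B)" by (metis (mono_tags, lifting) SigmaI case_prod_conv image_eqI)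
  qed
  hence "card {ys \<in> walks N n. card (set ys) \<le> b} \<le> card (?A \<times> ?B)"
    using fin by (meson card_image_le card_mono finite_SigmaI finite_imageI le_trans)
  also have "\<dots> = b ^ Suc n * N ^ b"
    by (simp add: card_cartesian_product card_lists_length_eq)
  finally show ?thesis .
qed

section \<open>Convergence of the moments\<close>

definition valid :: "nat \<Rightarrow> ('d \<times> nat \<times> nat) list \<Rightarrow> bool" where
  "valid N L \<longleftrightarrow> (\<forall>(i, a, b)\<in>set L. a < N \<and> b < N)"

lemma valid_append [simp]: "valid N (L @ L') \<longleftrightarrow> valid N L \<and> valid N L'"
  and valid_Cons [simp]: "valid N ((i, a, b) # L) \<longleftrightarrow> a < N \<and> b < N \<and> valid N L"
  and valid_Nil [simp]: "valid N []"
  by (simp_all add: valid_def ball_Un)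

lemma valid_steps: "set ys \<subseteq> {..<N} \<Longrightarrow> valid N (steps w ys)"
  by (induction w ys rule: steps.induct) auto

text \<open>What Wigner's argument uses about expectations of products of entries: \<open>E L\<close> stands for the expectation
of the product of the entries listed in \<open>L\<close>, and two lists are independent if the undirected edges
underlying them are disjoint. The bound \<open>C\<close> depends only on the number of factors, so that it can be
shared by all \<open>N\<close>.\<close>

locale moment_functional =
  fixes N :: nat and E :: "('d \<times> nat \<times> nat) list \<Rightarrow> complex" and C :: "nat \<Rightarrow> real"
  assumes N_pos: "1 \<le> N"
    and E_append: "\<And>L L'. valid N L \<Longrightarrow> valid N L' \<Longrightarrow> set (support L) \<inter> set (support L') = {} \<Longrightarrow> E (L @ L') = E L * E L'"
    and E_mset: "\<And>L L'. mset L = mset L' \<Longrightarrow> E L = E L'"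
    and E_Nil: "E [] = 1"
    and E_single: "\<And>i a b. a < N \<Longrightarrow> b < N \<Longrightarrow> E [(i, a, b)] = 0"
    and E_pair: "\<And>i j a b. a < N \<Longrightarrow> b < N \<Longrightarrow> E [(i, a, b), (j, b, a)] = (if i = j then 1 else 0)"
    and E_bound: "\<And>L. valid N L \<Longrightarrow> norm (E L) \<le> C (length L)"
begin

lemma C_nonneg: "0 \<le> C n"
proof -
  have "valid N (replicate n (undefined, 0, 0) :: ('d \<times> nat \<times> nat) list)" using N_pos by (auto simp: valid_def)
  from E_bound[OF this] show ?thesis by (metis length_replicate norm_ge_zero order_trans)
qed

lemma E_single_edge:
  assumes "valid N L" "count_list (support L) e = 1"
  shows "E L = 0"
proof -
  have "e \<in> set (support L)" using assms(2) by (metis count_notin zero_neq_one)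
  then obtain i a b where m: "(i, a, b) \<in> set L" "e = edge a b" by (auto simp: support_def)
  then obtain L1 L2 where L: "L = L1 @ (i, a, b) # L2" by (meson split_list)
  have "count_list (support L1) e + count_list (support L2) e = 0" using assms(2) L m(2) by simp
  hence n: "e \<notin> set (support L1)" "e \<notin> set (support L2)" by (auto simp: count_list_0_iff)
  have "E L = E ([(i, a, b)] @ (L1 @ L2))" by (rule E_mset) (simp add: L)
  also have "\<dots> = E [(i, a, b)] * E (L1 @ L2)"
    using assms(1) L n m(2) by (intro E_append) auto
  finally show ?thesis using assms(1) L by (simp add: E_single)
qed

text \<open>The contribution of the walk \<open>ys\<close> to the summand \<open>k\<close> of the recursion: the step \<open>k\<close> must be the
reverse of the closing step, which makes both remaining pieces closed walks.\<close>

definition split_term :: "'d \<Rightarrow> 'd list \<Rightarrow> nat list \<Rightarrow> nat \<Rightarrow> complex" where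
  "split_term j w ys k = (if w ! k = j \<and> ys ! Suc k = last ys \<and> ys ! k = hd ys
     then E (steps (take k w) (take (Suc k) ys)) * E (steps (drop (Suc k) w) (drop (Suc k) ys)) else 0)"

lemma split_walk:
  assumes "length ys = Suc (length w)" "k < length w"
  shows "last (take (Suc k) ys) = ys ! k" "hd (drop (Suc k) ys) = ys ! Suc k"
    "edges ys = edges (take (Suc k) ys) @ edge (ys ! Suc k) (ys ! k) # edges (drop (Suc k) ys)"
    "steps w ys = steps (take k w) (take (Suc k) ys) @ (w ! k, ys ! Suc k, ys ! k) # steps (drop (Suc k) w) (drop (Suc k) ys)"
proof -
  have ne: "take (Suc k) ys \<noteq> []" "drop (Suc k) ys \<noteq> []" using assms by auto
  show l: "last (take (Suc k) ys) = ys ! k" using assms by (simp add: take_Suc_conv_app_nth)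
  show h: "hd (drop (Suc k) ys) = ys ! Suc k" using assms by (simp add: hd_drop_conv_nth)
  show "edges ys = edges (take (Suc k) ys) @ edge (ys ! Suc k) (ys ! k) # edges (drop (Suc k) ys)"
    using edges_append[OF ne] by (simp add: l h del: take_Suc)
  have "steps (take k w @ w ! k # drop (Suc k) w) (take (Suc k) ys @ drop (Suc k) ys) =
    steps (take k w) (take (Suc k) ys) @ (w ! k, hd (drop (Suc k) ys), last (take (Suc k) ys)) # steps (drop (Suc k) w) (drop (Suc k) ys)"
    using assms by (intro steps_append) auto
  thus "steps w ys = steps (take k w) (take (Suc k) ys) @ (w ! k, ys ! Suc k, ys ! k) # steps (drop (Suc k) w) (drop (Suc k) ys)"
    using assms by (simp only: l h append_take_drop_id id_take_nth_drop[symmetric])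
qed

text \<open>If some edge is used once, both sides vanish. Otherwise every edge is used exactly twice, the closing
edge recurs at a unique position \<open>k\<close>, so only this summand survives, and independence splits the
expectation into the pair, whose value is \<open>1\<close> or \<open>0\<close>, and the two pieces.\<close>

lemma generic_walk_expectation:
  assumes ys: "ys \<in> walks N (length w)" and gen: "length ys + 2 \<le> 2 * card (set ys)"
  shows "E ((j, hd ys, last ys) # steps w ys) = (\<Sum>k<length w. split_term j w ys k)"
proof -
  let ?e = "edge (hd ys) (last ys)"
  let ?f = "?e # edges ys"
  have len: "length ys = Suc (length w)" and sub: "set ys \<subseteq> {..<N}" using ys by (auto simp: walks_def)
  hence ne: "ys \<noteq> []" by auto
  have hl: "hd ys < N" "last ys < N" using sub hd_in_set[OF ne] last_in_set[OF ne] by auto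
  have val: "valid N ((j, hd ys, last ys) # steps w ys)" using hl sub by (simp add: valid_steps)
  have sup: "support ((j, hd ys, last ys) # steps w ys) = ?f" using len by (simp add: support_steps)
  have vt: "valid N (steps q (take m ys))" "valid N (steps q (drop m ys))" for q m
    using sub by (auto intro!: valid_steps dest: in_set_takeD in_set_dropD)
  have st: "support (steps (take k w) (take (Suc k) ys)) = edges (take (Suc k) ys)"
     "support (steps (drop (Suc k) w) (drop (Suc k) ys)) = edges (drop (Suc k) ys)" if "k < length w" for k
    using that len by (simp_all add: support_steps)
  show ?thesis
  proof (cases "\<exists>e. count_list ?f e = 1")
    case True
    then obtain e where e: "count_list ?f e = 1" by blast
    have "E ((j, hd ys, last ys) # steps w ys) = 0" by (rule E_single_edge[OF val, of e]) (use e sup in simp)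
    moreover have "split_term j w ys k = 0" if k: "k < length w" for k
    proof (cases "ys ! Suc k = last ys \<and> ys ! k = hd ys")
      case True
      have ed: "edges ys = edges (take (Suc k) ys) @ ?e # edges (drop (Suc k) ys)"
        using split_walk(3)[OF len k] True by (simp add: edge_commute)
      have "e \<noteq> ?e" using e ed by auto
      hence "count_list (edges (take (Suc k) ys)) e + count_list (edges (drop (Suc k) ys)) e = 1"
        using e ed by simp
      hence "count_list (edges (take (Suc k) ys)) e = 1 \<or> count_list (edges (drop (Suc k) ys)) e = 1" by linarith
      hence "E (steps (take k w) (take (Suc k) ys)) = 0 \<or> E (steps (drop (Suc k) w) (drop (Suc k) ys)) = 0"
        using E_single_edge[OF vt(1)] E_single_edge[OF vt(2)] st[OF k] by metis
      thus ?thesis by (auto simp: split_term_def)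
    qed (auto simp: split_term_def)
    ultimately show ?thesis by simp
  next
    case False
    have dbl: "2 \<le> count_list ?f e" if "e \<in> set ?f" for e
    proof -
      have "count_list ?f e \<noteq> 0" using that by (metis count_list_0_iff)
      moreover have "count_list ?f e \<noteq> 1" using False by blast
      ultimately show ?thesis by linarith
    qed
    have "?e \<in> set (edges ys)" by (rule generic_walk_double_edges(2)[OF ne gen dbl])
    then obtain k where k: "k < length w" "edges ys ! k = ?e"
      using len by (auto simp: in_set_conv_nth length_edges)
    have key: "ys ! Suc k' = last ys \<and> ys ! k' = hd ys \<and> ?e \<notin> set (edges (take (Suc k') ys)) \<and>
        ?e \<notin> set (edges (drop (Suc k') ys)) \<and> set (edges (take (Suc k') ys)) \<inter> set (edges (drop (Suc k') ys)) = {}"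
      if k': "k' < length w" "edge (ys ! Suc k') (ys ! k') = ?e" for k'
    proof -
      have "take (Suc k') ys \<noteq> []" "drop (Suc k') ys \<noteq> []" using k' len by auto
      moreover have "edge (hd (drop (Suc k') ys)) (last (take (Suc k') ys)) = ?e"
        using split_walk(1,2)[OF len k'(1)] k'(2) by simp
      ultimately show ?thesis
        using generic_walk_split[OF gen dbl, of "take (Suc k') ys" "drop (Suc k') ys"] split_walk(1,2)[OF len k'(1)]
        by simp
    qed
    have ek: "edge (ys ! Suc k) (ys ! k) = ?e"
    proof -
      have "length (edges (take (Suc k) ys)) = k" using k len by (simp add: length_edges)
      hence "edges ys ! k = edge (ys ! Suc k) (ys ! k)" by (subst split_walk(3)[OF len k(1)]) (simp add: nth_append)
      thus ?thesis using k(2) by simp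
    qed
    note K = key[OF k(1) ek]
    have uniq: "k' = k" if k': "k' < length w" "edge (ys ! Suc k') (ys ! k') = ?e" for k'
    proof -
      have "edges (take (Suc k') ys) @ ?e # edges (drop (Suc k') ys) = edges (take (Suc k) ys) @ ?e # edges (drop (Suc k) ys)"
        using split_walk(3)[OF len k'(1)] split_walk(3)[OF len k(1)] k'(2) ek by simp
      hence "edges (take (Suc k') ys) = edges (take (Suc k) ys)"
        using key[OF k'] K append_Cons_eq_iff[of ?e "edges (take (Suc k') ys)" "edges (drop (Suc k') ys)"] by blast
      hence "length (edges (take (Suc k') ys)) = length (edges (take (Suc k) ys))" by simp
      thus ?thesis using k k' len by (simp add: length_edges)
    qed
    let ?q = "steps (take k w) (take (Suc k) ys)" and ?p = "steps (drop (Suc k) w) (drop (Suc k) ys)"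
    have s: "support ?q = edges (take (Suc k) ys)" "support ?p = edges (drop (Suc k) ys)" using st[OF k(1)] by auto
    have "E ((j, hd ys, last ys) # steps w ys) = E ([(j, hd ys, last ys), (w ! k, last ys, hd ys)] @ (?q @ ?p))"
      using K by (intro E_mset) (simp add: split_walk(4)[OF len k(1)])
    also have "\<dots> = E [(j, hd ys, last ys), (w ! k, last ys, hd ys)] * E (?q @ ?p)"
    proof (rule E_append)
      have "edge (last ys) (hd ys) = ?e" by (rule edge_commute)
      thus "set (support [(j, hd ys, last ys), (w ! k, last ys, hd ys)]) \<inter> set (support (?q @ ?p)) = {}"
        using K by (simp add: s)
    qed (use hl vt in auto)
    also have "E (?q @ ?p) = E ?q * E ?p" using vt K by (intro E_append) (auto simp: s)
    finally have lhs: "E ((j, hd ys, last ys) # steps w ys) = split_term j w ys k"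
      using K hl by (auto simp: split_term_def E_pair)
    have "split_term j w ys k' = (if k' = k then split_term j w ys k else 0)" if "k' \<in> {..<length w}" for k'
    proof (cases "k' = k")
      case False
      hence "edge (ys ! Suc k') (ys ! k') \<noteq> ?e" using uniq[of k'] that by auto
      hence "\<not> (ys ! Suc k' = last ys \<and> ys ! k' = hd ys)" using edge_commute[of "last ys" "hd ys"] by auto
      thus ?thesis using False by (auto simp: split_term_def)
    qed simp
    hence "(\<Sum>k'<length w. split_term j w ys k') = (\<Sum>k'<length w. if k' = k then split_term j w ys k else 0)"
      by (rule sum.cong[OF refl])
    also have "\<dots> = split_term j w ys k" using k(1) by (subst sum.delta) auto
    finally show ?thesis using lhs by (simp only:)
  qed
qed

definition trace_moment :: "'d list \<Rightarrow> complex" where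
  "trace_moment w = (\<Sum>ys\<in>closed_walks N (length w). E (steps w ys))"

lemma trace_moment_Nil: "trace_moment [] = of_nat N"
proof -
  have "closed_walks N 0 = (\<lambda>a. [a]) ` {..<N}"
    by (auto simp: closed_walks_def walks_def length_Suc_conv)
  hence "card (closed_walks N 0) = N" by (simp add: card_image inj_on_def)
  thus ?thesis by (simp add: trace_moment_def E_Nil)
qed

lemma trace_moment_Cons:
  "trace_moment (j # w) = (\<Sum>ys\<in>walks N (length w). E ((j, hd ys, last ys) # steps w ys))"
  unfolding trace_moment_def
proof (rule sum.reindex_bij_witness[where j = tl and i = "\<lambda>ys. last ys # ys"])
  fix ys assume "ys \<in> closed_walks N (length (j # w))"
  then obtain a b zs where "ys = a # b # zs" "a = last (b # zs)"
    by (auto simp: closed_walks_def walks_def length_Suc_conv)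
  thus "last (tl ys) # tl ys = ys" "E ((j, hd (tl ys), last (tl ys)) # steps w (tl ys)) = E (steps (j # w) ys)"
    by auto
  show "tl ys \<in> walks N (length w)"
    using \<open>ys = a # b # zs\<close> \<open>ys \<in> closed_walks N (length (j # w))\<close> by (auto simp: closed_walks_def walks_def)
next
  fix ys assume ys: "ys \<in> walks N (length w)"
  hence "ys \<noteq> []" by (auto simp: walks_def)
  from last_in_set[OF this] show "last ys # ys \<in> closed_walks N (length (j # w))"
    using ys by (auto simp: closed_walks_def walks_def)
qed auto

lemma sum_split_term:
  assumes k: "k < length w"
  shows "(\<Sum>ys\<in>walks N (length w). split_term j w ys k) =
    (if w ! k = j then trace_moment (take k w) * trace_moment (drop (Suc k) w) else 0)"
proof (cases "w ! k = j")
  case True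
  let ?q = "take k w" and ?p = "drop (Suc k) w"
  have "(\<Sum>ys\<in>walks N (length w). split_term j w ys k) = 
     (\<Sum>ys\<in>{ys \<in> walks N (length w). ys ! Suc k = last ys \<and> ys ! k = hd ys}.
        E (steps ?q (take (Suc k) ys)) * E (steps ?p (drop (Suc k) ys)))"
    unfolding split_term_def using True by (simp add: sum.inter_filter[OF finite_walks])
  also have "\<dots> = (\<Sum>(y1, y2)\<in>closed_walks N (length ?q) \<times> closed_walks N (length ?p). E (steps ?q y1) * E (steps ?p y2))"
  proof (rule sum.reindex_bij_witness[where j = "\<lambda>ys. (take (Suc k) ys, drop (Suc k) ys)" and i = "\<lambda>(y1, y2). y1 @ y2"])
    fix ys assume "ys \<in> {ys \<in> walks N (length w). ys ! Suc k = last ys \<and> ys ! k = hd ys}"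
    hence h: "set ys \<subseteq> {..<N}" "length ys = Suc (length w)" "ys ! Suc k = last ys" "ys ! k = hd ys"
      by (auto simp: walks_def)
    have "last (drop (Suc k) ys) = last ys" using h k by simp
    moreover have "hd (take (Suc k) ys) = hd ys" using h by (cases ys) auto
    ultimately show "(take (Suc k) ys, drop (Suc k) ys) \<in> closed_walks N (length ?q) \<times> closed_walks N (length ?p)"
      using h k split_walk(1,2)[OF h(2) k] by (auto simp: closed_walks_def walks_def dest: in_set_takeD in_set_dropD)
  next
    fix yy assume "yy \<in> closed_walks N (length ?q) \<times> closed_walks N (length ?p)"
    then obtain y1 y2 where yy: "yy = (y1, y2)" "length y1 = Suc k" "length y2 = length w - k" "set y1 \<subseteq> {..<N}" "set y2 \<subseteq> {..<N}"
       "hd y1 = last y1" "hd y2 = last y2" using k by (auto simp: closed_walks_def walks_def)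
    have ne: "y1 \<noteq> []" "y2 \<noteq> []" using yy k by auto
    have "y1 ! k = last y1" using yy ne by (simp add: last_conv_nth)
    moreover have "y2 ! 0 = hd y2" using ne by (simp add: hd_conv_nth)
    ultimately show "(case yy of (y1, y2) \<Rightarrow> y1 @ y2) \<in> {ys \<in> walks N (length w). ys ! Suc k = last ys \<and> ys ! k = hd ys}"
      using yy ne k by (auto simp: walks_def nth_append)
    show "(take (Suc k) (case yy of (y1, y2) \<Rightarrow> y1 @ y2), drop (Suc k) (case yy of (y1, y2) \<Rightarrow> y1 @ y2)) = yy"
      using yy by simp
  qed auto
  also have "\<dots> = trace_moment ?q * trace_moment ?p"
    unfolding trace_moment_def sum_product by (simp add: sum.cartesian_product)
  finally show ?thesis using True by simp
qed (simp add: split_term_def)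

text \<open>Only walks with at most \<open>(n + 2) div 2\<close> vertices contribute to the error, and there are
\<open>O(N^((n + 2) div 2))\<close> of them.\<close>

lemma trace_moment_recursion:
  fixes w :: "'d list" and j :: 'd
  defines "n \<equiv> length w"
  defines "D \<equiv> (\<Sum>l\<le>Suc n. C l)"
  shows "norm (trace_moment (j # w) -
      (\<Sum>k<n. if w ! k = j then trace_moment (take k w) * trace_moment (drop (Suc k) w) else 0))
    \<le> (D + real n * (D * D)) * real (((n + 2) div 2) ^ Suc n) * real N ^ ((n + 2) div 2)"
proof -
  have CD: "C l \<le> D" if "l \<le> Suc n" for l
    unfolding D_def using that C_nonneg by (intro member_le_sum) auto
  have D0: "0 \<le> D" unfolding D_def by (intro sum_nonneg C_nonneg)
  let ?d = "\<lambda>ys. E ((j, hd ys, last ys) # steps w ys) - (\<Sum>k<n. split_term j w ys k)"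
  let ?bad = "{ys \<in> walks N n. card (set ys) \<le> (n + 2) div 2}"
  have "trace_moment (j # w) - (\<Sum>k<n. if w ! k = j then trace_moment (take k w) * trace_moment (drop (Suc k) w) else 0)
     = (\<Sum>ys\<in>walks N n. E ((j, hd ys, last ys) # steps w ys)) - (\<Sum>k<n. \<Sum>ys\<in>walks N n. split_term j w ys k)"
    unfolding n_def by (simp add: trace_moment_Cons sum_split_term)
  also have "(\<Sum>k<n. \<Sum>ys\<in>walks N n. split_term j w ys k) = (\<Sum>ys\<in>walks N n. \<Sum>k<n. split_term j w ys k)"
    by (rule sum.swap)
  also have "(\<Sum>ys\<in>walks N n. E ((j, hd ys, last ys) # steps w ys)) - (\<Sum>ys\<in>walks N n. \<Sum>k<n. split_term j w ys k) = (\<Sum>ys\<in>walks N n. ?d ys)"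
    by (simp add: sum_subtractf)
  also have "\<dots> = (\<Sum>ys\<in>?bad. ?d ys)"
  proof (rule sum.mono_neutral_right[OF finite_walks])
    show "\<forall>ys\<in>walks N n - ?bad. ?d ys = 0"
    proof
      fix ys assume ys: "ys \<in> walks N n - ?bad"
      hence "length ys + 2 \<le> 2 * card (set ys)" by (auto simp: walks_def)
      thus "?d ys = 0" using generic_walk_expectation[of ys w j] ys by (simp add: n_def)
    qed
  qed auto
  finally have eq: "trace_moment (j # w) - (\<Sum>k<n. if w ! k = j then trace_moment (take k w) * trace_moment (drop (Suc k) w) else 0)
     = (\<Sum>ys\<in>?bad. ?d ys)" .
  have each: "norm (?d ys) \<le> D + real n * (D * D)" if "ys \<in> ?bad" for ys
  proof -
    have h: "set ys \<subseteq> {..<N}" "length ys = Suc n" using that by (auto simp: walks_def)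
    hence ne: "ys \<noteq> []" by auto
    have "norm (E ((j, hd ys, last ys) # steps w ys)) \<le> C (Suc n)"
      using E_bound[of "(j, hd ys, last ys) # steps w ys"] h hd_in_set[OF ne] last_in_set[OF ne] 
      by (auto simp: valid_steps length_steps n_def)
    also have "\<dots> \<le> D" by (rule CD) simp
    finally have 1: "norm (E ((j, hd ys, last ys) # steps w ys)) \<le> D" .
    have 2: "norm (split_term j w ys k) \<le> D * D" if k: "k < n" for k
    proof -
      have v: "valid N (steps (take k w) (take (Suc k) ys))" "valid N (steps (drop (Suc k) w) (drop (Suc k) ys))"
        using h by (auto intro!: valid_steps dest: in_set_takeD in_set_dropD)
      have "length (steps (take k w) (take (Suc k) ys)) \<le> Suc n" "length (steps (drop (Suc k) w) (drop (Suc k) ys)) \<le> Suc n"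
        using h k by (simp_all add: length_steps n_def)
      hence "norm (E (steps (take k w) (take (Suc k) ys))) \<le> D" "norm (E (steps (drop (Suc k) w) (drop (Suc k) ys))) \<le> D"
        using E_bound[OF v(1)] E_bound[OF v(2)] CD by (meson order_trans)+
      thus ?thesis using D0 by (auto simp: split_term_def norm_mult intro!: mult_mono)
    qed
    have "norm (\<Sum>k<n. split_term j w ys k) \<le> (\<Sum>k<n. D * D)" by (rule sum_norm_le) (use 2 in auto)
    thus ?thesis using 1 norm_triangle_ineq4[of "E ((j, hd ys, last ys) # steps w ys)" "\<Sum>k<n. split_term j w ys k"] by simp
  qed
  have "norm (\<Sum>ys\<in>?bad. ?d ys) \<le> (\<Sum>ys\<in>?bad. D + real n * (D * D))" by (rule sum_norm_le) (rule each)
  also have "\<dots> = real (card ?bad) * (D + real n * (D * D))" by simp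
  also have "\<dots> \<le> real (((n + 2) div 2) ^ Suc n * N ^ ((n + 2) div 2)) * (D + real n * (D * D))"
    using D0 N_pos by (intro mult_right_mono of_nat_mono card_walks_few_vertices) auto
  finally show ?thesis unfolding eq by (simp add: mult_ac)
qed

end

lemma half_le: "2 * a \<le> b \<Longrightarrow> a \<le> b / 2" for a b :: real
  by simp

text \<open>The normalising exponents satisfy \<open>(k/2 + 1) + ((n-1-k)/2 + 1) = (n+1)/2 + 1\<close>, so the normalised moments
satisfy the recursion of \<open>noncrossing_count\<close> up to \<open>O(N^(-1/2))\<close>.\<close>

lemma trace_moment_limit:
  fixes E :: "nat \<Rightarrow> ('d \<times> nat \<times> nat) list \<Rightarrow> complex"
  assumes mf: "\<And>N. N \<ge> 1 \<Longrightarrow> moment_functional N (E N) C"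
  shows "(\<lambda>N. moment_functional.trace_moment N (E N) w / of_real (real N powr (real (length w) / 2 + 1)))
     \<longlonglongrightarrow> of_nat (noncrossing_count w)"
proof (induction w rule: length_induct)
  case (1 w)
  let ?m = "\<lambda>N. moment_functional.trace_moment N (E N)"
  let ?M = "\<lambda>w N. ?m N w / of_real (real N powr (real (length w) / 2 + 1))"
  have IH: "?M v \<longlonglongrightarrow> of_nat (noncrossing_count v)" if "length v < length w" for v
    using 1 that by blast
  show ?case
  proof (cases w)
    case Nil
    have "\<forall>\<^sub>F N in sequentially. ?M w N = 1"
      using eventually_ge_at_top[of 1]
    proof eventually_elim
      case (elim N)
      thus ?case using moment_functional.trace_moment_Nil[OF mf[OF elim]] Nil by simp
    qed
    thus ?thesis using Nil by (simp add: tendsto_eventually)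
  next
    case (Cons j v)
    define n where "n = length v"
    let ?R = "\<lambda>N. \<Sum>k<n. if v ! k = j then ?M (take k v) N * ?M (drop (Suc k) v) N else 0"
    define D where "D = (\<Sum>l\<le>Suc n. C l)"
    define c where "c = (D + real n * (D * D)) * real (((n + 2) div 2) ^ Suc n)"
    have limR: "?R \<longlonglongrightarrow> of_nat (noncrossing_count w)"
    proof -
      have "?R \<longlonglongrightarrow> (\<Sum>k<n. if v ! k = j then of_nat (noncrossing_count (take k v)) * of_nat (noncrossing_count (drop (Suc k) v)) else 0)"
      proof (intro tendsto_sum)
        fix k assume "k \<in> {..<n}"
        hence "length (take k v) < length w" "length (drop (Suc k) v) < length w" using Cons n_def by auto
        from tendsto_mult[OF IH[OF this(1)] IH[OF this(2)]]
        show "(\<lambda>N. if v ! k = j then ?M (take k v) N * ?M (drop (Suc k) v) N else 0) \<longlonglongrightarrow>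
           (if v ! k = j then of_nat (noncrossing_count (take k v)) * of_nat (noncrossing_count (drop (Suc k) v)) else 0)"
          by auto
      qed
      also have "(\<Sum>k<n. if v ! k = j then of_nat (noncrossing_count (take k v)) * of_nat (noncrossing_count (drop (Suc k) v)) else (0 :: complex))
         = of_nat (noncrossing_count w)"
        unfolding Cons n_def noncrossing_count.simps of_nat_sum by (intro sum.cong) auto
      finally show ?thesis .
    qed
    have "(\<lambda>N. ?M w N - ?R N) \<longlonglongrightarrow> 0"
    proof (rule Lim_null_comparison)
      show "\<forall>\<^sub>F N in sequentially. norm (?M w N - ?R N) \<le> c * real N powr (-1/2)"
        using eventually_ge_at_top[of 1]
      proof eventually_elim
        case (elim N)
        interpret moment_functional N "E N" C by (rule mf[OF elim])
        let ?p = "real N powr (real (length w) / 2 + 1)"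
        have p: "?p > 0" using elim by simp
        have "?M (take k v) N * ?M (drop (Suc k) v) N = ?m N (take k v) * ?m N (drop (Suc k) v) / of_real ?p" if "k < n" for k
        proof -
          have "(real k / 2 + 1) + (real (n - Suc k) / 2 + 1) = real (length w) / 2 + 1"
            using that Cons n_def by (simp add: of_nat_diff field_simps)
          hence "real N powr (real k / 2 + 1) * real N powr (real (n - Suc k) / 2 + 1) = ?p"
            by (simp only: powr_add[symmetric])
          moreover have "length (take k v) = k" "length (drop (Suc k) v) = n - Suc k" using that n_def by auto
          ultimately show ?thesis by (simp only: times_divide_times_eq of_real_mult[symmetric])
        qed
        hence "?R N = (\<Sum>k<n. if v ! k = j then ?m N (take k v) * ?m N (drop (Suc k) v) else 0) / of_real ?p"
          unfolding sum_divide_distrib by (intro sum.cong) auto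
        hence "?M w N - ?R N = (?m N (j # v) - (\<Sum>k<n. if v ! k = j then ?m N (take k v) * ?m N (drop (Suc k) v) else 0)) / of_real ?p"
          by (simp add: Cons diff_divide_distrib)
        hence "norm (?M w N - ?R N) = norm (?m N (j # v) - (\<Sum>k<n. if v ! k = j then ?m N (take k v) * ?m N (drop (Suc k) v) else 0)) / ?p"
          by (simp add: norm_divide)
        also have "\<dots> \<le> c * real N ^ ((n + 2) div 2) / ?p"
          using trace_moment_recursion[of j v] p unfolding c_def D_def n_def by (intro divide_right_mono) auto
        also have "\<dots> = c * (real N powr (real ((n + 2) div 2)) / ?p)" using elim by (subst powr_realpow) auto
        also have "\<dots> = c * real N powr (real ((n + 2) div 2) - (real (length w) / 2 + 1))" by (simp only: powr_diff)
        also have "\<dots> \<le> c * real N powr (-1/2)"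
        proof (intro mult_left_mono powr_mono)
          have "2 * ((n + 2) div 2) \<le> n + 2" by (rule times_div_less_eq_dividend)
          hence "real (2 * ((n + 2) div 2)) \<le> real (n + 2)" by (simp only: of_nat_le_iff)
          hence "real ((n + 2) div 2) \<le> real (n + 2) / 2" by (simp only: of_nat_mult of_nat_numeral) (rule half_le)
          thus "real ((n + 2) div 2) - (real (length w) / 2 + 1) \<le> - 1 / 2" using Cons n_def by (simp add: field_simps)
          show "c \<ge> 0" unfolding c_def D_def using C_nonneg by (intro mult_nonneg_nonneg add_nonneg_nonneg sum_nonneg) auto
        qed (use elim in auto)
        finally show ?case .
      qed
      have "(\<lambda>N. real N powr (-1/2)) \<longlonglongrightarrow> 0"
        by (rule tendsto_neg_powr[OF _ filterlim_real_sequentially]) simp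
      from tendsto_mult_right_zero[OF this] show "(\<lambda>N. c * real N powr (-1/2)) \<longlonglongrightarrow> 0" .
    qed
    from tendsto_add[OF this limR] show ?thesis by simp
  qed
qed

section \<open>Random Hermitian matrices with independent entries\<close>

lemma mat_adjoint_index:
  assumes "A \<in> carrier_mat N N" "a < N" "b < N"
  shows "mat_adjoint A $$ (a, b) = cnj (A $$ (b, a))"
  using assms unfolding mat_adjoint_def by (simp add: mat_of_rows_index conjugate_complex_def)

text \<open>The product is at most a power of the largest factor. Applied under an integral, this replaces
Hoelder's inequality by a bound through moments of single factors.\<close>

lemma prod_list_le_sum_list_power:
  fixes xs :: "real list"
  assumes "xs \<noteq> []" "\<And>x. x \<in> set xs \<Longrightarrow> 0 \<le> x"
  shows "prod_list xs \<le> sum_list (map (\<lambda>x. x ^ length xs) xs)"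
proof -
  define m where "m = Max (set xs)"
  have m: "m \<in> set xs" "\<And>x. x \<in> set xs \<Longrightarrow> x \<le> m" using assms(1) by (auto simp: m_def)
  have "prod_list ys \<le> m ^ length ys \<and> 0 \<le> prod_list ys" if "set ys \<subseteq> set xs" for ys
    using that
  proof (induction ys)
    case (Cons y ys)
    hence "0 \<le> y" "y \<le> m" "prod_list ys \<le> m ^ length ys" "0 \<le> prod_list ys" using assms(2) m(2) by auto
    thus ?case by (auto intro!: mult_mono)
  qed simp
  hence "prod_list xs \<le> m ^ length xs" by blast
  also have "\<dots> \<le> sum_list (map (\<lambda>x. x ^ length xs) xs)"
    using m(1) assms(2) by (intro member_le_sum_list) auto
  finally show ?thesis .
qed

lemma integrable_of_nn_integral_le:
  fixes f :: "'w \<Rightarrow> complex"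
  assumes "f \<in> borel_measurable M" "(\<integral>\<^sup>+\<omega>. ennreal (norm (f \<omega>)) \<partial>M) \<le> ennreal c" "0 \<le> c"
  shows "integrable M f" "(\<integral>\<omega>. norm (f \<omega>) \<partial>M) \<le> c" "norm (\<integral>\<omega>. f \<omega> \<partial>M) \<le> c"
proof -
  show int: "integrable M f"
    using assms by (intro integrableI_bounded) (auto intro: le_less_trans)
  have "ennreal (\<integral>\<omega>. norm (f \<omega>) \<partial>M) = (\<integral>\<^sup>+\<omega>. ennreal (norm (f \<omega>)) \<partial>M)"
    using int by (intro nn_integral_eq_integral[symmetric]) auto
  hence "ennreal (\<integral>\<omega>. norm (f \<omega>) \<partial>M) \<le> ennreal c" using assms(2) by simp
  thus le: "(\<integral>\<omega>. norm (f \<omega>) \<partial>M) \<le> c" using assms(3) by (simp add: ennreal_le_iff)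
  show "norm (\<integral>\<omega>. f \<omega> \<partial>M) \<le> c" using integral_norm_bound[of M f] le by linarith
qed

definition entry_prod :: "('d \<Rightarrow> complex mat) \<Rightarrow> ('d \<times> nat \<times> nat) list \<Rightarrow> complex" where
  "entry_prod A L = prod_list (map (\<lambda>(i, a, b). A i $$ (a, b)) L)"

lemma entry_prod_simps [simp]:
  "entry_prod A [] = 1"
  "entry_prod A ((i, a, b) # L) = A i $$ (a, b) * entry_prod A L"
  "entry_prod A (L @ L') = entry_prod A L * entry_prod A L'"
  by (simp_all add: entry_prod_def)

lemma entry_prod_mset: "mset L = mset L' \<Longrightarrow> entry_prod A L = entry_prod A L'"
  unfolding entry_prod_def prod_mset_prod_list[symmetric] by simp

lemma word_prod_index:
  assumes A: "\<And>j. A j \<in> carrier_mat N N" and ab: "a < N" "b < N"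
  shows "word_prod N A w $$ (a, b) =
    (\<Sum>ys\<in>{ys \<in> walks N (length w). hd ys = b \<and> last ys = a}. entry_prod A (steps w ys))"
  using ab
proof (induction w arbitrary: b)
  case Nil
  have "{ys \<in> walks N 0. hd ys = b \<and> last ys = a} = (if a = b then {[a]} else {})"
    using Nil by (auto simp: walks_def length_Suc_conv)
  thus ?case using Nil by simp
next
  case (Cons j w)
  let ?S = "{ys \<in> walks N (length w). last ys = a}"
  have "word_prod N A (j # w) $$ (a, b) = (\<Sum>c<N. word_prod N A w $$ (a, c) * A j $$ (c, b))"
    using index_mult_carrier[OF word_prod_carrier[OF A] A Cons.prems] by simp
  also have "\<dots> = (\<Sum>c<N. \<Sum>ys\<in>{ys \<in> ?S. hd ys = c}. entry_prod A (steps w ys) * A j $$ (hd ys, b))"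
  proof (rule sum.cong[OF refl])
    fix c assume "c \<in> {..<N}"
    hence c: "c < N" by simp
    have "{ys \<in> walks N (length w). hd ys = c \<and> last ys = a} = {ys \<in> ?S. hd ys = c}" by auto
    thus "word_prod N A w $$ (a, c) * A j $$ (c, b) = (\<Sum>ys\<in>{ys \<in> ?S. hd ys = c}. entry_prod A (steps w ys) * A j $$ (hd ys, b))"
      using Cons.IH[OF Cons.prems(1) c] by (simp add: sum_distrib_right)
  qed
  also have "\<dots> = (\<Sum>ys\<in>?S. entry_prod A (steps w ys) * A j $$ (hd ys, b))"
  proof (rule sum.group)
    show "hd ` ?S \<subseteq> {..<N}"
    proof
      fix c assume "c \<in> hd ` ?S"
      then obtain ys where ys: "c = hd ys" "set ys \<subseteq> {..<N}" "length ys = Suc (length w)" by (auto simp: walks_def)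
      hence "ys \<noteq> []" by auto
      thus "c \<in> {..<N}" using subsetD[OF ys(2) hd_in_set] ys(1) by simp
    qed
  qed (auto simp: finite_walks)
  also have "\<dots> = (\<Sum>ys\<in>{ys \<in> walks N (length (j # w)). hd ys = b \<and> last ys = a}. entry_prod A (steps (j # w) ys))"
  proof (rule sum.reindex_bij_witness[where j = "\<lambda>ys. b # ys" and i = tl])
    fix ys assume "ys \<in> ?S"
    then obtain c zs where "ys = c # zs" by (auto simp: walks_def length_Suc_conv)
    thus "entry_prod A (steps (j # w) (b # ys)) = entry_prod A (steps w ys) * A j $$ (hd ys, b)" by simp
    show "b # ys \<in> {ys \<in> walks N (length (j # w)). hd ys = b \<and> last ys = a}"
      using \<open>ys \<in> ?S\<close> \<open>ys = c # zs\<close> Cons.prems by (auto simp: walks_def)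
  next
    fix ys assume ys: "ys \<in> {ys \<in> walks N (length (j # w)). hd ys = b \<and> last ys = a}"
    then obtain c zs where "ys = b # c # zs" by (auto simp: walks_def length_Suc_conv)
    thus "tl ys \<in> ?S" "b # tl ys = ys" using ys by (auto simp: walks_def)
  qed auto
  finally show ?case .
qed

lemma mat_trace_word_prod:
  assumes A: "\<And>j. A j \<in> carrier_mat N N"
  shows "mat_trace (word_prod N A w) = (\<Sum>ys\<in>closed_walks N (length w). entry_prod A (steps w ys))"
proof -
  have "mat_trace (word_prod N A w) = (\<Sum>m<N. \<Sum>ys\<in>{ys \<in> closed_walks N (length w). hd ys = m}. entry_prod A (steps w ys))"
    unfolding mat_trace_def carrier_matD(1)[OF word_prod_carrier[OF A]]
  proof (rule sum.cong[OF refl])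
    fix m assume "m \<in> {..<N}"
    hence m: "m < N" by simp
    have "{ys \<in> walks N (length w). hd ys = m \<and> last ys = m} = {ys \<in> closed_walks N (length w). hd ys = m}"
      by (auto simp: closed_walks_def)
    thus "word_prod N A w $$ (m, m) = (\<Sum>ys\<in>{ys \<in> closed_walks N (length w). hd ys = m}. entry_prod A (steps w ys))"
      using word_prod_index[of A N, OF A m m, of w] by simp
  qed
  also have "\<dots> = (\<Sum>ys\<in>closed_walks N (length w). entry_prod A (steps w ys))"
  proof (rule sum.group)
    show "hd ` closed_walks N (length w) \<subseteq> {..<N}"
    proof
      fix c assume "c \<in> hd ` closed_walks N (length w)"
      then obtain ys where "c = hd ys" "ys \<in> closed_walks N (length w)" by blast
      hence ys: "c = hd ys" "set ys \<subseteq> {..<N}" "length ys = Suc (length w)" by (simp_all add: walks_def closed_walks_def)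
      hence "ys \<noteq> []" by auto
      thus "c \<in> {..<N}" using subsetD[OF ys(2) hd_in_set] ys(1) by simp
    qed
  qed (auto simp: finite_closed_walks)
  finally show ?thesis .
qed

lemma entry_sigma_generators_Pow:
  "(\<Union>i. sets (vimage_algebra (space M) (\<lambda>\<omega>. A i \<omega> $$ e) borel)) \<subseteq> Pow (space M)"
proof (rule UN_least)
  fix i show "sets (vimage_algebra (space M) (\<lambda>\<omega>. A i \<omega> $$ e) borel) \<subseteq> Pow (space M)"
    using sets.space_closed[of "vimage_algebra (space M) (\<lambda>\<omega>. A i \<omega> $$ e) borel"] by simp
qed

lemma entry_sigma_Pow: "entry_sigma M A e \<subseteq> Pow (space M)"
  unfolding entry_sigma_def using sigma_sets_into_sp[OF entry_sigma_generators_Pow] by blast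

lemma Int_stable_entry_sigma: "Int_stable (entry_sigma M A e)"
proof -
  have "entry_sigma M A e = sets (sigma (space M) (\<Union>i. sets (vimage_algebra (space M) (\<lambda>\<omega>. A i \<omega> $$ e) borel)))"
    unfolding entry_sigma_def by (rule sets_measure_of[symmetric]) (rule entry_sigma_generators_Pow)
  thus ?thesis unfolding Int_stable_def by (auto intro: sets.Int)
qed

text \<open>The size \<open>N\<close> is fixed here, but \<open>cA\<close> is common to all sizes, so the bounds derived from it are uniform
in \<open>N\<close>.\<close>

locale wigner_family = prob_space M for M :: "'w measure" +
  fixes N :: nat and A :: "'d::finite \<Rightarrow> 'w \<Rightarrow> complex mat" and cA :: "nat \<Rightarrow> real"
  assumes N_pos: "1 \<le> N"
    and hermitian: "\<And>i \<omega>. \<omega> \<in> space M \<Longrightarrow> A i \<omega> \<in> hermitian_mats N"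
    and entry_measurable: "\<And>i m l. m < N \<Longrightarrow> l < N \<Longrightarrow> (\<lambda>\<omega>. A i \<omega> $$ (m, l)) \<in> borel_measurable M"
    and entry_moments: "\<And>k i m l. m < N \<Longrightarrow> l < N \<Longrightarrow>
      (\<integral>\<^sup>+\<omega>. ennreal (cmod (A i \<omega> $$ (m, l)) ^ k) \<partial>M) \<le> ennreal (cA k)"
    and entry_mean: "\<And>i m l. m < N \<Longrightarrow> l < N \<Longrightarrow> (\<integral>\<omega>. A i \<omega> $$ (m, l) \<partial>M) = 0"
    and entry_var: "\<And>i m l. m < N \<Longrightarrow> l < N \<Longrightarrow> (\<integral>\<omega>. (cmod (A i \<omega> $$ (m, l)))\<^sup>2 \<partial>M) = 1"
    and entry_indep: "indep_sets (entry_sigma M A) {(m, l). m \<le> l \<and> l < N}"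
    and entry_uncorrelated: "\<And>i j m l. i \<noteq> j \<Longrightarrow> m < N \<Longrightarrow> l < N \<Longrightarrow>
      (\<integral>\<omega>. cnj (A i \<omega> $$ (m, l)) * A j \<omega> $$ (m, l) \<partial>M) = 0"
begin

abbreviation X :: "('d \<times> nat \<times> nat) list \<Rightarrow> 'w \<Rightarrow> complex" where
  "X L \<omega> \<equiv> entry_prod (\<lambda>i. A i \<omega>) L"

lemma carrier: "\<omega> \<in> space M \<Longrightarrow> A i \<omega> \<in> carrier_mat N N"
  using hermitian unfolding hermitian_mats_def by auto

lemma entry_cnj: "\<omega> \<in> space M \<Longrightarrow> a < N \<Longrightarrow> b < N \<Longrightarrow> A i \<omega> $$ (b, a) = cnj (A i \<omega> $$ (a, b))"
  using mat_adjoint_index[OF carrier, of \<omega> b a i] hermitian[of \<omega> i] unfolding hermitian_mats_def by simp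

lemma X_measurable: "valid N L \<Longrightarrow> X L \<in> borel_measurable M"
proof (induction L)
  case (Cons x L)
  obtain i a b where "x = (i, a, b)" by (cases x)
  thus ?case using Cons entry_measurable[of a b i] by simp
qed simp

definition moment_bound :: "nat \<Rightarrow> real" where
  "moment_bound n = 1 + real n * \<bar>cA n\<bar>"

lemma nn_integral_X:
  assumes "valid N L"
  shows "(\<integral>\<^sup>+\<omega>. ennreal (norm (X L \<omega>)) \<partial>M) \<le> ennreal (moment_bound (length L))"
proof (cases "L = []")
  case True
  thus ?thesis by (simp add: emeasure_space_1 moment_bound_def)
next
  case False
  let ?n = "length L"
  have ptw: "ennreal (norm (X L \<omega>)) \<le> (\<Sum>k<?n. ennreal (cmod (case L ! k of (i, a, b) \<Rightarrow> A i \<omega> $$ (a, b)) ^ ?n))" for \<omega>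
  proof -
    let ?xs = "map (\<lambda>(i, a, b). cmod (A i \<omega> $$ (a, b))) L"
    have "norm (X L \<omega>) = prod_list ?xs"
      by (induction L) (auto simp: norm_mult)
    also have "\<dots> \<le> sum_list (map (\<lambda>x. x ^ length ?xs) ?xs)"
      using False by (intro prod_list_le_sum_list_power) auto
    also have "\<dots> = (\<Sum>k<?n. cmod (case L ! k of (i, a, b) \<Rightarrow> A i \<omega> $$ (a, b)) ^ ?n)"
      by (simp add: sum_list_sum_nth case_prod_unfold lessThan_atLeast0)
    finally have "ennreal (norm (X L \<omega>)) \<le> ennreal (\<Sum>k<?n. cmod (case L ! k of (i, a, b) \<Rightarrow> A i \<omega> $$ (a, b)) ^ ?n)"
      by (rule ennreal_leI)
    thus ?thesis by (simp add: sum_ennreal)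
  qed
  have entry: "(\<lambda>\<omega>. case L ! k of (i, a, b) \<Rightarrow> A i \<omega> $$ (a, b)) \<in> borel_measurable M"
      "(\<integral>\<^sup>+\<omega>. ennreal (cmod (case L ! k of (i, a, b) \<Rightarrow> A i \<omega> $$ (a, b)) ^ ?n) \<partial>M) \<le> ennreal \<bar>cA ?n\<bar>" if "k < ?n" for k
  proof -
    obtain i a b where Lk: "L ! k = (i, a, b)" by (cases "L ! k")
    hence "a < N" "b < N" using assms nth_mem[OF that] by (auto simp: valid_def)
    thus "(\<lambda>\<omega>. case L ! k of (i, a, b) \<Rightarrow> A i \<omega> $$ (a, b)) \<in> borel_measurable M"
      "(\<integral>\<^sup>+\<omega>. ennreal (cmod (case L ! k of (i, a, b) \<Rightarrow> A i \<omega> $$ (a, b)) ^ ?n) \<partial>M) \<le> ennreal \<bar>cA ?n\<bar>"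
      using entry_measurable[of a b i] order_trans[OF entry_moments[of a b i ?n] ennreal_leI[of "cA ?n" "\<bar>cA ?n\<bar>"]] Lk by simp_all
  qed
  have "(\<integral>\<^sup>+\<omega>. ennreal (norm (X L \<omega>)) \<partial>M) \<le> (\<integral>\<^sup>+\<omega>. (\<Sum>k<?n. ennreal (cmod (case L ! k of (i, a, b) \<Rightarrow> A i \<omega> $$ (a, b)) ^ ?n)) \<partial>M)"
    by (intro nn_integral_mono ptw)
  also have "\<dots> = (\<Sum>k<?n. \<integral>\<^sup>+\<omega>. ennreal (cmod (case L ! k of (i, a, b) \<Rightarrow> A i \<omega> $$ (a, b)) ^ ?n) \<partial>M)"
    by (rule nn_integral_sum) (use entry(1) in auto)
  also have "\<dots> \<le> (\<Sum>k<?n. ennreal \<bar>cA ?n\<bar>)" by (intro sum_mono entry(2)) auto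
  also have "\<dots> = ennreal (real ?n * \<bar>cA ?n\<bar>)" by (simp add: ennreal_mult ennreal_of_nat_eq_real_of_nat)
  also have "\<dots> \<le> ennreal (moment_bound ?n)" by (intro ennreal_leI) (simp add: moment_bound_def)
  finally show ?thesis .
qed

lemma moment_bound_nonneg: "0 \<le> moment_bound n"
  unfolding moment_bound_def by (intro add_nonneg_nonneg mult_nonneg_nonneg) auto

lemma X_integrable: "valid N L \<Longrightarrow> integrable M (X L)"
  and norm_expectation_X: "valid N L \<Longrightarrow> norm (\<integral>\<omega>. X L \<omega> \<partial>M) \<le> moment_bound (length L)"
  using integrable_of_nn_integral_le[OF X_measurable nn_integral_X moment_bound_nonneg] by blast+

lemma support_valid: "valid N L \<Longrightarrow> set (support L) \<subseteq> {(m, l). m \<le> l \<and> l < N}"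
  by (fastforce simp: support_def valid_def edge_def)

lemma X_measurable_sigma:
  assumes "valid N L" "set (support L) \<subseteq> S"
  shows "X L \<in> borel_measurable (sigma (space M) (\<Union>e\<in>S. entry_sigma M A e))"
proof -
  let ?G = "sigma (space M) (\<Union>e\<in>S. entry_sigma M A e)"
  have sub: "(\<Union>e\<in>S. entry_sigma M A e) \<subseteq> Pow (space M)"
    using entry_sigma_Pow by (rule UN_least)
  have spaceG: "space ?G = space M" using sub by (simp add: space_measure_of)
  have setsG: "sets ?G = sigma_sets (space M) (\<Union>e\<in>S. entry_sigma M A e)" using sub by (simp add: sets_measure_of)
  have base: "(\<lambda>\<omega>. A i \<omega> $$ e) \<in> borel_measurable ?G" if "e \<in> S" for i e
  proof (rule measurableI)
    fix B :: "complex set" assume "B \<in> sets borel"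
    hence "(\<lambda>\<omega>. A i \<omega> $$ e) -` B \<inter> space M \<in> sets (vimage_algebra (space M) (\<lambda>\<omega>. A i \<omega> $$ e) borel)"
      by (rule in_vimage_algebra)
    hence "(\<lambda>\<omega>. A i \<omega> $$ e) -` B \<inter> space M \<in> entry_sigma M A e"
      unfolding entry_sigma_def by (intro sigma_sets.Basic) blast
    thus "(\<lambda>\<omega>. A i \<omega> $$ e) -` B \<inter> space ?G \<in> sets ?G"
      unfolding setsG spaceG using that by (intro sigma_sets.Basic) blast
  qed simp
  show ?thesis using assms
  proof (induction L)
    case (Cons x L)
    obtain i a b where x: "x = (i, a, b)" by (cases x)
    have ab: "a < N" "b < N" "edge a b \<in> S" using Cons.prems x by auto
    have "(\<lambda>\<omega>. A i \<omega> $$ (a, b)) \<in> borel_measurable ?G"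
    proof (cases "a \<le> b")
      case True
      hence "edge a b = (a, b)" by (simp add: edge_def)
      thus ?thesis using base[of "(a, b)" i] ab by simp
    next
      case False
      hence "edge a b = (b, a)" by (simp add: edge_def)
      hence "(\<lambda>\<omega>. A i \<omega> $$ (b, a)) \<in> borel_measurable ?G" using base[of "(b, a)" i] ab by simp
      moreover have "cnj \<in> borel_measurable borel"
        by (intro borel_measurable_continuous_onI continuous_on_cnj continuous_on_id)
      ultimately have "(\<lambda>\<omega>. cnj (A i \<omega> $$ (b, a))) \<in> borel_measurable ?G" by (rule measurable_compose)
      also have "?this \<longleftrightarrow> (\<lambda>\<omega>. A i \<omega> $$ (a, b)) \<in> borel_measurable ?G"
        by (rule measurable_cong, rule entry_cnj[symmetric]) (use ab spaceG in auto)
      finally show ?thesis .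
    qed
    moreover have "X L \<in> borel_measurable ?G" using Cons x by simp
    ultimately show ?case using x by simp
  qed simp
qed

text \<open>An entry and its mirror image across the diagonal are conjugate, so a product of entries is measurable
with respect to the \<open>\<sigma>\<close>-algebras attached to its undirected edges. Disjoint sets of edges generate
independent \<open>\<sigma>\<close>-algebras.\<close>

lemma expectation_X_append:
  assumes v: "valid N L" "valid N L'" and disj: "set (support L) \<inter> set (support L') = {}"
  shows "(\<integral>\<omega>. X (L @ L') \<omega> \<partial>M) = (\<integral>\<omega>. X L \<omega> \<partial>M) * (\<integral>\<omega>. X L' \<omega> \<partial>M)"
proof -
  let ?I = "case_bool (set (support L)) (set (support L'))"
  let ?F = "\<lambda>S. sigma_sets (space M) (\<Union>e\<in>S. entry_sigma M A e)"
  have "indep_sets (\<lambda>j. sigma_sets (space M) (\<Union>e\<in>?I j. entry_sigma M A e)) UNIV"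
  proof (rule indep_sets_collect_sigma)
    show "indep_sets (entry_sigma M A) (\<Union>j\<in>UNIV. ?I j)"
      by (rule indep_sets_mono_index[OF _ entry_indep]) (use support_valid v in \<open>auto simp: UNIV_bool\<close>)
    show "disjoint_family_on ?I UNIV" using disj by (auto simp: disjoint_family_on_def split: bool.split)
    show "Int_stable (entry_sigma M A i)" for i by (rule Int_stable_entry_sigma)
  qed
  hence "indep_sets (case_bool (sigma_sets (space M) {X L -` B \<inter> space M | B. B \<in> sets borel})
      (sigma_sets (space M) {X L' -` B \<inter> space M | B. B \<in> sets borel})) UNIV"
  proof (rule indep_sets_mono_sets)
    fix j :: bool
    have gen: "sigma_sets (space M) {X K -` B \<inter> space M | B. B \<in> sets borel} \<subseteq> ?F (set (support K))" if K: "valid N K" for K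
    proof (rule sigma_sets_mono, safe)
      fix B :: "complex set" assume B: "B \<in> sets borel"
      let ?G = "sigma (space M) (\<Union>e\<in>set (support K). entry_sigma M A e)"
      have sub: "(\<Union>e\<in>set (support K). entry_sigma M A e) \<subseteq> Pow (space M)"
        using entry_sigma_Pow by (rule UN_least)
      have "X K -` B \<inter> space ?G \<in> sets ?G" by (rule measurable_sets[OF X_measurable_sigma[OF K order_refl] B])
      thus "X K -` B \<inter> space M \<in> ?F (set (support K))" using sub by (simp add: space_measure_of sets_measure_of)
    qed
    show "case_bool (sigma_sets (space M) {X L -` B \<inter> space M | B. B \<in> sets borel})
      (sigma_sets (space M) {X L' -` B \<inter> space M | B. B \<in> sets borel}) j \<subseteq> ?F (?I j)"
      using gen[OF v(1)] gen[OF v(2)] by (cases j) auto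
  qed
  hence "indep_var borel (X L) borel (X L')"
    unfolding indep_var_eq indep_set_def using X_measurable v by simp
  from indep_var_lebesgue_integral[OF this X_integrable[OF v(1)] X_integrable[OF v(2)]]
  show ?thesis by simp
qed

lemma expectation_pair:
  assumes "a < N" "b < N"
  shows "(\<integral>\<omega>. X [(i, a, b), (j, b, a)] \<omega> \<partial>M) = (if i = j then 1 else 0)"
proof -
  have eq: "(\<integral>\<omega>. X [(i, a, b), (j, b, a)] \<omega> \<partial>M) = (\<integral>\<omega>. cnj (A j \<omega> $$ (a, b)) * A i \<omega> $$ (a, b) \<partial>M)"
  proof (rule Bochner_Integration.integral_cong[OF refl])
    fix \<omega> assume "\<omega> \<in> space M"
    from entry_cnj[OF this assms, of j]
    show "X [(i, a, b), (j, b, a)] \<omega> = cnj (A j \<omega> $$ (a, b)) * A i \<omega> $$ (a, b)" by simp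
  qed
  show ?thesis
  proof (cases "i = j")
    case True
    have "(\<integral>\<omega>. cnj (A j \<omega> $$ (a, b)) * A j \<omega> $$ (a, b) \<partial>M) = (\<integral>\<omega>. complex_of_real ((cmod (A j \<omega> $$ (a, b)))\<^sup>2) \<partial>M)"
      by (rule Bochner_Integration.integral_cong) (simp_all only: complex_norm_square mult.commute)
    also have "\<dots> = 1" using entry_var[OF assms, of j] by (simp only: integral_complex_of_real of_real_1)
    finally show ?thesis using True eq by simp
  next
    case False
    thus ?thesis using eq entry_uncorrelated[of j i a b] assms by simp
  qed
qed

sublocale mf: moment_functional N "\<lambda>L. \<integral>\<omega>. X L \<omega> \<partial>M" moment_bound
proof
  show "1 \<le> N" by (rule N_pos)
  show "(\<integral>\<omega>. X L \<omega> \<partial>M) = (\<integral>\<omega>. X L' \<omega> \<partial>M)" if "mset L = mset L'" for L L'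
    using entry_prod_mset[OF that] by simp
  show "(\<integral>\<omega>. X [] \<omega> \<partial>M) = 1" by (simp add: prob_space)
  show "(\<integral>\<omega>. X [(i, a, b)] \<omega> \<partial>M) = 0" if "a < N" "b < N" for i a b
    using entry_mean[OF that] by simp
qed (use expectation_X_append expectation_pair norm_expectation_X in auto)

lemma expectation_trace:
  "(\<integral>\<omega>. mat_trace (word_prod N (\<lambda>j. A j \<omega>) w) \<partial>M) = mf.trace_moment w"
proof -
  have v: "valid N (steps w ys)" if "ys \<in> closed_walks N (length w)" for ys
    using that by (intro valid_steps) (auto simp: closed_walks_def walks_def)
  have "(\<integral>\<omega>. mat_trace (word_prod N (\<lambda>j. A j \<omega>) w) \<partial>M) = (\<integral>\<omega>. (\<Sum>ys\<in>closed_walks N (length w). X (steps w ys) \<omega>) \<partial>M)"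
    by (rule Bochner_Integration.integral_cong[OF refl], rule mat_trace_word_prod, rule carrier)
  also have "\<dots> = mf.trace_moment w" unfolding mf.trace_moment_def
    by (rule Bochner_Integration.integral_sum) (use v X_integrable in auto)
  finally show ?thesis .
qed

lemma trace_measurable: "(\<lambda>\<omega>. mat_trace (word_prod N (\<lambda>j. A j \<omega>) w)) \<in> borel_measurable M"
proof -
  have v: "valid N (steps w ys)" if "ys \<in> closed_walks N (length w)" for ys
    using that by (intro valid_steps) (auto simp: closed_walks_def walks_def)
  have "(\<lambda>\<omega>. \<Sum>ys\<in>closed_walks N (length w). X (steps w ys) \<omega>) \<in> borel_measurable M"
    by (rule borel_measurable_sum) (use v X_measurable in auto)
  also have "?this \<longleftrightarrow> ?thesis"
    by (rule measurable_cong) (rule mat_trace_word_prod[symmetric], rule carrier)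
  finally show ?thesis .
qed

end

section \<open>Operator norms and the growth of the moments\<close>

lemma euclid_norm_L2: "euclid_norm v = L2_set (\<lambda>m. cmod (vec_index v m)) {..<dim_vec v}"
  by (simp add: euclid_norm_def L2_set_def)

lemma euclid_norm_nonneg: "0 \<le> euclid_norm v"
  by (simp add: euclid_norm_L2 L2_set_nonneg)

lemma norm_index_le_euclid_norm: "m < dim_vec v \<Longrightarrow> cmod (vec_index v m) \<le> euclid_norm v"
  unfolding euclid_norm_L2 by (rule member_le_L2_set) auto

lemma euclid_norm_add_le:
  assumes "v \<in> carrier_vec N" "w \<in> carrier_vec N"
  shows "euclid_norm (v + w) \<le> euclid_norm v + euclid_norm w"
proof -
  have d: "dim_vec v = N" "dim_vec w = N" using assms by auto
  have "euclid_norm (v + w) = L2_set (\<lambda>m. cmod (vec_index v m + vec_index w m)) {..<N}"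
    unfolding euclid_norm_L2 using d by (intro L2_set_cong) auto
  also have "\<dots> \<le> L2_set (\<lambda>m. cmod (vec_index v m) + cmod (vec_index w m)) {..<N}"
    by (intro L2_set_mono norm_triangle_ineq) auto
  also have "\<dots> \<le> euclid_norm v + euclid_norm w"
    unfolding euclid_norm_L2 d by (rule L2_set_triangle_ineq)
  finally show ?thesis .
qed

lemma euclid_norm_smult: "euclid_norm (c \<cdot>\<^sub>v v) = cmod c * euclid_norm v"
proof -
  have "euclid_norm (c \<cdot>\<^sub>v v) = L2_set (\<lambda>m. cmod c * cmod (vec_index v m)) {..<dim_vec v}"
    unfolding euclid_norm_L2 by (intro L2_set_cong) (auto simp: norm_mult)
  thus ?thesis unfolding euclid_norm_L2 by (simp add: L2_set_right_distrib)
qed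

definition entry_sum :: "nat \<Rightarrow> complex mat \<Rightarrow> real" where
  "entry_sum N B = (\<Sum>a<N. \<Sum>b<N. cmod (B $$ (a, b)))"

lemma euclid_norm_mult_le_entry_sum:
  assumes B: "B \<in> carrier_mat N N" and v: "v \<in> carrier_vec N"
  shows "euclid_norm (B *\<^sub>v v) \<le> entry_sum N B * euclid_norm v"
proof -
  have "euclid_norm (B *\<^sub>v v) \<le> (\<Sum>a<N. cmod (vec_index (B *\<^sub>v v) a))"
    unfolding euclid_norm_L2 using B by (intro order_trans[OF L2_set_le_sum]) auto
  also have "\<dots> \<le> (\<Sum>a<N. \<Sum>b<N. cmod (B $$ (a, b)) * euclid_norm v)"
  proof (rule sum_mono)
    fix a assume "a \<in> {..<N}"
    hence "vec_index (B *\<^sub>v v) a = (\<Sum>b<N. B $$ (a, b) * vec_index v b)"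
      using B v by (simp add: scalar_prod_def lessThan_atLeast0)
    also have "cmod \<dots> \<le> (\<Sum>b<N. cmod (B $$ (a, b)) * euclid_norm v)"
      by (rule sum_norm_le) (use v in \<open>auto simp: norm_mult intro!: mult_left_mono norm_index_le_euclid_norm\<close>)
    finally show "cmod (vec_index (B *\<^sub>v v) a) \<le> (\<Sum>b<N. cmod (B $$ (a, b)) * euclid_norm v)" .
  qed
  also have "\<dots> = entry_sum N B * euclid_norm v" by (simp add: entry_sum_def sum_distrib_right)
  finally show ?thesis .
qed

lemma entry_sum_nonneg: "0 \<le> entry_sum N B"
  unfolding entry_sum_def by (intro sum_nonneg) auto

lemma op_norm_bdd:
  assumes B: "B \<in> carrier_mat N N"
  shows "bdd_above {euclid_norm (B *\<^sub>v v) | v. v \<in> carrier_vec (dim_col B) \<and> euclid_norm v \<le> 1}"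
proof (rule bdd_aboveI[of _ "entry_sum N B"])
  fix x assume "x \<in> {euclid_norm (B *\<^sub>v v) | v. v \<in> carrier_vec (dim_col B) \<and> euclid_norm v \<le> 1}"
  then obtain v where v: "x = euclid_norm (B *\<^sub>v v)" "v \<in> carrier_vec N" "euclid_norm v \<le> 1" using B by auto
  have "x \<le> entry_sum N B * euclid_norm v" unfolding v(1) by (rule euclid_norm_mult_le_entry_sum[OF B v(2)])
  also have "\<dots> \<le> entry_sum N B * 1" by (rule mult_left_mono[OF v(3) entry_sum_nonneg])
  finally show "x \<le> entry_sum N B" by simp
qed

lemma euclid_norm_le_op_norm:
  assumes B: "B \<in> carrier_mat N N" and v: "v \<in> carrier_vec N" "euclid_norm v \<le> 1"
  shows "euclid_norm (B *\<^sub>v v) \<le> op_norm B"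
  unfolding op_norm_def by (rule cSup_upper[OF _ op_norm_bdd[OF B]]) (use B v in auto)

lemma euclid_norm_zero: "euclid_norm (0\<^sub>v N) = 0"
proof -
  have "euclid_norm (0\<^sub>v N) = L2_set (\<lambda>m. 0) {..<N}" unfolding euclid_norm_L2 by (intro L2_set_cong) auto
  thus ?thesis by (simp add: L2_set_def)
qed

lemma op_norm_nonneg: "B \<in> carrier_mat N N \<Longrightarrow> 0 \<le> op_norm B"
  using euclid_norm_le_op_norm[of B N "0\<^sub>v N"] euclid_norm_nonneg[of "B *\<^sub>v 0\<^sub>v N"] by (simp add: euclid_norm_zero)

lemma euclid_norm_mult_le:
  assumes B: "B \<in> carrier_mat N N" and v: "v \<in> carrier_vec N"
  shows "euclid_norm (B *\<^sub>v v) \<le> op_norm B * euclid_norm v"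
proof (cases "euclid_norm v = 0")
  case True
  thus ?thesis using euclid_norm_mult_le_entry_sum[OF B v] by simp
next
  case False
  hence pos: "euclid_norm v > 0" using euclid_norm_nonneg[of v] by simp
  define c where "c = complex_of_real (inverse (euclid_norm v))"
  have c: "cmod c = inverse (euclid_norm v)" using pos by (simp add: c_def norm_inverse)
  have "euclid_norm (B *\<^sub>v (c \<cdot>\<^sub>v v)) \<le> op_norm B"
    by (rule euclid_norm_le_op_norm[OF B]) (use v pos in \<open>auto simp: euclid_norm_smult c\<close>)
  moreover have "B *\<^sub>v (c \<cdot>\<^sub>v v) = c \<cdot>\<^sub>v (B *\<^sub>v v)" using B v by (rule mult_mat_vec)
  ultimately have "inverse (euclid_norm v) * euclid_norm (B *\<^sub>v v) \<le> op_norm B" by (simp add: euclid_norm_smult c)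
  thus ?thesis using pos by (simp add: field_simps)
qed

lemma op_norm_diff_le:
  assumes B: "B \<in> carrier_mat N N" and B': "B' \<in> carrier_mat N N"
  shows "op_norm B \<le> op_norm B' + entry_sum N (B - B')"
  unfolding op_norm_def[of B]
proof (rule cSup_least)
  have "euclid_norm (B *\<^sub>v 0\<^sub>v N) \<in> {euclid_norm (B *\<^sub>v v) |v. v \<in> carrier_vec (dim_col B) \<and> euclid_norm v \<le> 1}"
    using B euclid_norm_zero[of N] by fastforce
  thus "{euclid_norm (B *\<^sub>v v) |v. v \<in> carrier_vec (dim_col B) \<and> euclid_norm v \<le> 1} \<noteq> {}" by blast
  fix x assume "x \<in> {euclid_norm (B *\<^sub>v v) |v. v \<in> carrier_vec (dim_col B) \<and> euclid_norm v \<le> 1}"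
  then obtain v where v: "x = euclid_norm (B *\<^sub>v v)" "v \<in> carrier_vec N" "euclid_norm v \<le> 1" using B by auto
  have D: "B - B' \<in> carrier_mat N N" using B B' by auto
  have "B *\<^sub>v v = B' *\<^sub>v v + (B - B') *\<^sub>v v"
  proof -
    have "B = B' + (B - B')" using B B' by auto
    hence "B *\<^sub>v v = (B' + (B - B')) *\<^sub>v v" by (rule arg_cong)
    also have "\<dots> = B' *\<^sub>v v + (B - B') *\<^sub>v v" using B' D v(2) by (rule add_mult_distrib_mat_vec)
    finally show ?thesis .
  qed
  hence "x \<le> euclid_norm (B' *\<^sub>v v) + euclid_norm ((B - B') *\<^sub>v v)"
    unfolding v(1) using euclid_norm_add_le[of "B' *\<^sub>v v" N "(B - B') *\<^sub>v v"] B' D v(2) by simp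
  also have "\<dots> \<le> op_norm B' + entry_sum N (B - B') * 1"
    using euclid_norm_mult_le_entry_sum[OF D v(2)] mult_left_mono[OF v(3) entry_sum_nonneg[of N "B - B'"]]
    by (intro add_mono euclid_norm_le_op_norm[OF B' v(2,3)]) linarith
  finally show "x \<le> op_norm B' + entry_sum N (B - B')" by simp
qed

text \<open>The operator norm is Lipschitz in the matrix entries, hence a continuous function of the random array
of entries.\<close>

lemma op_norm_measurable:
  fixes B :: "'w \<Rightarrow> complex mat"
  assumes car: "\<And>\<omega>. \<omega> \<in> space M \<Longrightarrow> B \<omega> \<in> carrier_mat N N"
    and meas: "\<And>m l. m < N \<Longrightarrow> l < N \<Longrightarrow> (\<lambda>\<omega>. B \<omega> $$ (m, l)) \<in> borel_measurable M"
  shows "(\<lambda>\<omega>. op_norm (B \<omega>)) \<in> borel_measurable M"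
proof -
  define F where "F x = op_norm (Matrix.mat N N x)" for x :: "nat \<times> nat \<Rightarrow> complex"
  have lip: "\<bar>F y - F x\<bar> \<le> (\<Sum>a<N. \<Sum>b<N. cmod (y (a, b) - x (a, b)))" for x y
  proof -
    have "F y \<le> F x + (\<Sum>a<N. \<Sum>b<N. cmod (y (a, b) - x (a, b)))" for x y
    proof -
      have "entry_sum N (Matrix.mat N N y - Matrix.mat N N x) = (\<Sum>a<N. \<Sum>b<N. cmod (y (a, b) - x (a, b)))"
        unfolding entry_sum_def by (intro sum.cong refl) auto
      thus ?thesis using op_norm_diff_le[of "Matrix.mat N N y" N "Matrix.mat N N x"] by (simp add: F_def)
    qed
    from this[of x y] this[of y x] show ?thesis by (simp add: norm_minus_commute abs_le_iff)
  qed
  have "continuous_on UNIV F"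
    unfolding continuous_on_def
  proof
    fix x :: "nat \<times> nat \<Rightarrow> complex"
    have coord: "((\<lambda>y. y i) \<longlongrightarrow> x i) (at x)" for i :: "nat \<times> nat"
      using continuous_on_product_coordinates[of i] unfolding continuous_on_def by auto
    have "((\<lambda>y. \<Sum>a<N. \<Sum>b<N. cmod (y (a, b) - x (a, b))) \<longlongrightarrow> (\<Sum>a<N. \<Sum>b<N. cmod (x (a, b) - x (a, b)))) (at x)"
      by (intro tendsto_sum tendsto_norm tendsto_diff coord tendsto_const)
    hence z: "((\<lambda>y. \<Sum>a<N. \<Sum>b<N. cmod (y (a, b) - x (a, b))) \<longlongrightarrow> 0) (at x)" by simp
    have "((\<lambda>y. F y - F x) \<longlongrightarrow> 0) (at x)"
      by (rule Lim_null_comparison[OF _ z]) (use lip in auto)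
    thus "(F \<longlongrightarrow> F x) (at x within UNIV)" using LIM_zero_cancel by blast
  qed
  hence F: "F \<in> borel_measurable borel" by (rule borel_measurable_continuous_onI)
  define G where "G \<omega> = (\<lambda>(a, b). if a < N \<and> b < N then B \<omega> $$ (a, b) else 0)" for \<omega>
  have "G \<in> borel_measurable M"
  proof (rule measurable_coordinatewise_then_product)
    fix i :: "nat \<times> nat"
    show "(\<lambda>\<omega>. G \<omega> i) \<in> borel_measurable M"
      by (cases i; cases "fst i < N \<and> snd i < N") (auto simp: G_def intro: meas)
  qed
  from measurable_compose[OF this F] have "(\<lambda>\<omega>. F (G \<omega>)) \<in> borel_measurable M" .
  also have "?this \<longleftrightarrow> ?thesis"
  proof (rule measurable_cong)
    fix \<omega> assume "\<omega> \<in> space M"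
    from car[OF this] have "Matrix.mat N N (G \<omega>) = B \<omega>" by (intro eq_matI) (auto simp: G_def)
    thus "F (G \<omega>) = op_norm (B \<omega>)" by (simp add: F_def)
  qed
  finally show ?thesis .
qed

lemma euclid_norm_word_prod_le:
  assumes A: "\<And>j. A j \<in> carrier_mat N N" and v: "v \<in> carrier_vec N"
  shows "euclid_norm (word_prod N A w *\<^sub>v v) \<le> prod_list (map (\<lambda>j. op_norm (A j)) w) * euclid_norm v"
  using v
proof (induction w arbitrary: v)
  case Nil
  thus ?case by simp
next
  case (Cons j w)
  have Av: "A j *\<^sub>v v \<in> carrier_vec N" using A[of j] Cons.prems by simp
  have P0: "0 \<le> prod_list (map (\<lambda>j. op_norm (A j)) w)"
    by (induction w) (auto intro!: mult_nonneg_nonneg op_norm_nonneg[OF A])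
  have "word_prod N A (j # w) *\<^sub>v v = word_prod N A w *\<^sub>v (A j *\<^sub>v v)"
    using assoc_mult_mat_vec[OF word_prod_carrier[of A N w, OF A] A[of j] Cons.prems] by simp
  hence "euclid_norm (word_prod N A (j # w) *\<^sub>v v) \<le> prod_list (map (\<lambda>j. op_norm (A j)) w) * euclid_norm (A j *\<^sub>v v)"
    using Cons.IH[OF Av] by simp
  also have "\<dots> \<le> prod_list (map (\<lambda>j. op_norm (A j)) w) * (op_norm (A j) * euclid_norm v)"
    by (intro mult_left_mono euclid_norm_mult_le[OF A Cons.prems] P0)
  finally show ?case by (simp add: mult_ac)
qed

text \<open>Here the product of the norms along the word is replaced by the power of the largest one, and the
maximum over the letters by their sum, so that only powers of a single norm have to be integrated.\<close>

lemma norm_mat_trace_word_prod_le: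
  assumes A: "\<And>j::'d::finite. A j \<in> carrier_mat N N"
  shows "norm (mat_trace (word_prod N A w)) \<le> real N * (\<Sum>j\<in>UNIV. op_norm (A j) ^ length w)"
proof -
  have op0: "0 \<le> op_norm (A j)" for j by (rule op_norm_nonneg[OF A])
  have P: "prod_list (map (\<lambda>j. op_norm (A j)) w) \<le> (\<Sum>j\<in>UNIV. op_norm (A j) ^ length w)"
  proof -
    define m where "m = Max (range (\<lambda>j. op_norm (A j)))"
    have m: "op_norm (A j) \<le> m" for j by (simp add: m_def)
    have "m \<in> range (\<lambda>j. op_norm (A j))" unfolding m_def by (rule Max_in) auto
    then obtain i where i: "m = op_norm (A i)" by blast
    have "prod_list (map (\<lambda>j. op_norm (A j)) v) \<le> m ^ length v \<and> 0 \<le> prod_list (map (\<lambda>j. op_norm (A j)) v)" for v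
      by (induction v) (auto intro!: mult_mono m op0 mult_nonneg_nonneg order_trans[OF op0 m])
    hence "prod_list (map (\<lambda>j. op_norm (A j)) w) \<le> op_norm (A i) ^ length w" using i by blast
    also have "\<dots> \<le> (\<Sum>j\<in>UNIV. op_norm (A j) ^ length w)"
      by (rule member_le_sum) (auto intro: zero_le_power op0)
    finally show ?thesis .
  qed
  have entry: "norm (word_prod N A w $$ (m, m)) \<le> (\<Sum>j\<in>UNIV. op_norm (A j) ^ length w)" if m: "m < N" for m
  proof -
    have W: "word_prod N A w \<in> carrier_mat N N" by (rule word_prod_carrier[OF A])
    have "vec_index (word_prod N A w *\<^sub>v unit_vec N m) m = word_prod N A w $$ (m, m)"
      using W m by simp
    hence "norm (word_prod N A w $$ (m, m)) \<le> euclid_norm (word_prod N A w *\<^sub>v unit_vec N m)"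
      using norm_index_le_euclid_norm[of m "word_prod N A w *\<^sub>v unit_vec N m"] W m by simp
    also have "\<dots> \<le> prod_list (map (\<lambda>j. op_norm (A j)) w) * euclid_norm (unit_vec N m)"
      by (rule euclid_norm_word_prod_le[OF A]) simp
    also have "euclid_norm (unit_vec N m) = 1"
    proof -
      have "(\<Sum>k<N. (cmod (vec_index (unit_vec N m) k))\<^sup>2) = (\<Sum>k<N. if k = m then 1 else 0)"
        using m by (intro sum.cong) auto
      thus ?thesis using m by (simp add: euclid_norm_def)
    qed
    finally show ?thesis using P by simp
  qed
  have "norm (mat_trace (word_prod N A w)) \<le> (\<Sum>m<N. \<Sum>j\<in>UNIV. op_norm (A j) ^ length w)"
    unfolding mat_trace_def carrier_matD(1)[OF word_prod_carrier[OF A]]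
    by (rule sum_norm_le) (use entry in auto)
  thus ?thesis by simp
qed

text \<open>Log-convexity of \<open>Gamma\<close> at the midpoint of \<open>1\<close> and \<open>n + 1\<close>.\<close>

lemma Gamma_half_le_sqrt_fact: "Gamma (real n / 2 + 1) \<le> sqrt (fact n)"
proof -
  have "(ln \<circ> Gamma) ((1 - 1/2) *\<^sub>R 1 + (1/2) *\<^sub>R real (Suc n)) \<le> (1 - 1/2) * (ln \<circ> Gamma) (1::real) + (1/2) * (ln \<circ> Gamma) (real (Suc n))"
    by (rule convex_onD[OF log_convex_Gamma_real]) auto
  moreover have "(1 - 1/2) *\<^sub>R (1::real) + (1/2) *\<^sub>R real (Suc n) = real n / 2 + 1" by (simp add: field_simps)
  moreover have "Gamma (real (Suc n)) = fact n" by (rule Gamma_fact[of n, simplified add.commute of_nat_Suc[symmetric]])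
  ultimately have "ln (Gamma (real n / 2 + 1)) \<le> (1/2) * ln (fact n)" by simp
  also have "\<dots> = ln (sqrt (fact n))" by (simp add: ln_sqrt)
  finally show ?thesis by (subst (asm) ln_le_cancel_iff) (auto intro!: Gamma_real_pos)
qed

lemma summable_Gamma_half:
  fixes x :: real
  assumes "0 \<le> x"
  shows "summable (\<lambda>n. x ^ n * Gamma (real n / 2 + 1) / fact n)"
proof (rule summable_comparison_test')
  show "summable (\<lambda>n. x ^ n / sqrt (fact n))"
  proof (rule summable_ratio_test)
    show "(1/2::real) < 1" by simp
    fix n :: nat assume n: "n \<ge> nat \<lceil>4 * x\<^sup>2\<rceil>"
    have "4 * x\<^sup>2 \<le> real n" using n by linarith
    hence "(2 * x)\<^sup>2 \<le> real (Suc n)" by (simp add: power_mult_distrib)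
    hence le: "2 * x \<le> sqrt (real (Suc n))" by (rule real_le_rsqrt)
    have pos: "sqrt (real (Suc n)) > 0" by simp
    have "x / sqrt (real (Suc n)) \<le> 1/2" using le pos by (simp add: field_simps del: of_nat_Suc)
    hence "x ^ n / sqrt (fact n) * (x / sqrt (real (Suc n))) \<le> x ^ n / sqrt (fact n) * (1/2)"
      using assms by (intro mult_left_mono) auto
    thus "norm (x ^ Suc n / sqrt (fact (Suc n))) \<le> 1/2 * norm (x ^ n / sqrt (fact n))"
      using assms by (simp add: real_sqrt_mult mult_ac abs_mult)
  qed
  fix n :: nat assume "n \<ge> 0"
  have "0 < Gamma (real n / 2 + 1)" by (rule Gamma_real_pos) simp
  moreover have "Gamma (real n / 2 + 1) / fact n \<le> 1 / sqrt (fact n)"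
    using Gamma_half_le_sqrt_fact[of n] real_div_sqrt[of "fact n"]
    by (simp add: divide_simps) (metis fact_ge_zero mult_left_mono real_sqrt_ge_zero real_sqrt_mult_self abs_of_nonneg mult.commute)
  hence "x ^ n * (Gamma (real n / 2 + 1) / fact n) \<le> x ^ n * (1 / sqrt (fact n))"
    using assms by (intro mult_left_mono) auto
  ultimately show "norm (x ^ n * Gamma (real n / 2 + 1) / fact n) \<le> x ^ n / sqrt (fact n)"
    using assms by simp
qed

context wigner_family
begin

definition trace_majorant :: "real \<Rightarrow> nat \<Rightarrow> real" where
  "trace_majorant \<kappa> n = real CARD('d) * (\<kappa> ^ n * Gamma (real n / 2 + 1))"

lemma trace_majorant_nonneg: "0 < \<kappa> \<Longrightarrow> 0 \<le> trace_majorant \<kappa> n"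
  unfolding trace_majorant_def
  by (intro mult_nonneg_nonneg) (auto intro!: less_imp_le Gamma_real_pos)

definition scaled_trace :: "'d list \<Rightarrow> 'w \<Rightarrow> complex" where
  "scaled_trace w \<omega> = mat_trace (word_prod N (\<lambda>j. A j \<omega>) w) / of_real (real N powr (real (length w) / 2 + 1))"

lemma scaled_trace_measurable: "scaled_trace w \<in> borel_measurable M"
  unfolding scaled_trace_def by (intro borel_measurable_divide trace_measurable borel_measurable_const)

lemma norm_scaled_trace_le:
  assumes "\<omega> \<in> space M"
  shows "norm (scaled_trace w \<omega>) \<le> (\<Sum>j\<in>UNIV. real N powr (- real (length w) / 2) * op_norm (A j \<omega>) ^ length w)"
proof -
  let ?n = "length w"
  have N: "real N > 0" using N_pos by simp
  have "norm (scaled_trace w \<omega>) = norm (mat_trace (word_prod N (\<lambda>j. A j \<omega>) w)) / real N powr (real ?n / 2 + 1)"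
    by (simp add: scaled_trace_def norm_divide)
  also have "\<dots> \<le> (real N * (\<Sum>j\<in>UNIV. op_norm (A j \<omega>) ^ ?n)) / real N powr (real ?n / 2 + 1)"
    by (intro divide_right_mono norm_mat_trace_word_prod_le carrier assms) simp
  also have "\<dots> = real N powr (- real ?n / 2) * (\<Sum>j\<in>UNIV. op_norm (A j \<omega>) ^ ?n)"
    using N by (simp add: powr_add powr_minus_divide)
  finally show ?thesis by (simp add: sum_distrib_left)
qed

lemma nn_integral_scaled_trace:
  assumes op: "\<And>p i. (\<integral>\<^sup>+\<omega>. ennreal (real N powr (- real p / 2) * op_norm (A i \<omega>) ^ p) \<partial>M)
        \<le> ennreal (\<kappa> ^ p * Gamma (real p / 2 + 1))" and \<kappa>: "\<kappa> > 0"
  shows "(\<integral>\<^sup>+\<omega>. ennreal (norm (scaled_trace w \<omega>)) \<partial>M) \<le> ennreal (trace_majorant \<kappa> (length w))"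
proof -
  let ?n = "length w"
  let ?f = "\<lambda>j \<omega>. real N powr (- real ?n / 2) * op_norm (A j \<omega>) ^ ?n"
  have f0: "0 \<le> ?f j \<omega>" if "\<omega> \<in> space M" for j \<omega>
    by (intro mult_nonneg_nonneg zero_le_power op_norm_nonneg[OF carrier[OF that]]) simp
  have G0: "0 \<le> \<kappa> ^ ?n * Gamma (real ?n / 2 + 1)"
    using \<kappa> by (intro mult_nonneg_nonneg) (auto intro!: less_imp_le Gamma_real_pos)
  have "(\<integral>\<^sup>+\<omega>. ennreal (norm (scaled_trace w \<omega>)) \<partial>M) \<le> (\<integral>\<^sup>+\<omega>. (\<Sum>j\<in>UNIV. ennreal (?f j \<omega>)) \<partial>M)"
  proof (rule nn_integral_mono)
    fix \<omega> assume w: "\<omega> \<in> space M"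
    have "ennreal (norm (scaled_trace w \<omega>)) \<le> ennreal (\<Sum>j\<in>UNIV. ?f j \<omega>)"
      by (rule ennreal_leI[OF norm_scaled_trace_le[OF w]])
    also have "\<dots> = (\<Sum>j\<in>UNIV. ennreal (?f j \<omega>))" by (rule sum_ennreal[symmetric]) (rule f0[OF w])
    finally show "ennreal (norm (scaled_trace w \<omega>)) \<le> (\<Sum>j\<in>UNIV. ennreal (?f j \<omega>))" .
  qed
  also have "\<dots> = (\<Sum>j\<in>UNIV. \<integral>\<^sup>+\<omega>. ennreal (?f j \<omega>) \<partial>M)"
  proof (rule nn_integral_sum)
    fix j
    have "(\<lambda>\<omega>. op_norm (A j \<omega>)) \<in> borel_measurable M" by (rule op_norm_measurable[OF carrier entry_measurable])
    thus "(\<lambda>\<omega>. ennreal (?f j \<omega>)) \<in> borel_measurable M" by simp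
  qed
  also have "\<dots> \<le> (\<Sum>j\<in>(UNIV::'d set). ennreal (\<kappa> ^ ?n * Gamma (real ?n / 2 + 1)))" by (intro sum_mono op)
  also have "\<dots> = ennreal (trace_majorant \<kappa> ?n)"
    unfolding trace_majorant_def using G0 by (simp add: ennreal_mult ennreal_of_nat_eq_real_of_nat)
  finally show ?thesis .
qed

text \<open>Expectation and Picard series may be exchanged because the expected absolute values are summable: the
operator norm bound makes them at most \<open>(d (V t - V s))^n / n!\<close> times \<open>trace_majorant \<kappa> n\<close>. For fixed
\<open>\<omega>\<close> the series is dominated by exponential series in the norms of the matrices.\<close>

lemma expected_trace_series:
  fixes \<gamma> :: "real \<Rightarrow> real^'d"
  assumes op: "\<And>p i. (\<integral>\<^sup>+\<omega>. ennreal (real N powr (- real p / 2) * op_norm (A i \<omega>) ^ p) \<partial>M)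
        \<le> ennreal (\<kappa> ^ p * Gamma (real p / 2 + 1))" and \<kappa>: "\<kappa> > 0"
    and cp: "controlled_path (\<lambda>j u. vec_nth (\<gamma> u) j) V T"
    and sol: "\<And>\<omega>. \<omega> \<in> space M \<Longrightarrow> unitary_CDE_solution N (\<lambda>j. A j \<omega>) \<gamma> s T (Z \<omega>)"
    and st: "0 \<le> s" "s \<le> t" "t \<le> T"
  defines "S \<equiv> controlled_path.sig (\<lambda>j u. vec_nth (\<gamma> u) j)"
  defines "a \<equiv> \<lambda>n. \<i> ^ n * (\<Sum>w\<in>words n. S w s t * (mf.trace_moment w / of_real (real N powr (real (length w) / 2 + 1))))"
  shows "a sums (1 / of_nat N * (\<integral>\<omega>. mat_trace (Z \<omega> t) \<partial>M))"
    and "norm (mf.trace_moment w / of_real (real N powr (real (length w) / 2 + 1))) \<le> trace_majorant \<kappa> (length w)"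
    and "norm (a n) \<le> (real CARD('d) * (V t - V s)) ^ n / fact n * trace_majorant \<kappa> n"
proof -
  interpret P: controlled_path "\<lambda>j u. vec_nth (\<gamma> u) j" V T by (rule cp)
  let ?d = "real CARD('d)" and ?W = "V t - V s"
  let ?B = "trace_majorant \<kappa>"
  have N: "real N > 0" using N_pos by simp
  have W0: "0 \<le> ?W" using P.V_mono[OF st] by simp
  note h = integrable_of_nn_integral_le[OF scaled_trace_measurable nn_integral_scaled_trace[OF op \<kappa>] trace_majorant_nonneg[OF \<kappa>]]
  have sigb: "norm (S w s t) \<le> ?W ^ n / fact n" if "w \<in> words n" for w n
    using P.norm_sig_le[OF st, of w] that by (simp add: S_def)
  have Eh: "(\<integral>\<omega>. scaled_trace w \<omega> \<partial>M) = mf.trace_moment w / of_real (real N powr (real (length w) / 2 + 1))" for w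
    unfolding scaled_trace_def by (simp add: expectation_trace)
  show "norm (mf.trace_moment w / of_real (real N powr (real (length w) / 2 + 1))) \<le> ?B (length w)"
    using h(3)[of w] unfolding Eh .
  define f where "f n \<omega> = \<i> ^ n * (\<Sum>w\<in>words n. S w s t * scaled_trace w \<omega>)" for n \<omega>
  have f_eq: "f n \<omega> = 1 / of_nat N * ((\<i> / complex_of_real (sqrt (real N))) ^ n * (\<Sum>w\<in>words n. S w s t * mat_trace (word_prod N (\<lambda>j. A j \<omega>) w)))" for n \<omega>
  proof -
    have "real N powr (real n / 2 + 1) = sqrt (real N) ^ n * real N"
    proof -
      have "sqrt (real N) ^ n = (real N powr (1/2)) ^ n" using N by (simp add: powr_half_sqrt)
      also have "\<dots> = real N powr (real n / 2)" using N by (simp add: powr_power)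
      finally show ?thesis using N by (simp add: powr_add)
    qed
    hence p: "complex_of_real (real N powr (real n / 2 + 1)) = complex_of_real (sqrt (real N)) ^ n * of_nat N" by simp
    have "(\<Sum>w\<in>words n. S w s t * scaled_trace w \<omega>) = (\<Sum>w\<in>words n. S w s t * mat_trace (word_prod N (\<lambda>j. A j \<omega>) w)) / (complex_of_real (sqrt (real N)) ^ n * of_nat N)"
      unfolding sum_divide_distrib p[symmetric] by (rule sum.cong) (auto simp: scaled_trace_def)
    thus ?thesis by (simp add: f_def power_divide mult.commute)
  qed
  have f_sums: "(\<lambda>n. f n \<omega>) sums (1 / of_nat N * mat_trace (Z \<omega> t))" if "\<omega> \<in> space M" for \<omega>
    unfolding f_eq S_def by (intro sums_mult P.CDE_solution_sums[OF sol[OF that] carrier[OF that] _ st] refl)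
  have normf: "norm (f n \<omega>) \<le> (\<Sum>w\<in>words n. ?W ^ n / fact n * norm (scaled_trace w \<omega>))" for n \<omega>
  proof -
    have "norm (f n \<omega>) = norm (\<Sum>w\<in>words n. S w s t * scaled_trace w \<omega>)" by (simp add: f_def norm_mult norm_power)
    also have "\<dots> \<le> (\<Sum>w\<in>words n. ?W ^ n / fact n * norm (scaled_trace w \<omega>))"
      by (rule sum_norm_le) (simp only: norm_mult, intro mult_right_mono sigb norm_ge_zero)
    finally show ?thesis .
  qed
  have int_f: "integrable M (f n)" for n
    unfolding f_def by (intro integrable_mult_right Bochner_Integration.integrable_sum h(1))
  have Ef: "(\<integral>\<omega>. f n \<omega> \<partial>M) = a n" for n
    unfolding f_def a_def by (simp add: h(1) Eh)
  have Enormf: "(\<integral>\<omega>. norm (f n \<omega>) \<partial>M) \<le> (?d * ?W) ^ n / fact n * ?B n" for n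
  proof -
    have "(\<integral>\<omega>. norm (f n \<omega>) \<partial>M) \<le> (\<integral>\<omega>. (\<Sum>w\<in>words n. ?W ^ n / fact n * norm (scaled_trace w \<omega>)) \<partial>M)"
      by (intro integral_mono integrable_norm int_f Bochner_Integration.integrable_sum integrable_mult_right h(1) normf)
    also have "\<dots> = (\<Sum>w\<in>words n. ?W ^ n / fact n * (\<integral>\<omega>. norm (scaled_trace w \<omega>) \<partial>M))"
      using h(1) by (subst Bochner_Integration.integral_sum) auto
    also have "\<dots> \<le> (\<Sum>w\<in>(words n :: 'd list set). ?W ^ n / fact n * ?B n)"
    proof (intro sum_mono mult_left_mono)
      fix w :: "'d list" assume "w \<in> words n"
      thus "(\<integral>\<omega>. norm (scaled_trace w \<omega>) \<partial>M) \<le> ?B n" using h(2)[of w] by simp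
    qed (use W0 in auto)
    also have "\<dots> = (?d * ?W) ^ n / fact n * ?B n" by (simp add: card_words power_mult_distrib)
    finally show ?thesis .
  qed
  show "norm (a n) \<le> (?d * ?W) ^ n / fact n * ?B n"
    unfolding Ef[symmetric] by (rule order_trans[OF integral_norm_bound Enormf])
  have summ: "summable (\<lambda>n. (?d * ?W) ^ n / fact n * ?B n)"
  proof -
    have "summable (\<lambda>n. ?d * ((?d * ?W * \<kappa>) ^ n * Gamma (real n / 2 + 1) / fact n))"
      using W0 \<kappa> by (intro summable_mult summable_Gamma_half) simp
    thus ?thesis by (simp add: trace_majorant_def power_mult_distrib mult_ac)
  qed
  have "(\<lambda>n. \<integral>\<omega>. f n \<omega> \<partial>M) sums (\<integral>\<omega>. (\<Sum>n. f n \<omega>) \<partial>M)"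
  proof (rule sums_integral[OF int_f])
    show "AE \<omega> in M. summable (\<lambda>n. norm (f n \<omega>))"
    proof (rule AE_I2)
      fix \<omega> assume w: "\<omega> \<in> space M"
      define x where "x j = op_norm (A j \<omega>) / sqrt (real N)" for j
      have xn: "real N powr (- real n / 2) * op_norm (A j \<omega>) ^ n = x j ^ n" for j n
      proof -
        have "sqrt (real N) ^ n = (real N powr (1/2)) ^ n" using N by (simp add: powr_half_sqrt)
        also have "\<dots> = real N powr (real n / 2)" using N by (simp add: powr_power)
        finally show ?thesis by (simp add: x_def power_divide powr_minus_divide)
      qed
      have bound: "norm (f n \<omega>) \<le> (\<Sum>j\<in>UNIV. (?d * ?W * x j) ^ n / fact n)" for n
      proof -
        have "norm (f n \<omega>) \<le> (\<Sum>w\<in>words n. ?W ^ n / fact n * norm (scaled_trace w \<omega>))" by (rule normf)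
        also have "\<dots> \<le> (\<Sum>w\<in>(words n :: 'd list set). ?W ^ n / fact n * (\<Sum>j\<in>UNIV. x j ^ n))"
        proof (intro sum_mono mult_left_mono)
          fix v :: "'d list" assume "v \<in> words n"
          hence "length v = n" by simp
          from norm_scaled_trace_le[OF w, of v, unfolded this xn]
          show "norm (scaled_trace v \<omega>) \<le> (\<Sum>j\<in>UNIV. x j ^ n)" .
        qed (use W0 in auto)
        also have "\<dots> = (\<Sum>j\<in>UNIV. (?d * ?W * x j) ^ n / fact n)"
          by (simp add: card_words power_mult_distrib sum_distrib_left mult.assoc)
        finally show ?thesis .
      qed
      have "summable (\<lambda>n. \<Sum>j\<in>UNIV. (?d * ?W * x j) ^ n / fact n)"
      proof (rule summable_sum)
        fix j show "summable (\<lambda>n. (?d * ?W * x j) ^ n / fact n)"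
          using summable_exp[of "?d * ?W * x j"] by (simp add: divide_inverse mult.commute)
      qed
      thus "summable (\<lambda>n. norm (f n \<omega>))"
        by (rule summable_comparison_test'[where N = 0]) (use bound in auto)
    qed
    show "summable (\<lambda>n. \<integral>\<omega>. norm (f n \<omega>) \<partial>M)"
      by (rule summable_comparison_test'[OF summ, where N = 0]) (use Enormf in auto)
  qed
  moreover have "(\<integral>\<omega>. (\<Sum>n. f n \<omega>) \<partial>M) = (\<integral>\<omega>. 1 / of_nat N * mat_trace (Z \<omega> t) \<partial>M)"
    by (rule Bochner_Integration.integral_cong[OF refl]) (rule sums_unique[symmetric, OF f_sums])
  moreover have "(\<integral>\<omega>. 1 / of_nat N * mat_trace (Z \<omega> t) \<partial>M) = 1 / of_nat N * (\<integral>\<omega>. mat_trace (Z \<omega> t) \<partial>M)"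
    by (rule integral_mult_right_zero)
  ultimately show "a sums (1 / of_nat N * (\<integral>\<omega>. mat_trace (Z \<omega> t) \<partial>M))"
    by (simp only: Ef)
qed

end

section \<open>The limit of the expected traces\<close>

theorem theorem3p10:
  fixes M :: "'w measure"
    and A :: "nat \<Rightarrow> 'd::finite \<Rightarrow> 'w \<Rightarrow> complex mat"
    and cA :: "nat \<Rightarrow> real" and \<kappa> T :: real
    and \<gamma> :: "real \<Rightarrow> real^'d"
    and Z :: "nat \<Rightarrow> 'w \<Rightarrow> real \<Rightarrow> real \<Rightarrow> complex mat"
  assumes "prob_space M"
    and T_pos: "T > 0"
    and herm: "\<And>N i \<omega>. N \<ge> 1 \<Longrightarrow> \<omega> \<in> space M \<Longrightarrow> A N i \<omega> \<in> hermitian_mats N"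
    and rv: "\<And>N i m l. N \<ge> 1 \<Longrightarrow> m < N \<Longrightarrow> l < N \<Longrightarrow> (\<lambda>\<omega>. A N i \<omega> $$ (m, l)) \<in> borel_measurable M"
    and moments: "\<And>k N i m l. N \<ge> 1 \<Longrightarrow> m < N \<Longrightarrow> l < N \<Longrightarrow>
      (\<integral>\<^sup>+\<omega>. ennreal (cmod (A N i \<omega> $$ (m, l)) ^ k) \<partial>M) \<le> ennreal (cA k)"
    and mean: "\<And>N i m l. N \<ge> 1 \<Longrightarrow> m < N \<Longrightarrow> l < N \<Longrightarrow> (\<integral>\<omega>. A N i \<omega> $$ (m, l) \<partial>M) = 0"
    and var: "\<And>N i m l. N \<ge> 1 \<Longrightarrow> m < N \<Longrightarrow> l < N \<Longrightarrow> (\<integral>\<omega>. (cmod (A N i \<omega> $$ (m, l)))\<^sup>2 \<partial>M) = 1"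
    and \<kappa>_pos: "\<kappa> > 0"
    and op: "\<And>p N i. N \<ge> 1 \<Longrightarrow>
      (\<integral>\<^sup>+\<omega>. ennreal (real N powr (- real p / 2) * op_norm (A N i \<omega>) ^ p) \<partial>M)
        \<le> ennreal (\<kappa> ^ p * Gamma (real p / 2 + 1))"
    and indep: "\<And>N. N \<ge> 1 \<Longrightarrow>
      prob_space.indep_sets M (entry_sigma M (A N)) {(m, l). m \<le> l \<and> l < N}"
    and uncorrelated: "\<And>N i j m l. N \<ge> 1 \<Longrightarrow> i \<noteq> j \<Longrightarrow> m < N \<Longrightarrow> l < N \<Longrightarrow>
      (\<integral>\<omega>. cnj (A N i \<omega> $$ (m, l)) * A N j \<omega> $$ (m, l) \<partial>M) = 0"
    and path: "\<gamma> \<in> path_space T"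
    and sol: "\<And>N \<omega> s. N \<ge> 1 \<Longrightarrow> \<omega> \<in> space M \<Longrightarrow> 0 \<le> s \<Longrightarrow> s \<le> T \<Longrightarrow>
      unitary_CDE_solution N (\<lambda>j. A N j \<omega>) \<gamma> s T (\<lambda>t. Z N \<omega> s t)"
  shows "\<exists>K :: real \<Rightarrow> real \<Rightarrow> complex. \<forall>s t. 0 \<le> s \<and> s \<le> t \<and> t \<le> T \<longrightarrow>
      (\<lambda>N. 1 / of_nat N * (\<integral>\<omega>. mat_trace (Z N \<omega> s t) \<partial>M)) \<longlonglongrightarrow> K s t \<and>
      (\<exists>I. has_RS_double_integral (\<lambda>u r. K s u * K u r) \<gamma> s t I \<and> K s t = 1 - I) \<and>
      K s s = 1 \<and> K t t = 1"
proof -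
  have cont: "continuous_on {0..T} \<gamma>" and fin: "finite_1_variation \<gamma> 0 T"
    using path by (auto simp: path_space_def)
  define V where "V = variation \<gamma>"
  have cp: "controlled_path (\<lambda>j u. vec_nth (\<gamma> u) j) V T"
  proof
    fix x y :: real and j :: 'd assume h: "0 \<le> x" "x \<le> y" "y \<le> T"
    have "\<bar>vec_nth (\<gamma> y) j - vec_nth (\<gamma> x) j\<bar> \<le> norm (\<gamma> y - \<gamma> x)"
      using component_le_norm_cart[of "\<gamma> y - \<gamma> x" j] by simp
    also have "\<dots> \<le> V y - V x" unfolding V_def by (rule variation_control[OF fin h])
    finally show "\<bar>vec_nth (\<gamma> y) j - vec_nth (\<gamma> x) j\<bar> \<le> V y - V x" .
  next
    show "continuous_on {0..T} V" unfolding V_def using continuous_on_variation[OF fin cont] T_pos by simp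
  qed
  interpret P: controlled_path "\<lambda>j u. vec_nth (\<gamma> u) j" V T by (rule cp)
  have wf: "wigner_family M N (A N) cA" if "N \<ge> 1" for N
    by (intro wigner_family.intro wigner_family_axioms.intro assms(1))
       (use that herm rv moments mean var indep uncorrelated in auto)
  define E where "E N = (\<lambda>L. \<integral>\<omega>. entry_prod (\<lambda>i. A N i \<omega>) L \<partial>M)" for N
  define C where "C = wigner_family.moment_bound cA"
  have mf: "moment_functional N (E N) C" if "N \<ge> 1" for N
  proof -
    interpret wigner_family M N "A N" cA by (rule wf[OF that])
    show ?thesis unfolding E_def C_def by (rule mf.moment_functional_axioms)
  qed
  define B where "B n = real CARD('d) * (\<kappa> ^ n * Gamma (real n / 2 + 1))" for n
  define m where "m N w = moment_functional.trace_moment N (E N) w / of_real (real N powr (real (length w) / 2 + 1))" for N w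
  have m_lim: "(\<lambda>N. m N w) \<longlonglongrightarrow> of_nat (noncrossing_count w)" for w
    unfolding m_def by (rule trace_moment_limit[OF mf])
  have series: "(\<lambda>n. \<i> ^ n * (\<Sum>w\<in>words n. P.sig w s t * m N w)) sums (1 / of_nat N * (\<integral>\<omega>. mat_trace (Z N \<omega> s t) \<partial>M))"
    "norm (m N w) \<le> B (length w)"
    "norm (\<i> ^ n * (\<Sum>w\<in>words n. P.sig w s t * m N w)) \<le> (real CARD('d) * (V t - V s)) ^ n / fact n * B n"
    if N: "N \<ge> 1" and st: "0 \<le> s" "s \<le> t" "t \<le> T" for N s t w n
  proof -
    interpret wigner_family M N "A N" cA by (rule wf[OF N])
    have sT: "s \<le> T" using st by simp
    note * = expected_trace_series[OF op[OF N] \<kappa>_pos cp sol[OF N _ st(1) sT] st,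
        unfolded trace_majorant_def, folded B_def E_def, folded m_def]
    show "(\<lambda>n. \<i> ^ n * (\<Sum>w\<in>words n. P.sig w s t * m N w)) sums (1 / of_nat N * (\<integral>\<omega>. mat_trace (Z N \<omega> s t) \<partial>M))"
      "norm (m N w) \<le> B (length w)"
      "norm (\<i> ^ n * (\<Sum>w\<in>words n. P.sig w s t * m N w)) \<le> (real CARD('d) * (V t - V s)) ^ n / fact n * B n"
      using *(1) *(2)[of w] *(3)[of n] by simp_all
  qed
  have B0: "0 \<le> B n" for n
    unfolding B_def using \<kappa>_pos by (intro mult_nonneg_nonneg) (auto intro!: less_imp_le Gamma_real_pos)
  \<comment> \<open>the pairings inherit the majorant of the moments of which they are the limits\<close>
  have nc: "norm (of_nat (noncrossing_count w) :: complex) \<le> B (length w)" for w :: "'d list"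
  proof (rule tendsto_upperbound[OF tendsto_norm[OF m_lim]])
    show "\<forall>\<^sub>F N in sequentially. norm (m N w) \<le> B (length w)"
      using eventually_ge_at_top[of 1] by eventually_elim (rule series(2)[of _ 0 0], use T_pos in auto)
  qed simp
  define b where "b n = (real CARD('d) * (V T - V 0)) ^ n / fact n * B n" for n
  have VT: "V 0 \<le> V T" using P.V_mono[of 0 T] T_pos by simp
  have mono_b: "(real CARD('d) * (V t - V s)) ^ n / fact n * B n \<le> b n" if "0 \<le> s" "s \<le> t" "t \<le> T" for s t n
  proof -
    have "V 0 \<le> V s" "V s \<le> V t" "V t \<le> V T" using that by (auto intro!: P.V_mono)
    thus ?thesis unfolding b_def
      by (intro mult_right_mono divide_right_mono power_mono mult_left_mono mult_nonneg_nonneg B0) auto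
  qed
  interpret Q: summable_levels "\<lambda>j u. vec_nth (\<gamma> u) j" V T b
  proof
    show "summable b"
    proof -
      have "summable (\<lambda>n. real CARD('d) * ((real CARD('d) * (V T - V 0) * \<kappa>) ^ n * Gamma (real n / 2 + 1) / fact n))"
        using VT \<kappa>_pos by (intro summable_mult summable_Gamma_half) simp
      thus ?thesis unfolding b_def B_def by (simp add: power_mult_distrib mult_ac)
    qed
    fix s t :: real and n assume st: "0 \<le> s" "s \<le> t" "t \<le> T"
    have "norm (P.Klevel n s t) \<le> (\<Sum>w\<in>(words n :: 'd list set). B n * ((V t - V s) ^ n / fact n))"
      unfolding P.Klevel_def
    proof (rule sum_norm_le)
      fix w :: "'d list" assume w: "w \<in> words n"
      show "norm (of_nat (noncrossing_count w) * P.sig w s t) \<le> B n * ((V t - V s) ^ n / fact n)"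
        unfolding norm_mult using nc[of w] P.norm_sig_le[OF st, of w] w B0 by (intro mult_mono) auto
    qed
    also have "\<dots> = (real CARD('d) * (V t - V s)) ^ n / fact n * B n"
      by (simp add: card_words power_mult_distrib)
    also have "\<dots> \<le> b n" by (rule mono_b[OF st])
    finally show "norm (P.Klevel n s t) \<le> b n" .
  qed (use T_pos in auto)
  have lim: "(\<lambda>N. 1 / of_nat N * (\<integral>\<omega>. mat_trace (Z N \<omega> s t) \<partial>M)) \<longlonglongrightarrow> P.Kseries s t"
    if st: "0 \<le> s" "s \<le> t" "t \<le> T" for s t
  proof -
    define a where "a n N = \<i> ^ n * (\<Sum>w\<in>words n. P.sig w s t * m N w)" for n N
    have a_lim: "(\<lambda>N. a n N) \<longlonglongrightarrow> \<i> ^ n * P.Klevel n s t" for n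
    proof -
      have "(\<lambda>N. a n N) \<longlonglongrightarrow> \<i> ^ n * (\<Sum>w\<in>words n. P.sig w s t * of_nat (noncrossing_count w))"
        unfolding a_def by (intro tendsto_intros m_lim)
      thus ?thesis by (simp add: P.Klevel_def mult.commute)
    qed
    \<comment> \<open>the majorant \<open>b\<close> is independent of \<open>N\<close>, so the limit is taken term by term\<close>
    have "((\<lambda>N. \<Sum>n. a n N) \<longlongrightarrow> (\<Sum>n. \<i> ^ n * P.Klevel n s t)) sequentially"
    proof (rule tannerys_theorem[THEN conjunct2, THEN conjunct2])
      show "((\<lambda>N. a n N) \<longlongrightarrow> \<i> ^ n * P.Klevel n s t) sequentially" for n by (rule a_lim)
      show "summable b" by (rule Q.summable_b)
      show "eventually (\<lambda>(n, N). norm (a n N) \<le> b n) (at_top \<times>\<^sub>F sequentially)"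
        unfolding eventually_prod_filter
      proof (intro exI conjI allI impI)
        show "\<forall>\<^sub>F n in at_top. (\<lambda>_::nat. True) n" by simp
        show "\<forall>\<^sub>F N in sequentially. (\<lambda>N. N \<ge> 1) N" by (rule eventually_ge_at_top)
        fix n N :: nat assume "N \<ge> 1"
        from order_trans[OF series(3)[OF this st] mono_b[OF st]]
        show "case (n, N) of (n, N) \<Rightarrow> norm (a n N) \<le> b n" by (simp add: a_def)
      qed
    qed simp
    moreover have "\<forall>\<^sub>F N in sequentially. (\<Sum>n. a n N) = 1 / of_nat N * (\<integral>\<omega>. mat_trace (Z N \<omega> s t) \<partial>M)"
      using eventually_ge_at_top[of 1]
      by eventually_elim (unfold a_def, rule sums_unique[symmetric], rule series(1)[OF _ st])
    ultimately show ?thesis unfolding P.Kseries_def by (rule Lim_transform_eventually)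
  qed
  show ?thesis
  proof (intro exI[of _ P.Kseries] allI impI conjI)
    fix s t assume "0 \<le> s \<and> s \<le> t \<and> t \<le> T"
    hence st: "0 \<le> s" "s \<le> t" "t \<le> T" by auto
    show "(\<lambda>N. 1 / of_nat N * (\<integral>\<omega>. mat_trace (Z N \<omega> s t) \<partial>M)) \<longlonglongrightarrow> P.Kseries s t" by (rule lim[OF st])
    show "\<exists>I. has_RS_double_integral (\<lambda>u r. P.Kseries s u * P.Kseries u r) \<gamma> s t I \<and> P.Kseries s t = 1 - I"
      by (intro exI conjI, rule Q.Kseries_has_RS_double_integral[OF st refl], rule Q.Kseries_functional_equation[OF st])
    show "P.Kseries s s = 1" "P.Kseries t t = 1" using Q.Kseries_refl st by auto
  qed
qed

end
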